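(* Let $k$ be a number field and let $f(x)\in k(x)$ be a rational function of degree $2$ whose post-critical set is $P=\{p_1,\dots,p_r\}$ with $r\ge 3$, where $p_i=f^i(p_r)$ for $i=1,\dots,r$ (so $f(p_{i-1})=p_i$ with indices modulo $r$), and whose two critical points are $p_r$ and $p_{s-1}$ for some integer $1<s\le r$. Assume that one of the following holds: (1) $r$ is odd; or (2) $r$ is even, $s$ is odd, and $\frac{r}{\gcd(r,s-1)}$ is odd. Then the arithmetic and geometric iterated monodromy groups of $f$ do not contain any settled elements. Moreover, for any $a\in\mathbb{P}^1(k)\setminus P$, the arboreal Galois group $G_{f,a}$ of $(f,a)$ is not densely settled.
   Context: Let $T$ be the regular rooted binary tree whose vertices are the finite words over $\{0,1\}$ (the root is the empty word, $v$ is joined to $v0$ and $v1$); the words of length $n$ form level $n$. Let $\Omega=\mathrm{Aut}(T)$ with its profinite topology (the inverse limit of the automorphism groups of the finite truncations $T_n$ consisting of levels $0,\dots,n$). Iterated monodromy groups: the post-critical set of $f$ is $P=\{f^n(c): n\ge1,\ c \text{ a critical point}\}$. For $x_0\in\mathbb{P}^1(k)\setminus P$, the étale fundamental group $\pi_1^{\text{ét}}(\mathbb{P}^1_k\setminus P,x_0)$ acts by monodromy on the tree whose vertices at level $n$ are the points of $f^{-n}(x_0)$ (edges joining $y$ to $f(y)$); identifying this tree with $T$ gives a homomorphism to $\Omega$ whose image, well defined up to conjugation in $\Omega$, is the arithmetic iterated monodromy group $G^{\text{arith}}(f)$. Doing the same with $\pi_1^{\text{ét}}(\mathbb{P}^1_{\bar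 k}\setminus P,x_0)$ gives the geometric iterated monodromy group $G^{\text{geom}}(f)$, a normal subgroup of $G^{\text{arith}}(f)$. Arboreal Galois group: for $a\in\mathbb{P}^1(k)\setminus P$, the absolute Galois group $\mathrm{Gal}(\bar k/k)$ acts on the tree of iterated preimages $f^{-n}(a)$, $n\ge 0$ (a regular binary tree); identifying it with $T$, the image in $\Omega$ is $G_{f,a}$. Settled elements: for $\gamma\in\Omega$ and a vertex $v$ at level $n$, $v$ is in a stable cycle of length $k\ge1$ of $\gamma$ if the orbit $\{(v)\gamma^i: i\ge0\}$ has exactly $k$ elements and, for every $m>n$, all vertices at level $m$ lying above this orbit lie in a single cycle of $\gamma$ of length $2^{m-n}k$. $\gamma$ is settled if the proportion of level-$n$ vertices lying in stable cycles of $\gamma$ tends to $1$ as $n\to\infty$. A subgroup $H\le\Omega$ is densely settled if its settled elements are dense in $H$. *)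

theory Defs
  imports
    "HOL-Analysis.Abstract_Topology"
    "HOL-Algebra.Algebraic_Closure_Type"
    "HOL-Algebra.Bij"
    "HOL-Computational_Algebra.Fraction_Field"
begin

section \<open>The binary tree, its automorphism group, settled elements\<close>

definition tree_adj :: "bool list \<Rightarrow> bool list \<Rightarrow> bool" where
  "tree_adj v w \<longleftrightarrow> (\<exists>b. w = v @ [b]) \<or> (\<exists>b. v = w @ [b])"

definition tree_aut :: "(bool list \<Rightarrow> bool list) set" where
  "tree_aut = {\<gamma>. bij \<gamma> \<and> \<gamma> [] = [] \<and> (\<forall>v w. tree_adj (\<gamma> v) (\<gamma> w) \<longleftrightarrow> tree_adj v w)}"

text \<open>The inverse limit topology: a basis consists of the fibres of the restriction maps from
  \<^const>\<open>tree_aut\<close> to the (finite, discrete) automorphism groups of the truncations to the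
  levels \<open>0,\<dots>,n\<close>.\<close>

definition tree_aut_topology :: "(bool list \<Rightarrow> bool list) topology" where
  "tree_aut_topology = topology_generated_by
     {{\<gamma> \<in> tree_aut. \<forall>w. length w \<le> n \<longrightarrow> \<gamma> w = \<delta> w} | n \<delta>. \<delta> \<in> tree_aut}"

definition forward_orbit :: "('a \<Rightarrow> 'a) \<Rightarrow> 'a \<Rightarrow> 'a set" where
  "forward_orbit \<gamma> v = {(\<gamma> ^^ i) v | i. True}"

definition in_stable_cycle :: "(bool list \<Rightarrow> bool list) \<Rightarrow> bool list \<Rightarrow> nat \<Rightarrow> bool" where
  "in_stable_cycle \<gamma> v k \<longleftrightarrow>
     k \<ge> 1 \<and> card (forward_orbit \<gamma> v) = k \<and>
     (\<forall>m > length v. \<exists>u.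
        {w. length w = m \<and> take (length v) w \<in> forward_orbit \<gamma> v} \<subseteq> forward_orbit \<gamma> u \<and>
        card (forward_orbit \<gamma> u) = 2 ^ (m - length v) * k)"

definition settled :: "(bool list \<Rightarrow> bool list) \<Rightarrow> bool" where
  "settled \<gamma> \<longleftrightarrow>
     (\<lambda>n. real (card {v. length v = n \<and> (\<exists>k. in_stable_cycle \<gamma> v k)})
          / real (card {v :: bool list. length v = n})) \<longlonglongrightarrow> 1"

definition densely_settled :: "(bool list \<Rightarrow> bool list) set \<Rightarrow> bool" where
  "densely_settled H \<longleftrightarrow>
     subtopology tree_aut_topology H closure_of {\<gamma> \<in> H. settled \<gamma>} = H"


section \<open>Rational functions as self-maps of the projective line\<close>

text \<open>The points of the projective line over a field \<open>'a\<close> are the elements of \<open>'a option\<close>, with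
  \<^term>\<open>None\<close> the point at infinity; \<open>'a poly fract\<close> is the field of rational functions.\<close>

definition rf_rep :: "'a::field poly fract \<Rightarrow> 'a poly \<times> 'a poly" where
  "rf_rep h = (THE (p, q). h = Fraction_Field.Fract p q \<and> coprime p q \<and> lead_coeff q = 1)"

definition rf_num :: "'a::field poly fract \<Rightarrow> 'a poly" where
  "rf_num h = fst (rf_rep h)"

definition rf_den :: "'a::field poly fract \<Rightarrow> 'a poly" where
  "rf_den h = snd (rf_rep h)"

definition rf_degree :: "'a::field poly fract \<Rightarrow> nat" where
  "rf_degree h = max (Polynomial.degree (rf_num h)) (Polynomial.degree (rf_den h))"

text \<open>At infinity, the value is read off from the homogenisations of degree \<^term>\<open>rf_degree h\<close>.\<close>

definition rf_eval :: "'a::field poly fract \<Rightarrow> 'a option \<Rightarrow> 'a option" where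
  "rf_eval h y =
     (let (u, v) = (case y of
          Some z \<Rightarrow> (poly (rf_num h) z, poly (rf_den h) z)
        | None \<Rightarrow> (Polynomial.coeff (rf_num h) (rf_degree h),
                   Polynomial.coeff (rf_den h) (rf_degree h)))
      in if v = 0 then None else Some (u / v))"

definition rf_map :: "('a::field \<Rightarrow> 'b::field) \<Rightarrow> 'a poly fract \<Rightarrow> 'b poly fract" where
  "rf_map i h = Fraction_Field.Fract (map_poly i (rf_num h)) (map_poly i (rf_den h))"

definition rf_const :: "'a::field \<Rightarrow> 'a poly fract" where
  "rf_const c = Fraction_Field.Fract [:c:] 1"

definition rf_X :: "'a::field poly fract" where
  "rf_X = Fraction_Field.Fract [:0, 1:] 1"

text \<open>\<open>rf_comp h g\<close> is \<open>h(g(x))\<close>; it is used for non-constant \<open>g\<close> only.\<close>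

definition rf_comp :: "'a::field poly fract \<Rightarrow> 'a poly fract \<Rightarrow> 'a poly fract" where
  "rf_comp h g =
     poly (map_poly rf_const (rf_num h)) g / poly (map_poly rf_const (rf_den h)) g"

definition rf_iter :: "'a::field poly fract \<Rightarrow> nat \<Rightarrow> 'a poly fract" where
  "rf_iter f n = ((\<lambda>g. rf_comp f g) ^^ n) rf_X"

text \<open>The polynomial whose homogenisation of degree \<^term>\<open>rf_degree f\<close> cuts out the divisor
  \<open>f\<^sup>*(w)\<close>.  Its order of vanishing at infinity is the drop in degree.\<close>

definition fibre_poly :: "'a::field poly fract \<Rightarrow> 'a option \<Rightarrow> 'a poly" where
  "fibre_poly f w = (case w of
       Some c \<Rightarrow> rf_num f - Polynomial.smult c (rf_den f)
     | None \<Rightarrow> rf_den f)"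

definition ramification_index :: "'a::field poly fract \<Rightarrow> 'a option \<Rightarrow> nat" where
  "ramification_index f y = (let F = fibre_poly f (rf_eval f y) in case y of
       Some z \<Rightarrow> Polynomial.order z F
     | None \<Rightarrow> rf_degree f - Polynomial.degree F)"

definition critical_points :: "'a::field poly fract \<Rightarrow> 'a option set" where
  "critical_points f = {y. ramification_index f y > 1}"

definition post_critical_set :: "'a::field poly fract \<Rightarrow> 'a option set" where
  "post_critical_set f = {(rf_eval f ^^ n) c | n c. n \<ge> 1 \<and> c \<in> critical_points f}"

text \<open>An identification of the binary tree with the tree of iterated preimages of \<open>x\<close>.  The
  vertex \<open>w\<close> is sent to the point \<open>\<phi> w\<close> on level \<^term>\<open>length w\<close>; the same point may occur on
  several levels if \<open>x\<close> is periodic.\<close>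

definition tree_labelling ::
  "'a::field poly fract \<Rightarrow> 'a option \<Rightarrow> (bool list \<Rightarrow> 'a option) \<Rightarrow> bool" where
  "tree_labelling f x \<phi> \<longleftrightarrow>
     (\<forall>n. bij_betw \<phi> {w. length w = n} {y. (rf_eval f ^^ n) y = x}) \<and>
     (\<forall>w b. rf_eval f (\<phi> (w @ [b])) = \<phi> w)"


section \<open>The etale fundamental group of the projective line minus finitely many points\<close>

subsection \<open>Finite etale algebras\<close>

text \<open>An algebra over a commutative ring \<open>A\<close> is a pair \<open>(B, \<iota>)\<close> with \<open>\<iota> : A \<rightarrow> B\<close>.  Below,
  \<open>algebra_dual\<close> is \<open>Hom\<^sub>A(B, A)\<close>.\<close>

definition algebra_dual ::
  "('a, 'm) ring_scheme \<Rightarrow> ('b, 'n) ring_scheme \<Rightarrow> ('a \<Rightarrow> 'b) \<Rightarrow> ('b \<Rightarrow> 'a) set" where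
  "algebra_dual A B \<iota> = {\<theta> \<in> carrier B \<rightarrow>\<^sub>E carrier A.
     (\<forall>x\<in>carrier B. \<forall>y\<in>carrier B. \<theta> (x \<oplus>\<^bsub>B\<^esub> y) = \<theta> x \<oplus>\<^bsub>A\<^esub> \<theta> y) \<and>
     (\<forall>a\<in>carrier A. \<forall>x\<in>carrier B. \<theta> (\<iota> a \<otimes>\<^bsub>B\<^esub> x) = a \<otimes>\<^bsub>A\<^esub> \<theta> x)}"

text \<open>\<open>B\<close> is finite etale over \<open>A\<close> iff it is finitely generated projective as an \<open>A\<close>-module and
  its trace form is perfect.  The elements \<open>e i\<close> and functionals \<open>\<theta> i\<close> form a dual basis, which
  exists iff \<open>B\<close> is finitely generated projective; the trace of an endomorphism \<open>u\<close> is then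
  \<open>\<Sum>i. \<theta> i (u (e i))\<close>, independently of the dual basis.\<close>

definition finite_etale ::
  "('a, 'm) ring_scheme \<Rightarrow> ('b, 'n) ring_scheme \<Rightarrow> ('a \<Rightarrow> 'b) \<Rightarrow> bool" where
  "finite_etale A B \<iota> \<longleftrightarrow>
     cring B \<and> \<iota> \<in> ring_hom A B \<inter> extensional (carrier A) \<and>
     (\<exists>(n::nat) e \<theta>.
        (\<forall>i<n. e i \<in> carrier B \<and> \<theta> i \<in> algebra_dual A B \<iota>) \<and>
        (\<forall>x\<in>carrier B. x = (\<Oplus>\<^bsub>B\<^esub>i\<in>{..<n}. \<iota> (\<theta> i x) \<otimes>\<^bsub>B\<^esub> e i)) \<and>
        bij_betw
          (\<lambda>x. \<lambda>y\<in>carrier B. \<Oplus>\<^bsub>A\<^esub>i\<in>{..<n}. \<theta> i ((x \<otimes>\<^bsub>B\<^esub> y) \<otimes>\<^bsub>B\<^esub> e i))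
          (carrier B) (algebra_dual A B \<iota>))"

definition algebra_hom ::
  "('a, 'm) ring_scheme \<Rightarrow> ('b, 'n) ring_scheme \<times> ('a \<Rightarrow> 'b) \<Rightarrow>
   ('c, 'o) ring_scheme \<times> ('a \<Rightarrow> 'c) \<Rightarrow> ('b \<Rightarrow> 'c) set" where
  "algebra_hom A V W =
     {h \<in> ring_hom (fst V) (fst W) \<inter> extensional (carrier (fst V)).
        \<forall>a\<in>carrier A. h (snd V a) = snd W a}"


subsection \<open>The fundamental group as automorphism group of a fibre functor\<close>

text \<open>Throughout, \<open>'a\<close> is an algebraic closure of its subfield \<open>F\<close>, and \<open>S\<close> is a finite nonempty
  set of points of the projective line over \<open>'a\<close>, stable under the automorphisms of \<open>'a\<close>
  over \<open>F\<close>.  Then \<open>coord_ring F S\<close> is the ring of functions on the affine curve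
  obtained from the projective line over \<open>F\<close> by removing \<open>S\<close>.\<close>

definition coord_ring :: "'a::field set \<Rightarrow> 'a option set \<Rightarrow> 'a poly fract ring" where
  "coord_ring F S = ring_of_type_algebra \<lparr> carrier :=
     {h. (\<exists>p q. q \<noteq> 0 \<and> h = Fraction_Field.Fract p q \<and>
               range (Polynomial.coeff p) \<subseteq> F \<and> range (Polynomial.coeff q) \<subseteq> F) \<and>
         (\<forall>y. y \<notin> S \<longrightarrow> rf_eval h y \<noteq> None)} \<rparr>"

definition eval_hom :: "'a::field poly fract ring \<Rightarrow> 'a option \<Rightarrow> 'a poly fract \<Rightarrow> 'a" where
  "eval_hom B y = (\<lambda>h\<in>carrier B. the (rf_eval h y))"

text \<open>Finite etale covers of an affine scheme are the spectra of finite etale algebras over its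
  ring of functions.  Algebras with underlying set in the type \<open>'a poly fract\<close> represent all
  isomorphism classes, because a finite algebra over the infinite ring \<open>coord_ring F S\<close> has
  at most the cardinality of that ring.\<close>

definition etale_covers ::
  "'a::field set \<Rightarrow> 'a option set \<Rightarrow>
   ('a poly fract ring \<times> ('a poly fract \<Rightarrow> 'a poly fract)) set" where
  "etale_covers F S = {(B, \<iota>). finite_etale (coord_ring F S) B \<iota>}"

definition etale_fibre ::
  "'a::field set \<Rightarrow> 'a option set \<Rightarrow> 'a option \<Rightarrow>
   'a poly fract ring \<times> ('a poly fract \<Rightarrow> 'a poly fract) \<Rightarrow> ('a poly fract \<Rightarrow> 'a) set" where
  "etale_fibre F S x V =
     algebra_hom (coord_ring F S) V (ring_of_type_algebra, eval_hom (coord_ring F S) x)"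

text \<open>The automorphisms of the fibre functor: families of permutations of the fibres over the
  geometric point \<open>x\<close>, natural in the cover.\<close>

definition etale_pi1 ::
  "'a::field set \<Rightarrow> 'a option set \<Rightarrow> 'a option \<Rightarrow>
   ('a poly fract ring \<times> ('a poly fract \<Rightarrow> 'a poly fract) \<Rightarrow>
     ('a poly fract \<Rightarrow> 'a) \<Rightarrow> ('a poly fract \<Rightarrow> 'a)) set" where
  "etale_pi1 F S x =
     {\<sigma> \<in> (\<Pi>\<^sub>E V\<in>etale_covers F S. Bij (etale_fibre F S x V)).
        \<forall>V\<in>etale_covers F S. \<forall>W\<in>etale_covers F S.
        \<forall>h\<in>algebra_hom (coord_ring F S) V W. \<forall>\<psi>\<in>etale_fibre F S x W.
          \<sigma> V (compose (carrier (fst V)) \<psi> h) = compose (carrier (fst V)) (\<sigma> W \<psi>) h}"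


section \<open>Iterated monodromy groups and arboreal Galois groups\<close>

text \<open>The cover of the complement of the post-critical set \<open>P\<close> given by \<open>f\<^sup>n\<close>, restricted to the
  complement of \<open>f\<^sup>-\<^sup>n(P)\<close>.  A point \<open>y\<close> with \<open>f\<^sup>n(y) = x\<close> corresponds to the element
  \<open>eval_hom \<dots> y\<close> of its fibre over \<open>x\<close>.\<close>

definition iterate_cover ::
  "'a::field set \<Rightarrow> 'a poly fract \<Rightarrow> nat \<Rightarrow>
   'a poly fract ring \<times> ('a poly fract \<Rightarrow> 'a poly fract)" where
  "iterate_cover F f n =
     (coord_ring F {y. (rf_eval f ^^ n) y \<in> post_critical_set f},
      \<lambda>h\<in>carrier (coord_ring F (post_critical_set f)). rf_comp h (rf_iter f n))"

text \<open>The image of the fundamental group in \<^const>\<open>tree_aut\<close>, with respect to a labelling \<open>\<phi>\<close> of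
  the tree of iterated preimages of \<open>x\<close>.  The arithmetic group has the fundamental group over
  the base field \<open>'k\<close>, the geometric group the one over its algebraic closure.\<close>

definition iterated_monodromy ::
  "'a::field set \<Rightarrow> 'a poly fract \<Rightarrow> 'a option \<Rightarrow> (bool list \<Rightarrow> 'a option) \<Rightarrow>
   (bool list \<Rightarrow> bool list) set" where
  "iterated_monodromy F f x \<phi> =
     {\<gamma> \<in> tree_aut. \<exists>\<sigma>\<in>etale_pi1 F (post_critical_set f) x. \<forall>w.
        eval_hom (fst (iterate_cover F f (length w))) (\<phi> (\<gamma> w)) =
        \<sigma> (iterate_cover F f (length w))
          (eval_hom (fst (iterate_cover F f (length w))) (\<phi> w))}"

definition base_change :: "'k::field poly fract \<Rightarrow> 'k alg_closure poly fract" where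
  "base_change = rf_map to_ac"

definition G_arith ::
  "'k::field poly fract \<Rightarrow> 'k option \<Rightarrow> (bool list \<Rightarrow> 'k alg_closure option) \<Rightarrow>
   (bool list \<Rightarrow> bool list) set" where
  "G_arith f x \<phi> = iterated_monodromy (range to_ac) (base_change f) (map_option to_ac x) \<phi>"

definition G_geom ::
  "'k::field poly fract \<Rightarrow> 'k option \<Rightarrow> (bool list \<Rightarrow> 'k alg_closure option) \<Rightarrow>
   (bool list \<Rightarrow> bool list) set" where
  "G_geom f x \<phi> = iterated_monodromy UNIV (base_change f) (map_option to_ac x) \<phi>"

definition absolute_galois_group :: "('k::field alg_closure \<Rightarrow> 'k alg_closure) set" where
  "absolute_galois_group =
     {\<tau> \<in> ring_iso ring_of_type_algebra ring_of_type_algebra. \<forall>c. \<tau> (to_ac c) = to_ac c}"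

text \<open>The image of the absolute Galois group in \<^const>\<open>tree_aut\<close>; here the base point, and hence
  the action, is encoded in the labelling \<open>\<phi>\<close> of the tree of iterated preimages.\<close>

definition arboreal_galois_group ::
  "(bool list \<Rightarrow> 'k::field alg_closure option) \<Rightarrow> (bool list \<Rightarrow> bool list) set" where
  "arboreal_galois_group \<phi> =
     {\<gamma> \<in> tree_aut. \<exists>\<tau>\<in>absolute_galois_group. \<forall>w. \<phi> (\<gamma> w) = map_option \<tau> (\<phi> w)}"

definition number_field :: "'k::field_char_0 itself \<Rightarrow> bool" where
  "number_field _ \<longleftrightarrow>
     (\<exists>B :: 'k set. finite B \<and> module.span (\<lambda>(c::rat) x. of_rat c * x) B = UNIV)"

end

theory Submission
  imports Defs
begin

text \<open>If a vertex \<open>v\<close> lies in a stable cycle of length \<open>k\<close> of \<open>\<gamma>\<close>, then \<open>\<gamma>\<^sup>k\<close> fixes \<open>v\<close> and acts on every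
  level above \<open>v\<close> as a single cycle, hence with sign \<open>-1\<close>. Over a point \<open>y\<close>, the sign on level
  \<open>n + 1\<close> is the action on a square root of a constant times \<open>(y - f\<^sup>n(v\<^sub>1)) / (y - f\<^sup>n(v\<^sub>2))\<close>, where
  \<open>v\<^sub>1, v\<^sub>2\<close> are the critical values. With \<open>d = s - 1\<close> we have \<open>v\<^sub>2 = f\<^sup>d(v\<^sub>1)\<close>, so for the levels with
  \<open>n = 0, d, \<dots>, (q - 1) d\<close>, \<open>q = r / gcd(r, d)\<close>, these functions telescope to a constant \<open>K\<close>. As \<open>q\<close>
  is odd in both cases, the element underlying \<open>\<gamma>\<^sup>k\<close> negates \<open>\<surd>K\<close>. The same applies to \<open>\<gamma>\<^sup>2\<^sup>k\<close> and a
  child of \<open>v\<close>, with the same \<open>K\<close>; but the square of an element negating \<open>\<surd>K\<close> fixes it. So not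
  a single stable cycle exists in the monodromy groups, which contain the arboreal groups by
  specialisation.

  For an element of the fundamental group, the action on square roots is its action on double
  covers, and the sign on a level is transported down the tower of covers by the norm.\<close>

section \<open>Finite etale algebras\<close>

text \<open>Both critical points are totally ramified, so in Moebius coordinates with divisors
  \<open>c1 - c2\<close> upstairs and \<open>v1 - v2\<close> downstairs \<open>f\<close> is squaring
  up to a constant. Each step of the tower of preimages thus adjoins one square root, whose sign
  separates the two points of a fibre. This function has to be defined over the base field, and for
  the arithmetic group rationality of the critical points is the obstacle. Oddness of
  \<open>q\<close> removes it: conjugate critical points would force \<open>r\<close> to divide
  \<open>2 d\<close>, hence \<open>d\<close>, while 0 < d < r.

  Elements of the fundamental group act only on fibres of covers, so a square root of a unit is
  realised as a point of a double cover. The norm carries signs downwards for this reason: if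
  \<sigma> swaps the points x0, x1 over y and its square negates a root z0 over x0, then \<sigma>
  sends z0 to some z1 and z1 to -z0, so it negates z0 z1, a root of the norm at y. A constant K is
  special because its double cover is pulled back from the base; the sign found there no longer
  refers to the vertex.\<close>

locale quadratic_extension =
  B: cring B + W: cring W
  for B :: "('b, 'n) ring_scheme" and W :: "('c, 'o) ring_scheme" +
  fixes j :: "'b \<Rightarrow> 'c" and S :: 'c and u :: 'b
  assumes hom: "j \<in> ring_hom B W"
    and root_closed [simp]: "S \<in> carrier W"
    and disc_closed [simp]: "u \<in> carrier B"
    and root_square: "S \<otimes>\<^bsub>W\<^esub> S = j u"
    and decomposition: "w \<in> carrier W \<Longrightarrow>
      \<exists>a\<in>carrier B. \<exists>b\<in>carrier B. w = j a \<oplus>\<^bsub>W\<^esub> j b \<otimes>\<^bsub>W\<^esub> S"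
    and uniqueness: "\<lbrakk>a \<in> carrier B; b \<in> carrier B; a' \<in> carrier B; b' \<in> carrier B;
      j a \<oplus>\<^bsub>W\<^esub> j b \<otimes>\<^bsub>W\<^esub> S = j a' \<oplus>\<^bsub>W\<^esub> j b' \<otimes>\<^bsub>W\<^esub> S\<rbrakk> \<Longrightarrow> a = a' \<and> b = b'"
begin

lemma hom_closed [simp]: "b \<in> carrier B \<Longrightarrow> j b \<in> carrier W"
  using hom ring_hom_closed by metis

lemma hom_mult: "a \<in> carrier B \<Longrightarrow> b \<in> carrier B \<Longrightarrow> j (a \<otimes>\<^bsub>B\<^esub> b) = j a \<otimes>\<^bsub>W\<^esub> j b"
  using hom ring_hom_mult by metis

lemma hom_add: "a \<in> carrier B \<Longrightarrow> b \<in> carrier B \<Longrightarrow> j (a \<oplus>\<^bsub>B\<^esub> b) = j a \<oplus>\<^bsub>W\<^esub> j b"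
  using hom ring_hom_add by metis

lemma hom_one: "j \<one>\<^bsub>B\<^esub> = \<one>\<^bsub>W\<^esub>"
  using hom ring_hom_one by metis

lemma hom_zero: "j \<zero>\<^bsub>B\<^esub> = \<zero>\<^bsub>W\<^esub>"
  using hom B.ring_axioms W.ring_axioms ring_hom_zero by metis

text \<open>The coordinates of \<open>w\<close> in the basis 1, \<open>S\<close>;
  \<open>decomposition\<close> and \<open>uniqueness\<close> make \<open>W\<close> free of rank two
  over \<open>B\<close>.\<close>

definition part0 :: "'c \<Rightarrow> 'b" where
  "part0 w = (THE a. a \<in> carrier B \<and> (\<exists>b\<in>carrier B. w = j a \<oplus>\<^bsub>W\<^esub> j b \<otimes>\<^bsub>W\<^esub> S))"

definition part1 :: "'c \<Rightarrow> 'b" where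
  "part1 w = (THE b. b \<in> carrier B \<and> (\<exists>a\<in>carrier B. w = j a \<oplus>\<^bsub>W\<^esub> j b \<otimes>\<^bsub>W\<^esub> S))"

lemma part0_eq: "a \<in> carrier B \<Longrightarrow> b \<in> carrier B \<Longrightarrow> part0 (j a \<oplus>\<^bsub>W\<^esub> j b \<otimes>\<^bsub>W\<^esub> S) = a"
  unfolding part0_def by (rule the_equality) (use uniqueness in blast)+

lemma part1_eq: "a \<in> carrier B \<Longrightarrow> b \<in> carrier B \<Longrightarrow> part1 (j a \<oplus>\<^bsub>W\<^esub> j b \<otimes>\<^bsub>W\<^esub> S) = b"
  unfolding part1_def by (rule the_equality) (use uniqueness in blast)+

lemma part_closed [simp]:
  assumes "w \<in> carrier W"
  shows "part0 w \<in> carrier B" "part1 w \<in> carrier B"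
  using decomposition[OF assms] by (auto simp: part0_eq part1_eq)

lemma parts: "w \<in> carrier W \<Longrightarrow> w = j (part0 w) \<oplus>\<^bsub>W\<^esub> j (part1 w) \<otimes>\<^bsub>W\<^esub> S"
  using decomposition[of w] by (auto simp: part0_eq part1_eq)

lemma add_decomposed:
  assumes "a \<in> carrier B" "b \<in> carrier B" "c \<in> carrier B" "d \<in> carrier B"
  shows "(j a \<oplus>\<^bsub>W\<^esub> j b \<otimes>\<^bsub>W\<^esub> S) \<oplus>\<^bsub>W\<^esub> (j c \<oplus>\<^bsub>W\<^esub> j d \<otimes>\<^bsub>W\<^esub> S) =
    j (a \<oplus>\<^bsub>B\<^esub> c) \<oplus>\<^bsub>W\<^esub> j (b \<oplus>\<^bsub>B\<^esub> d) \<otimes>\<^bsub>W\<^esub> S"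
  using assms by (simp add: hom_add W.l_distr W.a_ac)

lemma mult_decomposed:
  assumes "a \<in> carrier B" "b \<in> carrier B" "c \<in> carrier B" "d \<in> carrier B"
  shows "(j a \<oplus>\<^bsub>W\<^esub> j b \<otimes>\<^bsub>W\<^esub> S) \<otimes>\<^bsub>W\<^esub> (j c \<oplus>\<^bsub>W\<^esub> j d \<otimes>\<^bsub>W\<^esub> S) =
    j (a \<otimes>\<^bsub>B\<^esub> c \<oplus>\<^bsub>B\<^esub> u \<otimes>\<^bsub>B\<^esub> (b \<otimes>\<^bsub>B\<^esub> d)) \<oplus>\<^bsub>W\<^esub>
    j (a \<otimes>\<^bsub>B\<^esub> d \<oplus>\<^bsub>B\<^esub> b \<otimes>\<^bsub>B\<^esub> c) \<otimes>\<^bsub>W\<^esub> S"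
proof -
  have "(j b \<otimes>\<^bsub>W\<^esub> S) \<otimes>\<^bsub>W\<^esub> (j d \<otimes>\<^bsub>W\<^esub> S) = (S \<otimes>\<^bsub>W\<^esub> S) \<otimes>\<^bsub>W\<^esub> (j b \<otimes>\<^bsub>W\<^esub> j d)"
    using assms by (simp add: W.m_ac)
  then show ?thesis
    using assms
    by (simp add: hom_add hom_mult W.l_distr W.r_distr root_square W.a_ac W.m_ac)
qed

lemma part_add:
  assumes "v \<in> carrier W" "w \<in> carrier W"
  shows "part0 (v \<oplus>\<^bsub>W\<^esub> w) = part0 v \<oplus>\<^bsub>B\<^esub> part0 w" "part1 (v \<oplus>\<^bsub>W\<^esub> w) = part1 v \<oplus>\<^bsub>B\<^esub> part1 w"
  using add_decomposed[of "part0 v" "part1 v" "part0 w" "part1 w"] parts[OF assms(1)]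
    parts[OF assms(2)] assms by (auto simp: part0_eq part1_eq)

lemma part_mult:
  assumes "v \<in> carrier W" "w \<in> carrier W"
  shows "part0 (v \<otimes>\<^bsub>W\<^esub> w) = part0 v \<otimes>\<^bsub>B\<^esub> part0 w \<oplus>\<^bsub>B\<^esub> u \<otimes>\<^bsub>B\<^esub> (part1 v \<otimes>\<^bsub>B\<^esub> part1 w)"
    "part1 (v \<otimes>\<^bsub>W\<^esub> w) = part0 v \<otimes>\<^bsub>B\<^esub> part1 w \<oplus>\<^bsub>B\<^esub> part1 v \<otimes>\<^bsub>B\<^esub> part0 w"
  using mult_decomposed[of "part0 v" "part1 v" "part0 w" "part1 w"] parts[OF assms(1)]
    parts[OF assms(2)] assms by (auto simp: part0_eq part1_eq)

lemma part_hom: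
  assumes "b \<in> carrier B"
  shows "part0 (j b) = b" "part1 (j b) = \<zero>\<^bsub>B\<^esub>"
proof -
  have "j b = j b \<oplus>\<^bsub>W\<^esub> j \<zero>\<^bsub>B\<^esub> \<otimes>\<^bsub>W\<^esub> S"
    using assms by (simp add: hom_zero)
  then show "part0 (j b) = b" "part1 (j b) = \<zero>\<^bsub>B\<^esub>"
    using assms part0_eq[of b "\<zero>\<^bsub>B\<^esub>"] part1_eq[of b "\<zero>\<^bsub>B\<^esub>"] by auto
qed

lemma part_root: "part0 S = \<zero>\<^bsub>B\<^esub>" "part1 S = \<one>\<^bsub>B\<^esub>"
proof -
  have "S = j \<zero>\<^bsub>B\<^esub> \<oplus>\<^bsub>W\<^esub> j \<one>\<^bsub>B\<^esub> \<otimes>\<^bsub>W\<^esub> S"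
    by (simp add: hom_zero hom_one)
  then show "part0 S = \<zero>\<^bsub>B\<^esub>" "part1 S = \<one>\<^bsub>B\<^esub>"
    using part0_eq[of "\<zero>\<^bsub>B\<^esub>" "\<one>\<^bsub>B\<^esub>"] part1_eq[of "\<zero>\<^bsub>B\<^esub>" "\<one>\<^bsub>B\<^esub>"] by auto
qed

lemma part_mult_hom:
  assumes "w \<in> carrier W" "b \<in> carrier B"
  shows "part0 (j b \<otimes>\<^bsub>W\<^esub> w) = b \<otimes>\<^bsub>B\<^esub> part0 w" "part1 (j b \<otimes>\<^bsub>W\<^esub> w) = b \<otimes>\<^bsub>B\<^esub> part1 w"
  using assms by (simp_all add: part_mult part_hom)

end

lemma ring_homD:
  assumes "h \<in> ring_hom R S"
  shows "x \<in> carrier R \<Longrightarrow> h x \<in> carrier S"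
    "x \<in> carrier R \<Longrightarrow> y \<in> carrier R \<Longrightarrow> h (x \<otimes>\<^bsub>R\<^esub> y) = h x \<otimes>\<^bsub>S\<^esub> h y"
    "x \<in> carrier R \<Longrightarrow> y \<in> carrier R \<Longrightarrow> h (x \<oplus>\<^bsub>R\<^esub> y) = h x \<oplus>\<^bsub>S\<^esub> h y"
    "h \<one>\<^bsub>R\<^esub> = \<one>\<^bsub>S\<^esub>"
  using assms by (auto simp: ring_hom_def)

text \<open>Block summation for the doubled basis of a quadratic extension: the elements
  \<open>e i\<close> occupy the indices below \<open>n\<close>, their products with the root the
  next \<open>n\<close>.\<close>

lemma sum_two_copies:
  assumes "abelian_monoid G" and "\<And>i. i < n \<Longrightarrow> f i \<in> carrier G" "\<And>i. i < n \<Longrightarrow> g i \<in> carrier G"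
  shows "(\<Oplus>\<^bsub>G\<^esub>i\<in>{..<2 * (n::nat)}. if i < n then f i else g (i - n)) =
    (\<Oplus>\<^bsub>G\<^esub>i\<in>{..<n}. f i) \<oplus>\<^bsub>G\<^esub> (\<Oplus>\<^bsub>G\<^esub>i\<in>{..<n}. g i)"
proof -
  interpret abelian_monoid G by fact
  let ?h = "\<lambda>i. if i < n then f i else g (i - n)"
  have h: "?h i \<in> carrier G" if "i < 2 * n" for i
    using assms(2,3)[of i] assms(3)[of "i - n"] that by auto
  have h': "g (i - n) \<in> carrier G" if "n \<le> i" "i < 2 * n" for i
    using assms(3)[of "i - n"] that by auto
  have split: "{..<2 * n} = {..<n} \<union> {n..<2 * n}" by auto
  have im: "(\<lambda>i. i + n) ` {..<n} = {n..<2 * n}"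
  proof -
    have "x \<in> (\<lambda>i. i + n) ` {..<n}" if "n \<le> x" "x < 2 * n" for x
      using that by (intro image_eqI[of _ _ "x - n"]) auto
    then show ?thesis by auto
  qed
  have "(\<Oplus>\<^bsub>G\<^esub>i\<in>{..<2 * n}. ?h i) = (\<Oplus>\<^bsub>G\<^esub>i\<in>{..<n}. ?h i) \<oplus>\<^bsub>G\<^esub> (\<Oplus>\<^bsub>G\<^esub>i\<in>{n..<2 * n}. ?h i)"
    unfolding split by (rule finsum_Un_disjoint) (use assms(2) h' in auto)
  moreover have "(\<Oplus>\<^bsub>G\<^esub>i\<in>{..<n}. ?h i) = (\<Oplus>\<^bsub>G\<^esub>i\<in>{..<n}. f i)"
    by (rule finsum_cong') (use assms in auto)
  moreover have "(\<Oplus>\<^bsub>G\<^esub>i\<in>{n..<2 * n}. ?h i) = (\<Oplus>\<^bsub>G\<^esub>i\<in>{..<n}. ?h (i + n))"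
    unfolding im[symmetric] by (rule finsum_reindex) (use h' im in \<open>auto simp: inj_on_def\<close>)
  moreover have "(\<Oplus>\<^bsub>G\<^esub>i\<in>{..<n}. ?h (i + n)) = (\<Oplus>\<^bsub>G\<^esub>i\<in>{..<n}. g i)"
    by (rule finsum_cong') (use assms in auto)
  ultimately show ?thesis by simp
qed

text \<open>The trivial cover, which is level 0 of the tower: 1 alone is a dual basis, and the trace
  form is multiplication.\<close>

lemma finite_etale_self:
  assumes "cring A"
  shows "finite_etale A A (\<lambda>a\<in>carrier A. a)"
proof -
  interpret cring A by fact
  let ?i = "\<lambda>a\<in>carrier A. a"
  have hom: "?i \<in> ring_hom A A"
    by (rule ring_hom_memI) auto
  have dual_one: "?i \<in> algebra_dual A A ?i"
    by (auto simp: algebra_dual_def)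
  have T: "(\<lambda>x. \<lambda>y\<in>carrier A. \<Oplus>\<^bsub>A\<^esub>i\<in>{..<Suc 0}. ?i ((x \<otimes>\<^bsub>A\<^esub> y) \<otimes>\<^bsub>A\<^esub> \<one>\<^bsub>A\<^esub>)) x =
      (\<lambda>y\<in>carrier A. x \<otimes>\<^bsub>A\<^esub> y)" if "x \<in> carrier A" for x
    using that by (auto simp: restrict_def fun_eq_iff lessThan_Suc)
  have "bij_betw (\<lambda>x. \<lambda>y\<in>carrier A. x \<otimes>\<^bsub>A\<^esub> y) (carrier A) (algebra_dual A A ?i)"
  proof (rule bij_betw_imageI)
    show "inj_on (\<lambda>x. \<lambda>y\<in>carrier A. x \<otimes>\<^bsub>A\<^esub> y) (carrier A)"
    proof (rule inj_onI)
      fix x y assume *: "x \<in> carrier A" "y \<in> carrier A"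
        "(\<lambda>z\<in>carrier A. x \<otimes>\<^bsub>A\<^esub> z) = (\<lambda>z\<in>carrier A. y \<otimes>\<^bsub>A\<^esub> z)"
      from fun_cong[OF this(3), of "\<one>\<^bsub>A\<^esub>"] *(1,2) show "x = y" by simp
    qed
    show "(\<lambda>x. \<lambda>y\<in>carrier A. x \<otimes>\<^bsub>A\<^esub> y) ` carrier A = algebra_dual A A ?i"
    proof (intro equalityI subsetI)
      fix \<theta> assume "\<theta> \<in> (\<lambda>x. \<lambda>y\<in>carrier A. x \<otimes>\<^bsub>A\<^esub> y) ` carrier A"
      then show "\<theta> \<in> algebra_dual A A ?i"
        by (auto simp: algebra_dual_def r_distr m_ac)
    next
      fix \<theta> assume t: "\<theta> \<in> algebra_dual A A ?i"
      then have cl: "\<theta> \<one>\<^bsub>A\<^esub> \<in> carrier A"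
        by (auto simp: algebra_dual_def)
      have lin: "\<theta> (y \<otimes>\<^bsub>A\<^esub> \<one>\<^bsub>A\<^esub>) = y \<otimes>\<^bsub>A\<^esub> \<theta> \<one>\<^bsub>A\<^esub>" if "y \<in> carrier A" for y
      proof -
        have "\<theta> (?i y \<otimes>\<^bsub>A\<^esub> \<one>\<^bsub>A\<^esub>) = y \<otimes>\<^bsub>A\<^esub> \<theta> \<one>\<^bsub>A\<^esub>"
          using t that one_closed unfolding algebra_dual_def by blast
        then show ?thesis using that by (simp del: r_one)
      qed
      have "\<theta> = (\<lambda>y\<in>carrier A. \<theta> \<one>\<^bsub>A\<^esub> \<otimes>\<^bsub>A\<^esub> y)"
      proof
        fix y show "\<theta> y = (\<lambda>y\<in>carrier A. \<theta> \<one>\<^bsub>A\<^esub> \<otimes>\<^bsub>A\<^esub> y) y"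
        proof (cases "y \<in> carrier A")
          case True
          then show ?thesis using lin[OF True] cl by (simp add: m_comm)
        next
          case False
          then show ?thesis using t by (auto simp: algebra_dual_def PiE_def extensional_def)
        qed
      qed
      then show "\<theta> \<in> (\<lambda>x. \<lambda>y\<in>carrier A. x \<otimes>\<^bsub>A\<^esub> y) ` carrier A" using cl by blast
    qed
  qed
  then have bij: "bij_betw (\<lambda>x. \<lambda>y\<in>carrier A. \<Oplus>\<^bsub>A\<^esub>i\<in>{..<Suc 0}. ?i ((x \<otimes>\<^bsub>A\<^esub> y) \<otimes>\<^bsub>A\<^esub> \<one>\<^bsub>A\<^esub>))
      (carrier A) (algebra_dual A A ?i)"
    using T by (subst bij_betw_cong[where g = "\<lambda>x. \<lambda>y\<in>carrier A. x \<otimes>\<^bsub>A\<^esub> y"]) auto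
  show ?thesis
    unfolding finite_etale_def
  proof (intro conjI exI)
    show "\<forall>i<Suc 0. (\<lambda>i. \<one>\<^bsub>A\<^esub>) i \<in> carrier A \<and> (\<lambda>i. ?i) i \<in> algebra_dual A A ?i"
      using dual_one by simp
    show "\<forall>x\<in>carrier A. x = (\<Oplus>\<^bsub>A\<^esub>i\<in>{..<Suc 0}. ?i ((\<lambda>i. ?i) i x) \<otimes>\<^bsub>A\<^esub> (\<lambda>i. \<one>\<^bsub>A\<^esub>) i)"
      by (simp add: lessThan_Suc)
    show "bij_betw (\<lambda>x. \<lambda>y\<in>carrier A. \<Oplus>\<^bsub>A\<^esub>i\<in>{..<Suc 0}. (\<lambda>i. ?i) i ((x \<otimes>\<^bsub>A\<^esub> y) \<otimes>\<^bsub>A\<^esub> (\<lambda>i. \<one>\<^bsub>A\<^esub>) i))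
      (carrier A) (algebra_dual A A ?i)" using bij .
  qed (use hom assms in auto)
qed

text \<open>The trace of \<open>W\<close> over \<open>B\<close> kills the root and doubles
  \<open>B\<close>. In the coordinates \<open>part0\<close>, \<open>part1\<close> the trace form
  over \<open>A\<close> is therefore the orthogonal sum of two copies of the trace form of
  \<open>B\<close>, scaled by 2 and by \<open>2 u\<close>. Both scalars are units, so perfectness is
  inherited. The theorem serves the formal double covers as well as the steps of the tower of
  preimages.\<close>

theorem (in quadratic_extension) finite_etale_quadratic:
  assumes "cring A" and et: "finite_etale A B \<iota>"
    and u: "u \<in> Units B" and two: "\<one>\<^bsub>B\<^esub> \<oplus>\<^bsub>B\<^esub> \<one>\<^bsub>B\<^esub> \<in> Units B"
  shows "finite_etale A W (\<lambda>a\<in>carrier A. j (\<iota> a))"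
proof -
  interpret A: cring A by fact
  from et obtain n e \<theta> where
    \<iota>: "\<iota> \<in> ring_hom A B" and
    e: "\<And>i. i < n \<Longrightarrow> e i \<in> carrier B" and
    \<theta>: "\<And>i. i < n \<Longrightarrow> \<theta> i \<in> algebra_dual A B \<iota>" and
    dual: "\<And>x. x \<in> carrier B \<Longrightarrow> x = (\<Oplus>\<^bsub>B\<^esub>i\<in>{..<n::nat}. \<iota> (\<theta> i x) \<otimes>\<^bsub>B\<^esub> e i)" and
    bij: "bij_betw (\<lambda>x. \<lambda>y\<in>carrier B. \<Oplus>\<^bsub>A\<^esub>i\<in>{..<n}. \<theta> i ((x \<otimes>\<^bsub>B\<^esub> y) \<otimes>\<^bsub>B\<^esub> e i))
          (carrier B) (algebra_dual A B \<iota>)"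
    unfolding finite_etale_def by blast
  note \<iota> = ring_homD[OF \<iota>]
  define \<kappa> where "\<kappa> = (\<lambda>a\<in>carrier A. j (\<iota> a))"
  have \<kappa>: "\<kappa> a = j (\<iota> a)" if "a \<in> carrier A" for a
    using that by (simp add: \<kappa>_def)
  have \<theta>c [simp]: "\<theta> i x \<in> carrier A" if "i < n" "x \<in> carrier B" for i x
    using \<theta>[OF that(1)] that(2) by (auto simp: algebra_dual_def)
  \<comment> \<open>\<open>T\<close> is the trace of \<open>B\<close> over \<open>A\<close>, and
    perfectness of the trace form says that \<open>\<Phi>\<close> is bijective.\<close>
  define T where "T = (\<lambda>b. \<Oplus>\<^bsub>A\<^esub>i\<in>{..<n}. \<theta> i (b \<otimes>\<^bsub>B\<^esub> e i))"
  define \<Phi> where "\<Phi> = (\<lambda>b. \<lambda>c\<in>carrier B. T (b \<otimes>\<^bsub>B\<^esub> c))"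
  have bij: "bij_betw \<Phi> (carrier B) (algebra_dual A B \<iota>)"
    using bij unfolding \<Phi>_def T_def .
  have \<Phi>dual: "\<Phi> b \<in> algebra_dual A B \<iota>" if "b \<in> carrier B" for b
    using bij that bij_betwE by blast
  \<comment> \<open>As \<open>T\<close> is \<open>\<Phi>\<close> at 1, its linearity is contained in
    the fact that \<open>\<Phi>\<close> lands in the dual.\<close>
  have T1: "T b = \<Phi> \<one>\<^bsub>B\<^esub> b" if "b \<in> carrier B" for b
    using that by (simp add: \<Phi>_def)
  have Tc [simp]: "T b \<in> carrier A" if "b \<in> carrier B" for b
    using \<Phi>dual[OF B.one_closed] that by (auto simp: T1 algebra_dual_def)
  have Tadd: "T (b \<oplus>\<^bsub>B\<^esub> c) = T b \<oplus>\<^bsub>A\<^esub> T c" if "b \<in> carrier B" "c \<in> carrier B" for b c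
    using \<Phi>dual[OF B.one_closed] that by (auto simp: T1 algebra_dual_def)
  have Tlin: "T (\<iota> a \<otimes>\<^bsub>B\<^esub> b) = a \<otimes>\<^bsub>A\<^esub> T b" if "a \<in> carrier A" "b \<in> carrier B" for a b
    using \<Phi>dual[OF B.one_closed] that \<iota> by (auto simp: T1 algebra_dual_def)
  define e' where "e' = (\<lambda>i. if i < n then j (e i) else j (e (i - n)) \<otimes>\<^bsub>W\<^esub> S)"
  define \<theta>' where "\<theta>' = (\<lambda>i. if i < n then (\<lambda>w\<in>carrier W. \<theta> i (part0 w))
    else (\<lambda>w\<in>carrier W. \<theta> (i - n) (part1 w)))"
  have lift0: "(\<lambda>w\<in>carrier W. \<eta> (part0 w)) \<in> algebra_dual A W \<kappa>"
    if "\<eta> \<in> algebra_dual A B \<iota>" for \<eta>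
    using that by (auto simp: algebra_dual_def part_add \<kappa> \<iota> part_mult_hom)
  have lift1: "(\<lambda>w\<in>carrier W. \<eta> (part1 w)) \<in> algebra_dual A W \<kappa>"
    if "\<eta> \<in> algebra_dual A B \<iota>" for \<eta>
    using that by (auto simp: algebra_dual_def part_add \<kappa> \<iota> part_mult_hom)
  have e'c: "e' i \<in> carrier W" if "i < 2 * n" for i
    using that e[of i] e[of "i - n"] by (auto simp: e'_def)
  have \<theta>'d: "\<theta>' i \<in> algebra_dual A W \<kappa>" if "i < 2 * n" for i
    using that \<theta>[of i] \<theta>[of "i - n"] lift0 lift1 by (auto simp: \<theta>'_def)
  have j_sum: "j (\<Oplus>\<^bsub>B\<^esub>i\<in>I. f i) = (\<Oplus>\<^bsub>W\<^esub>i\<in>I. j (f i))"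
    if "finite I" "\<And>i. i \<in> I \<Longrightarrow> f i \<in> carrier B" for I :: "nat set" and f
    using that by (induction I rule: finite_induct) (auto simp: hom_zero hom_add)
  have dual': "w = (\<Oplus>\<^bsub>W\<^esub>i\<in>{..<2 * n}. \<kappa> (\<theta>' i w) \<otimes>\<^bsub>W\<^esub> e' i)" if w: "w \<in> carrier W" for w
  proof -
    have "(\<Oplus>\<^bsub>W\<^esub>i\<in>{..<2 * n}. \<kappa> (\<theta>' i w) \<otimes>\<^bsub>W\<^esub> e' i) =
      (\<Oplus>\<^bsub>W\<^esub>i\<in>{..<2 * n}. if i < n then j (\<iota> (\<theta> i (part0 w)) \<otimes>\<^bsub>B\<^esub> e i)
         else j (\<iota> (\<theta> (i - n) (part1 w)) \<otimes>\<^bsub>B\<^esub> e (i - n)) \<otimes>\<^bsub>W\<^esub> S)"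
    proof (rule W.finsum_cong')
      fix i assume i: "i \<in> {..<2 * n}"
      then show "\<kappa> (\<theta>' i w) \<otimes>\<^bsub>W\<^esub> e' i = (if i < n then j (\<iota> (\<theta> i (part0 w)) \<otimes>\<^bsub>B\<^esub> e i)
         else j (\<iota> (\<theta> (i - n) (part1 w)) \<otimes>\<^bsub>B\<^esub> e (i - n)) \<otimes>\<^bsub>W\<^esub> S)"
        using w e[of i] e[of "i - n"] by (auto simp: \<theta>'_def e'_def \<kappa> \<iota> hom_mult W.m_assoc)
    qed (use w e \<iota> in auto)
    also have "\<dots> = (\<Oplus>\<^bsub>W\<^esub>i\<in>{..<n}. j (\<iota> (\<theta> i (part0 w)) \<otimes>\<^bsub>B\<^esub> e i)) \<oplus>\<^bsub>W\<^esub>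
        (\<Oplus>\<^bsub>W\<^esub>i\<in>{..<n}. j (\<iota> (\<theta> i (part1 w)) \<otimes>\<^bsub>B\<^esub> e i) \<otimes>\<^bsub>W\<^esub> S)"
      by (rule sum_two_copies) (use w e \<iota> W.abelian_monoid_axioms in auto)
    also have "\<dots> = (\<Oplus>\<^bsub>W\<^esub>i\<in>{..<n}. j (\<iota> (\<theta> i (part0 w)) \<otimes>\<^bsub>B\<^esub> e i)) \<oplus>\<^bsub>W\<^esub>
        (\<Oplus>\<^bsub>W\<^esub>i\<in>{..<n}. j (\<iota> (\<theta> i (part1 w)) \<otimes>\<^bsub>B\<^esub> e i)) \<otimes>\<^bsub>W\<^esub> S"
      by (subst W.finsum_ldistr) (use w e \<iota> in auto)
    also have "\<dots> = j (\<Oplus>\<^bsub>B\<^esub>i\<in>{..<n}. \<iota> (\<theta> i (part0 w)) \<otimes>\<^bsub>B\<^esub> e i) \<oplus>\<^bsub>W\<^esub>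
        j (\<Oplus>\<^bsub>B\<^esub>i\<in>{..<n}. \<iota> (\<theta> i (part1 w)) \<otimes>\<^bsub>B\<^esub> e i) \<otimes>\<^bsub>W\<^esub> S"
      by (subst (1 2) j_sum) (use w e \<iota> in auto)
    also have "\<dots> = w"
      using dual[of "part0 w"] dual[of "part1 w"] parts[OF w] w by simp
    finally show ?thesis by simp
  qed
  define T' where "T' = (\<lambda>w. \<Oplus>\<^bsub>A\<^esub>i\<in>{..<2 * n}. \<theta>' i (w \<otimes>\<^bsub>W\<^esub> e' i))"
  define \<Phi>' where "\<Phi>' = (\<lambda>w. \<lambda>v\<in>carrier W. T' (w \<otimes>\<^bsub>W\<^esub> v))"
  \<comment> \<open>In the doubled basis both diagonal blocks of multiplication by \<open>w\<close>
    are multiplication by \<open>part0 w\<close>, hence the factor two.\<close>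
  have T': "T' w = T (part0 w \<oplus>\<^bsub>B\<^esub> part0 w)" if w: "w \<in> carrier W" for w
  proof -
    have "T' w = (\<Oplus>\<^bsub>A\<^esub>i\<in>{..<2 * n}. if i < n then \<theta> i (part0 w \<otimes>\<^bsub>B\<^esub> e i)
       else \<theta> (i - n) (part0 w \<otimes>\<^bsub>B\<^esub> e (i - n)))"
      unfolding T'_def
    proof (rule A.finsum_cong')
      fix i assume i: "i \<in> {..<2 * n}"
      then show "\<theta>' i (w \<otimes>\<^bsub>W\<^esub> e' i) = (if i < n then \<theta> i (part0 w \<otimes>\<^bsub>B\<^esub> e i)
         else \<theta> (i - n) (part0 w \<otimes>\<^bsub>B\<^esub> e (i - n)))"
        using w e[of i] e[of "i - n"]
        by (auto simp: \<theta>'_def e'_def part_mult part_hom part_root)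
    qed (use w e in auto)
    also have "\<dots> = T (part0 w) \<oplus>\<^bsub>A\<^esub> T (part0 w)"
      unfolding T_def by (rule sum_two_copies) (use w e A.abelian_monoid_axioms in auto)
    also have "\<dots> = T (part0 w \<oplus>\<^bsub>B\<^esub> part0 w)" using w by (simp add: Tadd)
    finally show ?thesis .
  qed
  let ?two = "\<one>\<^bsub>B\<^esub> \<oplus>\<^bsub>B\<^esub> \<one>\<^bsub>B\<^esub>"
  have two_c [simp]: "?two \<in> carrier B" by simp
  have dbl: "b \<oplus>\<^bsub>B\<^esub> b = ?two \<otimes>\<^bsub>B\<^esub> b" if "b \<in> carrier B" for b
    using that by (simp add: B.l_distr)
  have \<Phi>'_eq: "\<Phi>' w v = T (?two \<otimes>\<^bsub>B\<^esub> (part0 w \<otimes>\<^bsub>B\<^esub> part0 v)) \<oplus>\<^bsub>A\<^esub>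
      T (?two \<otimes>\<^bsub>B\<^esub> (u \<otimes>\<^bsub>B\<^esub> (part1 w \<otimes>\<^bsub>B\<^esub> part1 v)))"
    if "w \<in> carrier W" "v \<in> carrier W" for w v
  proof -
    have "\<Phi>' w v = T (?two \<otimes>\<^bsub>B\<^esub> part0 (w \<otimes>\<^bsub>W\<^esub> v))"
      using that dbl[of "part0 (w \<otimes>\<^bsub>W\<^esub> v)"] by (simp add: \<Phi>'_def T')
    also have "\<dots> = T (?two \<otimes>\<^bsub>B\<^esub> (part0 w \<otimes>\<^bsub>B\<^esub> part0 v) \<oplus>\<^bsub>B\<^esub>
        ?two \<otimes>\<^bsub>B\<^esub> (u \<otimes>\<^bsub>B\<^esub> (part1 w \<otimes>\<^bsub>B\<^esub> part1 v)))"
      using that by (simp add: part_mult B.r_distr)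
    finally show ?thesis using that by (simp add: Tadd)
  qed
  have T0: "T \<zero>\<^bsub>B\<^esub> = \<zero>\<^bsub>A\<^esub>"
    using Tadd[of "\<zero>\<^bsub>B\<^esub>" "\<zero>\<^bsub>B\<^esub>"] by (metis A.add.r_cancel_one' B.l_zero B.zero_closed Tc)
  \<comment> \<open>Testing against \<open>j c\<close> isolates \<open>part0\<close>; testing
    against \<open>j c\<close> times the root isolates \<open>part1\<close>.\<close>
  have \<Phi>'_hom: "\<Phi>' w (j c) = \<Phi> (?two \<otimes>\<^bsub>B\<^esub> part0 w) c"
    if "w \<in> carrier W" "c \<in> carrier B" for w c
    using that by (simp add: \<Phi>'_eq part_hom T0 \<Phi>_def B.m_assoc)
  have \<Phi>'_root: "\<Phi>' w (j c \<otimes>\<^bsub>W\<^esub> S) = \<Phi> (?two \<otimes>\<^bsub>B\<^esub> (u \<otimes>\<^bsub>B\<^esub> part1 w)) c"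
    if "w \<in> carrier W" "c \<in> carrier B" for w c
    using that by (simp add: \<Phi>'_eq part_mult_hom part_root T0 \<Phi>_def B.m_assoc)
  have \<Phi>_ext: "\<Phi> b = \<Phi> c" if "\<And>x. x \<in> carrier B \<Longrightarrow> \<Phi> b x = \<Phi> c x" for b c
    using that by (auto simp: \<Phi>_def restrict_def)
  have \<Phi>_inj: "b = c" if "\<Phi> b = \<Phi> c" "b \<in> carrier B" "c \<in> carrier B" for b c
    using bij that by (auto simp: bij_betw_def inj_on_def)
  have bij': "bij_betw \<Phi>' (carrier W) (algebra_dual A W \<kappa>)"
  proof (rule bij_betw_imageI)
    show "inj_on \<Phi>' (carrier W)"
    proof (rule inj_onI)
      fix v w assume vw: "v \<in> carrier W" "w \<in> carrier W" and eq: "\<Phi>' v = \<Phi>' w"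
      have "\<Phi> (?two \<otimes>\<^bsub>B\<^esub> part0 v) = \<Phi> (?two \<otimes>\<^bsub>B\<^esub> part0 w)"
        using vw eq \<Phi>'_hom by (intro \<Phi>_ext) metis
      then have "?two \<otimes>\<^bsub>B\<^esub> part0 v = ?two \<otimes>\<^bsub>B\<^esub> part0 w"
        using vw by (intro \<Phi>_inj) auto
      then have 0: "part0 v = part0 w"
        using two vw by (meson B.Units_l_cancel part_closed)
      have "\<Phi> (?two \<otimes>\<^bsub>B\<^esub> (u \<otimes>\<^bsub>B\<^esub> part1 v)) = \<Phi> (?two \<otimes>\<^bsub>B\<^esub> (u \<otimes>\<^bsub>B\<^esub> part1 w))"
        using vw eq \<Phi>'_root by (intro \<Phi>_ext) metis
      then have "?two \<otimes>\<^bsub>B\<^esub> (u \<otimes>\<^bsub>B\<^esub> part1 v) = ?two \<otimes>\<^bsub>B\<^esub> (u \<otimes>\<^bsub>B\<^esub> part1 w)"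
        using vw by (intro \<Phi>_inj) auto
      then have "part1 v = part1 w"
        using two u vw by (meson B.Units_l_cancel B.m_closed disc_closed part_closed)
      with 0 show "v = w" using parts vw by metis
    qed
    show "\<Phi>' ` carrier W = algebra_dual A W \<kappa>"
    proof (intro equalityI subsetI)
      fix \<eta> assume "\<eta> \<in> \<Phi>' ` carrier W"
      then obtain w where w: "w \<in> carrier W" and \<eta>: "\<eta> = \<Phi>' w" by blast
      have "T' (w \<otimes>\<^bsub>W\<^esub> (x \<oplus>\<^bsub>W\<^esub> y)) = T' (w \<otimes>\<^bsub>W\<^esub> x) \<oplus>\<^bsub>A\<^esub> T' (w \<otimes>\<^bsub>W\<^esub> y)"
        if "x \<in> carrier W" "y \<in> carrier W" for x y
      proof -
        have "T' (w \<otimes>\<^bsub>W\<^esub> (x \<oplus>\<^bsub>W\<^esub> y)) = T (part0 (w \<otimes>\<^bsub>W\<^esub> x \<oplus>\<^bsub>W\<^esub> w \<otimes>\<^bsub>W\<^esub> y) \<oplus>\<^bsub>B\<^esub>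
           part0 (w \<otimes>\<^bsub>W\<^esub> x \<oplus>\<^bsub>W\<^esub> w \<otimes>\<^bsub>W\<^esub> y))" using w that by (simp add: W.r_distr T')
        also have "\<dots> = T ((part0 (w \<otimes>\<^bsub>W\<^esub> x) \<oplus>\<^bsub>B\<^esub> part0 (w \<otimes>\<^bsub>W\<^esub> x)) \<oplus>\<^bsub>B\<^esub>
            (part0 (w \<otimes>\<^bsub>W\<^esub> y) \<oplus>\<^bsub>B\<^esub> part0 (w \<otimes>\<^bsub>W\<^esub> y)))"
          using w that by (simp add: part_add B.a_ac)
        also have "\<dots> = T' (w \<otimes>\<^bsub>W\<^esub> x) \<oplus>\<^bsub>A\<^esub> T' (w \<otimes>\<^bsub>W\<^esub> y)"
          using w that by (subst Tadd) (auto simp: T')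
        finally show ?thesis .
      qed
      moreover have "T' (w \<otimes>\<^bsub>W\<^esub> (\<kappa> a \<otimes>\<^bsub>W\<^esub> x)) = a \<otimes>\<^bsub>A\<^esub> T' (w \<otimes>\<^bsub>W\<^esub> x)"
        if "a \<in> carrier A" "x \<in> carrier W" for a x
      proof -
        have "w \<otimes>\<^bsub>W\<^esub> (\<kappa> a \<otimes>\<^bsub>W\<^esub> x) = j (\<iota> a) \<otimes>\<^bsub>W\<^esub> (w \<otimes>\<^bsub>W\<^esub> x)"
          using w that \<iota> by (simp add: \<kappa> W.m_lcomm)
        then have "T' (w \<otimes>\<^bsub>W\<^esub> (\<kappa> a \<otimes>\<^bsub>W\<^esub> x)) =
            T (\<iota> a \<otimes>\<^bsub>B\<^esub> (part0 (w \<otimes>\<^bsub>W\<^esub> x) \<oplus>\<^bsub>B\<^esub> part0 (w \<otimes>\<^bsub>W\<^esub> x)))"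
          using w that \<iota> by (simp add: T' part_mult_hom B.r_distr)
        then show ?thesis using w that by (simp add: T' Tlin)
      qed
      ultimately show "\<eta> \<in> algebra_dual A W \<kappa>"
        using w \<iota> by (auto simp: \<eta> \<Phi>'_def algebra_dual_def T' \<kappa>)
    next
      fix \<eta> assume \<eta>: "\<eta> \<in> algebra_dual A W \<kappa>"
      have \<eta>c: "\<eta> w \<in> carrier A" if "w \<in> carrier W" for w
        using \<eta> that by (auto simp: algebra_dual_def)
      have \<eta>a: "\<eta> (v \<oplus>\<^bsub>W\<^esub> w) = \<eta> v \<oplus>\<^bsub>A\<^esub> \<eta> w" if "v \<in> carrier W" "w \<in> carrier W" for v w
        using \<eta> that by (auto simp: algebra_dual_def)
      have \<eta>l: "\<eta> (\<kappa> a \<otimes>\<^bsub>W\<^esub> w) = a \<otimes>\<^bsub>A\<^esub> \<eta> w" if "a \<in> carrier A" "w \<in> carrier W" for a w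
        using \<eta> that by (auto simp: algebra_dual_def)
      have "(\<lambda>c\<in>carrier B. \<eta> (j c)) \<in> algebra_dual A B \<iota>"
        using \<iota> \<eta>c by (auto simp: algebra_dual_def hom_add \<eta>a hom_mult \<eta>l simp flip: \<kappa>)
      then obtain b0 where b0: "b0 \<in> carrier B" "\<Phi> b0 = (\<lambda>c\<in>carrier B. \<eta> (j c))"
        using bij by (metis (no_types, lifting) bij_betw_imp_surj_on imageE)
      have "\<eta> (j (\<iota> a \<otimes>\<^bsub>B\<^esub> c) \<otimes>\<^bsub>W\<^esub> S) = a \<otimes>\<^bsub>A\<^esub> \<eta> (j c \<otimes>\<^bsub>W\<^esub> S)"
        if "a \<in> carrier A" "c \<in> carrier B" for a c
        using \<eta>l[of a "j c \<otimes>\<^bsub>W\<^esub> S"] that \<iota> by (simp add: \<kappa> hom_mult W.m_assoc)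
      then have "(\<lambda>c\<in>carrier B. \<eta> (j c \<otimes>\<^bsub>W\<^esub> S)) \<in> algebra_dual A B \<iota>"
        using \<iota> \<eta>c by (auto simp: algebra_dual_def hom_add \<eta>a W.l_distr)
      then obtain b1 where b1: "b1 \<in> carrier B" "\<Phi> b1 = (\<lambda>c\<in>carrier B. \<eta> (j c \<otimes>\<^bsub>W\<^esub> S))"
        using bij by (metis (no_types, lifting) bij_betw_imp_surj_on imageE)
      \<comment> \<open>These coordinates undo the scalings by 2 and \<open>2 u\<close> of the two
        summands.\<close>
      let ?a = "inv\<^bsub>B\<^esub> ?two \<otimes>\<^bsub>B\<^esub> b0" and ?b = "inv\<^bsub>B\<^esub> u \<otimes>\<^bsub>B\<^esub> (inv\<^bsub>B\<^esub> ?two \<otimes>\<^bsub>B\<^esub> b1)"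
      have ic [simp]: "inv\<^bsub>B\<^esub> ?two \<in> carrier B" "inv\<^bsub>B\<^esub> u \<in> carrier B"
        using two u by auto
      define w where "w = j ?a \<oplus>\<^bsub>W\<^esub> j ?b \<otimes>\<^bsub>W\<^esub> S"
      have w: "w \<in> carrier W" using b0 b1 by (simp add: w_def)
      have p0: "?two \<otimes>\<^bsub>B\<^esub> part0 w = b0"
        using b0 b1 two by (simp add: w_def part0_eq B.m_assoc[symmetric])
      have "u \<otimes>\<^bsub>B\<^esub> part1 w = inv\<^bsub>B\<^esub> ?two \<otimes>\<^bsub>B\<^esub> b1"
        using b0 b1 u by (simp add: w_def part1_eq B.m_assoc[symmetric])
      then have p1: "?two \<otimes>\<^bsub>B\<^esub> (u \<otimes>\<^bsub>B\<^esub> part1 w) = b1"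
        using b1 two by (simp flip: B.m_assoc)
      have "\<Phi>' w = \<eta>"
      proof
        fix v show "\<Phi>' w v = \<eta> v"
        proof (cases "v \<in> carrier W")
          case v: True
          have "\<Phi>' w v = \<Phi>' w (j (part0 v)) \<oplus>\<^bsub>A\<^esub> \<Phi>' w (j (part1 v) \<otimes>\<^bsub>W\<^esub> S)"
            using w v
            by (simp add: \<Phi>'_eq part_hom part_mult_hom part_root T0)
          also have "\<dots> = \<eta> (j (part0 v)) \<oplus>\<^bsub>A\<^esub> \<eta> (j (part1 v) \<otimes>\<^bsub>W\<^esub> S)"
            using w v by (simp add: \<Phi>'_hom \<Phi>'_root p0 p1 b0 b1)
          also have "\<dots> = \<eta> v"
            using parts[OF v] \<eta>a[of "j (part0 v)" "j (part1 v) \<otimes>\<^bsub>W\<^esub> S"] v by simp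
          finally show ?thesis .
        next
          case False
          then show ?thesis
            using \<eta> by (auto simp: \<Phi>'_def algebra_dual_def PiE_def extensional_def)
        qed
      qed
      then show "\<eta> \<in> \<Phi>' ` carrier W" using w by blast
    qed
  qed
  have hom': "\<kappa> \<in> ring_hom A W"
    by (rule ring_hom_memI) (auto simp: \<kappa> \<iota> hom_mult hom_add hom_one)
  have bij'': "bij_betw (\<lambda>x. \<lambda>y\<in>carrier W. \<Oplus>\<^bsub>A\<^esub>i\<in>{..<2 * n}. \<theta>' i ((x \<otimes>\<^bsub>W\<^esub> y) \<otimes>\<^bsub>W\<^esub> e' i))
      (carrier W) (algebra_dual A W \<kappa>)"
    using bij' unfolding \<Phi>'_def T'_def .
  have ex: "\<exists>(n::nat) e \<theta>.
        (\<forall>i<n. e i \<in> carrier W \<and> \<theta> i \<in> algebra_dual A W \<kappa>) \<and>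
        (\<forall>x\<in>carrier W. x = (\<Oplus>\<^bsub>W\<^esub>i\<in>{..<n}. \<kappa> (\<theta> i x) \<otimes>\<^bsub>W\<^esub> e i)) \<and>
        bij_betw
          (\<lambda>x. \<lambda>y\<in>carrier W. \<Oplus>\<^bsub>A\<^esub>i\<in>{..<n}. \<theta> i ((x \<otimes>\<^bsub>W\<^esub> y) \<otimes>\<^bsub>W\<^esub> e i))
          (carrier W) (algebra_dual A W \<kappa>)"
  proof (rule exI[of _ "2 * n"], rule exI[of _ e'], rule exI[of _ \<theta>'], intro conjI)
    show "\<forall>i<2 * n. e' i \<in> carrier W \<and> \<theta>' i \<in> algebra_dual A W \<kappa>"
      using e'c \<theta>'d by simp
    show "\<forall>x\<in>carrier W. x = (\<Oplus>\<^bsub>W\<^esub>i\<in>{..<2 * n}. \<kappa> (\<theta>' i x) \<otimes>\<^bsub>W\<^esub> e' i)"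
      by (rule ballI) (rule dual')
  qed (rule bij'')
  have "\<kappa> \<in> ring_hom A W \<inter> extensional (carrier A)"
    using hom' by (simp add: \<kappa>_def)
  then have "finite_etale A W \<kappa>"
    unfolding finite_etale_def using ex W.cring_axioms by (intro conjI)
  then show ?thesis unfolding \<kappa>_def .
qed

text \<open>The universal property of adjoining a square root. It produces the points of double
  covers (\<open>t\<close> a scalar), maps between covers, and the deck transformation of a step of
  the tower (\<open>t = - S\<close>).\<close>

lemma (in quadratic_extension) extend_hom:
  assumes "cring C" and h: "h \<in> ring_hom B C" and t: "t \<in> carrier C" "t \<otimes>\<^bsub>C\<^esub> t = h u"
  defines "H \<equiv> \<lambda>w\<in>carrier W. h (part0 w) \<oplus>\<^bsub>C\<^esub> h (part1 w) \<otimes>\<^bsub>C\<^esub> t"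
  shows "H \<in> ring_hom W C" "H S = t" "\<And>b. b \<in> carrier B \<Longrightarrow> H (j b) = h b"
proof -
  interpret C: cring C by fact
  note h = ring_homD[OF h]
  have h0: "h \<zero>\<^bsub>B\<^esub> = \<zero>\<^bsub>C\<^esub>"
    using assms(2) B.ring_axioms C.ring_axioms ring_hom_zero by metis
  show "H (j b) = h b" if "b \<in> carrier B" for b
    using that t by (simp add: H_def part_hom h h0)
  show "H S = t"
    using t by (simp add: H_def part_root h h0)
  show "H \<in> ring_hom W C"
  proof (rule ring_hom_memI)
    show "H w \<in> carrier C" if "w \<in> carrier W" for w
      using that t by (simp add: H_def h)
    show "H (v \<oplus>\<^bsub>W\<^esub> w) = H v \<oplus>\<^bsub>C\<^esub> H w" if "v \<in> carrier W" "w \<in> carrier W" for v w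
      using that t by (simp add: H_def part_add h C.l_distr C.a_ac)
    show "H \<one>\<^bsub>W\<^esub> = \<one>\<^bsub>C\<^esub>"
      using t by (simp add: H_def h h0 part_hom flip: hom_one)
    show "H (v \<otimes>\<^bsub>W\<^esub> w) = H v \<otimes>\<^bsub>C\<^esub> H w" if vw: "v \<in> carrier W" "w \<in> carrier W" for v w
    proof -
      have "(h (part1 v) \<otimes>\<^bsub>C\<^esub> t) \<otimes>\<^bsub>C\<^esub> (h (part1 w) \<otimes>\<^bsub>C\<^esub> t) =
          (t \<otimes>\<^bsub>C\<^esub> t) \<otimes>\<^bsub>C\<^esub> (h (part1 v) \<otimes>\<^bsub>C\<^esub> h (part1 w))"
        using vw t(1) by (simp add: h C.m_ac)
      then show ?thesis
        using vw t by (simp add: H_def part_mult h C.l_distr C.r_distr C.a_ac C.m_ac)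
    qed
  qed
qed

text \<open>Uniqueness in the universal property: the restriction to \<open>B\<close> and the image
  of the root determine the map.\<close>

lemma (in quadratic_extension) hom_eqI:
  assumes "cring C" "H \<in> ring_hom W C" "w \<in> carrier W"
  shows "H w = H (j (part0 w)) \<oplus>\<^bsub>C\<^esub> H (j (part1 w)) \<otimes>\<^bsub>C\<^esub> H S"
proof -
  note H = ring_homD[OF assms(2)]
  have "H w = H (j (part0 w) \<oplus>\<^bsub>W\<^esub> j (part1 w) \<otimes>\<^bsub>W\<^esub> S)"
    using parts[OF assms(3)] by simp
  then show ?thesis using assms(3) by (simp add: H)
qed

section \<open>Adjoining a square root\<close>

definition pair_code :: "'c \<times> 'c \<Rightarrow> 'c" where
  "pair_code = (SOME g. inj g)"

text \<open>An infinite set is equinumerous with its square.\<close>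

lemma inj_pair_code:
  assumes "infinite (UNIV :: 'c set)"
  shows "inj (pair_code :: 'c \<times> 'c \<Rightarrow> 'c)"
proof -
  obtain g :: "'c \<times> 'c \<Rightarrow> 'c" where "bij_betw g (UNIV \<times> UNIV) UNIV"
    using card_of_Times_same_infinite[OF assms] card_of_ordIso by blast
  then have "\<exists>g :: 'c \<times> 'c \<Rightarrow> 'c. inj g" by (auto simp: bij_betw_def)
  then show ?thesis unfolding pair_code_def by (rule someI_ex)
qed

text \<open>The ring \<open>B[z] / (z\<^sup>2 - u)\<close>; the pair coding keeps it in the type of \<open>B\<close>, as the
  definition of the fundamental group only sees covers in one type.\<close>

definition quad_ext :: "'c ring \<Rightarrow> 'c \<Rightarrow> 'c ring" where
  "quad_ext B u = \<lparr>
     carrier = pair_code ` (carrier B \<times> carrier B),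
     monoid.mult = (\<lambda>v w. (let (a, b) = inv_into UNIV pair_code v; (c, d) = inv_into UNIV pair_code w in
       pair_code (a \<otimes>\<^bsub>B\<^esub> c \<oplus>\<^bsub>B\<^esub> u \<otimes>\<^bsub>B\<^esub> (b \<otimes>\<^bsub>B\<^esub> d), a \<otimes>\<^bsub>B\<^esub> d \<oplus>\<^bsub>B\<^esub> b \<otimes>\<^bsub>B\<^esub> c))),
     one = pair_code (\<one>\<^bsub>B\<^esub>, \<zero>\<^bsub>B\<^esub>),
     zero = pair_code (\<zero>\<^bsub>B\<^esub>, \<zero>\<^bsub>B\<^esub>),
     add = (\<lambda>v w. (let (a, b) = inv_into UNIV pair_code v; (c, d) = inv_into UNIV pair_code w in
       pair_code (a \<oplus>\<^bsub>B\<^esub> c, b \<oplus>\<^bsub>B\<^esub> d)))\<rparr>"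

definition quad_incl :: "'c ring \<Rightarrow> 'c \<Rightarrow> 'c" where
  "quad_incl B b = pair_code (b, \<zero>\<^bsub>B\<^esub>)"

definition quad_root :: "'c ring \<Rightarrow> 'c" where
  "quad_root B = pair_code (\<zero>\<^bsub>B\<^esub>, \<one>\<^bsub>B\<^esub>)"

context
  fixes B :: "'c ring" and u :: 'c
  assumes inf: "infinite (UNIV :: 'c set)" and B: "cring B" and u: "u \<in> carrier B"
begin

interpretation B: cring B by (fact B)

lemma decode [simp]: "inv_into UNIV pair_code (pair_code (a, b)) = (a :: 'c, b)"
  by (rule inv_f_f) (rule inj_pair_code[OF inf])

lemma pair_code_eq [simp]: "pair_code (a, b) = pair_code (c, d) \<longleftrightarrow> (a :: 'c) = c \<and> b = d"
  using inj_pair_code[OF inf] by (auto dest: injD)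

lemma quad_ext_add: "pair_code (a, b) \<oplus>\<^bsub>quad_ext B u\<^esub> pair_code (c, d) =
    pair_code (a \<oplus>\<^bsub>B\<^esub> c, b \<oplus>\<^bsub>B\<^esub> d)"
  by (simp add: quad_ext_def)

lemma quad_ext_mult: "pair_code (a, b) \<otimes>\<^bsub>quad_ext B u\<^esub> pair_code (c, d) =
    pair_code (a \<otimes>\<^bsub>B\<^esub> c \<oplus>\<^bsub>B\<^esub> u \<otimes>\<^bsub>B\<^esub> (b \<otimes>\<^bsub>B\<^esub> d), a \<otimes>\<^bsub>B\<^esub> d \<oplus>\<^bsub>B\<^esub> b \<otimes>\<^bsub>B\<^esub> c)"
  by (simp add: quad_ext_def)

lemma quad_ext_carrier:
  "w \<in> carrier (quad_ext B u) \<longleftrightarrow> (\<exists>a\<in>carrier B. \<exists>b\<in>carrier B. w = pair_code (a, b))"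
  by (auto simp: quad_ext_def)

lemma quad_ext_zero: "\<zero>\<^bsub>quad_ext B u\<^esub> = pair_code (\<zero>\<^bsub>B\<^esub>, \<zero>\<^bsub>B\<^esub>)"
  by (simp add: quad_ext_def)

lemma quad_ext_one: "\<one>\<^bsub>quad_ext B u\<^esub> = pair_code (\<one>\<^bsub>B\<^esub>, \<zero>\<^bsub>B\<^esub>)"
  by (simp add: quad_ext_def)

lemma cring_quad_ext: "cring (quad_ext B u)"
proof (rule cringI)
  show "abelian_group (quad_ext B u)"
  proof (rule abelian_groupI)
    fix x assume "x \<in> carrier (quad_ext B u)"
    then obtain a b where ab: "a \<in> carrier B" "b \<in> carrier B" "x = pair_code (a, b)"
      by (auto simp: quad_ext_carrier)
    then have "pair_code (\<ominus>\<^bsub>B\<^esub> a, \<ominus>\<^bsub>B\<^esub> b) \<in> carrier (quad_ext B u)"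
      "pair_code (\<ominus>\<^bsub>B\<^esub> a, \<ominus>\<^bsub>B\<^esub> b) \<oplus>\<^bsub>quad_ext B u\<^esub> x = \<zero>\<^bsub>quad_ext B u\<^esub>"
      by (auto simp: quad_ext_carrier quad_ext_add quad_ext_zero B.l_neg)
    then show "\<exists>y\<in>carrier (quad_ext B u). y \<oplus>\<^bsub>quad_ext B u\<^esub> x = \<zero>\<^bsub>quad_ext B u\<^esub>" by blast
  qed (auto simp: quad_ext_carrier quad_ext_add quad_ext_zero B.a_ac)
  show "Group.comm_monoid (quad_ext B u)"
  proof (rule comm_monoidI)
    fix x y z
    assume "x \<in> carrier (quad_ext B u)" "y \<in> carrier (quad_ext B u)" "z \<in> carrier (quad_ext B u)"
    then obtain a b c d e f where
      *: "a \<in> carrier B" "b \<in> carrier B" "c \<in> carrier B" "d \<in> carrier B" "e \<in> carrier B" "f \<in> carrier B"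
      "x = pair_code (a, b)" "y = pair_code (c, d)" "z = pair_code (e, f)"
      by (auto simp: quad_ext_carrier)
    show "(x \<otimes>\<^bsub>quad_ext B u\<^esub> y) \<otimes>\<^bsub>quad_ext B u\<^esub> z = x \<otimes>\<^bsub>quad_ext B u\<^esub> (y \<otimes>\<^bsub>quad_ext B u\<^esub> z)"
      using *(1-6) u unfolding *(7-9)
      by (simp add: quad_ext_mult B.l_distr B.r_distr B.a_ac B.m_ac)
  qed (use u in \<open>auto simp: quad_ext_carrier quad_ext_mult quad_ext_one B.a_ac B.m_ac\<close>)
  fix x y z
  assume "x \<in> carrier (quad_ext B u)" "y \<in> carrier (quad_ext B u)" "z \<in> carrier (quad_ext B u)"
  then show "(x \<oplus>\<^bsub>quad_ext B u\<^esub> y) \<otimes>\<^bsub>quad_ext B u\<^esub> z =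
      x \<otimes>\<^bsub>quad_ext B u\<^esub> z \<oplus>\<^bsub>quad_ext B u\<^esub> y \<otimes>\<^bsub>quad_ext B u\<^esub> z"
    using u by (auto simp: quad_ext_carrier quad_ext_add quad_ext_mult B.l_distr B.r_distr B.a_ac)
qed

lemma quadratic_extension_quad_ext:
  "quadratic_extension B (quad_ext B u) (quad_incl B) (quad_root B) u"
proof -
  have decomp: "quad_incl B a \<oplus>\<^bsub>quad_ext B u\<^esub> quad_incl B b \<otimes>\<^bsub>quad_ext B u\<^esub> quad_root B =
      pair_code (a, b)" if "a \<in> carrier B" "b \<in> carrier B" for a b
    using that u by (simp add: quad_incl_def quad_root_def quad_ext_add quad_ext_mult)
  show ?thesis
  proof (intro quadratic_extension.intro quadratic_extension_axioms.intro B cring_quad_ext)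
    show "quad_incl B \<in> ring_hom B (quad_ext B u)"
      using u by (intro ring_hom_memI)
        (auto simp: quad_incl_def quad_ext_carrier quad_ext_mult quad_ext_add quad_ext_one)
    show "quad_root B \<in> carrier (quad_ext B u)"
      by (auto simp: quad_root_def quad_ext_carrier)
    show "quad_root B \<otimes>\<^bsub>quad_ext B u\<^esub> quad_root B = quad_incl B u"
      using u by (simp add: quad_root_def quad_incl_def quad_ext_mult)
    show "\<exists>a\<in>carrier B. \<exists>b\<in>carrier B.
        w = quad_incl B a \<oplus>\<^bsub>quad_ext B u\<^esub> quad_incl B b \<otimes>\<^bsub>quad_ext B u\<^esub> quad_root B"
      if "w \<in> carrier (quad_ext B u)" for w
      using that by (auto simp: quad_ext_carrier) (metis decomp)
    show "a = a' \<and> b = b'" if "a \<in> carrier B" "b \<in> carrier B" "a' \<in> carrier B" "b' \<in> carrier B"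
      "quad_incl B a \<oplus>\<^bsub>quad_ext B u\<^esub> quad_incl B b \<otimes>\<^bsub>quad_ext B u\<^esub> quad_root B =
       quad_incl B a' \<oplus>\<^bsub>quad_ext B u\<^esub> quad_incl B b' \<otimes>\<^bsub>quad_ext B u\<^esub> quad_root B" for a b a' b'
      using that by (simp add: decomp)
  qed (rule u)
qed

end

section \<open>Natural families of self-maps of the fibres\<close>

text \<open>A unit \<open>u\<close> of a cover \<open>V\<close> gives the double cover of \<open>V\<close> by the square roots of \<open>u\<close>.
  Its points are the pairs \<open>(\<psi>, z)\<close> with \<open>z\<^sup>2 = \<psi>(u)\<close>, and a natural family \<open>\<sigma>\<close> sends \<open>(\<psi>, z)\<close>
  to \<open>(\<sigma>(\<psi>), kummer \<sigma> V u \<psi> z)\<close>.\<close>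

locale pointed_base =
  fixes A :: "'c ring" and ev :: "'c \<Rightarrow> 'k :: field"
  assumes infinite_type: "infinite (UNIV :: 'c set)"
    and cring_base: "cring A"
    and ev_hom: "ev \<in> ring_hom A ring_of_type_algebra"
    and two_unit: "\<one>\<^bsub>A\<^esub> \<oplus>\<^bsub>A\<^esub> \<one>\<^bsub>A\<^esub> \<in> Units A"
begin

abbreviation K :: "'k ring" where "K \<equiv> ring_of_type_algebra"

lemma K_simps [simp]: "carrier K = UNIV" "x \<oplus>\<^bsub>K\<^esub> y = x + y" "x \<otimes>\<^bsub>K\<^esub> y = x * y" "\<one>\<^bsub>K\<^esub> = 1" "\<zero>\<^bsub>K\<^esub> = 0"
  by (simp_all add: ring_of_type_algebra_def)

lemma cring_K: "cring K" by (rule cring_from_type_algebra)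

definition covers :: "('c ring \<times> ('c \<Rightarrow> 'c)) set" where
  "covers = {(B, \<iota>). finite_etale A B \<iota>}"

definition fibre :: "'c ring \<times> ('c \<Rightarrow> 'c) \<Rightarrow> ('c \<Rightarrow> 'k) set" where
  "fibre V = algebra_hom A V (K, ev)"

text \<open>The part of the fundamental group structure that transports square roots; it passes to
  the powers that arise as return maps of vertices.\<close>

definition natural_family :: "('c ring \<times> ('c \<Rightarrow> 'c) \<Rightarrow> ('c \<Rightarrow> 'k) \<Rightarrow> ('c \<Rightarrow> 'k)) \<Rightarrow> bool" where
  "natural_family \<sigma> \<longleftrightarrow>
     (\<forall>V\<in>covers. \<forall>\<psi>\<in>fibre V. \<sigma> V \<psi> \<in> fibre V) \<and>
     (\<forall>V\<in>covers. \<forall>W\<in>covers. \<forall>h\<in>algebra_hom A V W. \<forall>\<psi>\<in>fibre W.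
        \<sigma> V (compose (carrier (fst V)) \<psi> h) = compose (carrier (fst V)) (\<sigma> W \<psi>) h)"


lemma coversD:
  assumes "V \<in> covers"
  shows "cring (fst V)" "snd V \<in> ring_hom A (fst V)"
  using assms by (auto simp: covers_def finite_etale_def)

lemma fibre_iff:
  "\<psi> \<in> fibre V \<longleftrightarrow> \<psi> \<in> ring_hom (fst V) K \<and> \<psi> \<in> extensional (carrier (fst V)) \<and>
     (\<forall>a\<in>carrier A. \<psi> (snd V a) = ev a)"
  by (auto simp: fibre_def algebra_hom_def)

lemma algebra_hom_iff:
  "h \<in> algebra_hom A V W \<longleftrightarrow> h \<in> ring_hom (fst V) (fst W) \<and> h \<in> extensional (carrier (fst V)) \<and>
     (\<forall>a\<in>carrier A. h (snd V a) = snd W a)"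
  by (auto simp: algebra_hom_def)

lemma algebra_hom_compose:
  assumes "V \<in> covers" "h \<in> algebra_hom A V W" "g \<in> algebra_hom A W Y"
  shows "compose (carrier (fst V)) g h \<in> algebra_hom A V Y"
proof -
  have h: "h \<in> ring_hom (fst V) (fst W)" "\<And>a. a \<in> carrier A \<Longrightarrow> h (snd V a) = snd W a"
    and g: "g \<in> ring_hom (fst W) (fst Y)" "\<And>a. a \<in> carrier A \<Longrightarrow> g (snd W a) = snd Y a"
    using assms by (auto simp: algebra_hom_iff)
  interpret V: cring "fst V" using coversD[OF assms(1)] by simp
  note homs = ring_homD[OF h(1)] ring_homD[OF g(1)] ring_homD[OF coversD(2)[OF assms(1)]]
  have "compose (carrier (fst V)) g h \<in> ring_hom (fst V) (fst Y)"
    by (rule ring_hom_memI) (auto simp: compose_def homs)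
  then show ?thesis
    by (auto simp: algebra_hom_iff compose_def homs h g)
qed

lemma compose_fibre:
  assumes "V \<in> covers" "h \<in> algebra_hom A V W" "\<psi> \<in> fibre W"
  shows "compose (carrier (fst V)) \<psi> h \<in> fibre V"
  using algebra_hom_compose[OF assms(1,2), of \<psi> "(K, ev)"] assms(3) unfolding fibre_def by simp

section \<open>Points and maps of the double covers\<close>

definition qcover :: "'c ring \<times> ('c \<Rightarrow> 'c) \<Rightarrow> 'c \<Rightarrow> 'c ring \<times> ('c \<Rightarrow> 'c)" where
  "qcover V u = (quad_ext (fst V) u, \<lambda>a\<in>carrier A. quad_incl (fst V) (snd V a))"

definition kummer ::
  "('c ring \<times> ('c \<Rightarrow> 'c) \<Rightarrow> ('c \<Rightarrow> 'k) \<Rightarrow> ('c \<Rightarrow> 'k)) \<Rightarrow>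
   'c ring \<times> ('c \<Rightarrow> 'c) \<Rightarrow> 'c \<Rightarrow> ('c \<Rightarrow> 'k) \<Rightarrow> 'k \<Rightarrow> 'k" where
  "kummer \<sigma> V u \<psi> z = \<sigma> (qcover V u)
     (\<lambda>w\<in>carrier (quad_ext (fst V) u).
        \<psi> (quadratic_extension.part0 (fst V) (quad_ext (fst V) u) (quad_incl (fst V)) (quad_root (fst V)) w) +
        \<psi> (quadratic_extension.part1 (fst V) (quad_ext (fst V) u) (quad_incl (fst V)) (quad_root (fst V)) w) * z)
     (quad_root (fst V))"

context
  fixes V :: "'c ring \<times> ('c \<Rightarrow> 'c)" and u :: 'c
  assumes V: "V \<in> covers" and u: "u \<in> Units (fst V)"
begin

interpretation V: cring "fst V" using coversD[OF V] by simp

lemma u_closed: "u \<in> carrier (fst V)" using u by auto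

interpretation Q: quadratic_extension "fst V" "quad_ext (fst V) u" "quad_incl (fst V)" "quad_root (fst V)" u
  by (rule quadratic_extension_quad_ext[OF infinite_type V.cring_axioms u_closed])

definition qpoint :: "('c \<Rightarrow> 'k) \<Rightarrow> 'k \<Rightarrow> ('c \<Rightarrow> 'k)" where
  "qpoint \<psi> z = (\<lambda>w\<in>carrier (quad_ext (fst V) u). \<psi> (Q.part0 w) + \<psi> (Q.part1 w) * z)"

lemma kummer_qpoint: "kummer \<sigma> V u \<psi> z = \<sigma> (qcover V u) (qpoint \<psi> z) (quad_root (fst V))"
  by (simp add: kummer_def qpoint_def)

lemma qcover_cover: "qcover V u \<in> covers"
proof -
  note i = ring_homD[OF coversD(2)[OF V]]
  interpret A: cring A by (rule cring_base)
  let ?two = "\<one>\<^bsub>A\<^esub> \<oplus>\<^bsub>A\<^esub> \<one>\<^bsub>A\<^esub>"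
  have c: "?two \<in> carrier A" "inv\<^bsub>A\<^esub> ?two \<in> carrier A" using two_unit by auto
  have "snd V ?two \<otimes>\<^bsub>fst V\<^esub> snd V (inv\<^bsub>A\<^esub> ?two) = \<one>\<^bsub>fst V\<^esub>"
    unfolding i(2)[OF c, symmetric] A.Units_r_inv[OF two_unit] by (rule i(4))
  then have "snd V ?two \<in> Units (fst V)"
    using c i(1) V.m_comm[of "snd V ?two" "snd V (inv\<^bsub>A\<^esub> ?two)"] unfolding Units_def
    by (intro CollectI conjI bexI[of _ "snd V (inv\<^bsub>A\<^esub> ?two)"]) auto
  then have "\<one>\<^bsub>fst V\<^esub> \<oplus>\<^bsub>fst V\<^esub> \<one>\<^bsub>fst V\<^esub> \<in> Units (fst V)" by (simp add: i)
  then show ?thesis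
    using Q.finite_etale_quadratic[OF cring_base _ u, of "snd V"] V
    by (auto simp: covers_def qcover_def)
qed

lemma qincl_hom: "restrict (quad_incl (fst V)) (carrier (fst V)) \<in> algebra_hom A V (qcover V u)"
proof -
  have "restrict (quad_incl (fst V)) (carrier (fst V)) \<in> ring_hom (fst V) (quad_ext (fst V) u)"
    by (rule ring_hom_memI) (auto simp: Q.hom_mult Q.hom_add Q.hom_one)
  then show ?thesis
    using ring_homD(1)[OF coversD(2)[OF V]] by (auto simp: algebra_hom_iff qcover_def)
qed

lemma qpoint_fibre:
  assumes "\<psi> \<in> fibre V" "z * z = \<psi> u"
  shows "qpoint \<psi> z \<in> fibre (qcover V u)" "qpoint \<psi> z (quad_root (fst V)) = z"
    "\<And>b. b \<in> carrier (fst V) \<Longrightarrow> qpoint \<psi> z (quad_incl (fst V) b) = \<psi> b"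
proof -
  have p: "\<psi> \<in> ring_hom (fst V) K" "\<And>a. a \<in> carrier A \<Longrightarrow> \<psi> (snd V a) = ev a"
    using assms by (auto simp: fibre_iff)
  have q: "qpoint \<psi> z = (\<lambda>w\<in>carrier (quad_ext (fst V) u). \<psi> (Q.part0 w) \<oplus>\<^bsub>K\<^esub> \<psi> (Q.part1 w) \<otimes>\<^bsub>K\<^esub> z)"
    by (simp add: qpoint_def)
  have "z \<in> carrier K" "z \<otimes>\<^bsub>K\<^esub> z = \<psi> u" using assms by auto
  note e = Q.extend_hom[OF cring_K p(1) this, folded q]
  show "qpoint \<psi> z (quad_root (fst V)) = z"
    and *: "\<And>b. b \<in> carrier (fst V) \<Longrightarrow> qpoint \<psi> z (quad_incl (fst V) b) = \<psi> b"
    using e by auto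
  show "qpoint \<psi> z \<in> fibre (qcover V u)"
    using e(1) * p(2) ring_homD(1)[OF coversD(2)[OF V]]
    by (auto simp: fibre_iff qcover_def qpoint_def)
qed

text \<open>So a point of the double cover is nothing more than a point of \<open>V\<close> with a
  square root of the value of \<open>u\<close> there.\<close>

lemma qpoint_eq:
  assumes "\<chi> \<in> fibre (qcover V u)"
  shows "\<chi> = qpoint (compose (carrier (fst V)) \<chi> (restrict (quad_incl (fst V)) (carrier (fst V))))
    (\<chi> (quad_root (fst V)))"
proof
  have c: "\<chi> \<in> ring_hom (quad_ext (fst V) u) K" "\<chi> \<in> extensional (carrier (quad_ext (fst V) u))"
    using assms by (auto simp: fibre_iff qcover_def)
  fix w show "\<chi> w = qpoint (compose (carrier (fst V)) \<chi> (restrict (quad_incl (fst V)) (carrier (fst V))))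
    (\<chi> (quad_root (fst V))) w"
  proof (cases "w \<in> carrier (quad_ext (fst V) u)")
    case True
    then show ?thesis
      using Q.hom_eqI[OF cring_K c(1) True] by (simp add: qpoint_def compose_def)
  next
    case False
    then show ?thesis using c(2) by (auto simp: qpoint_def extensional_def)
  qed
qed

text \<open>Geometrically, a square root of \<open>u\<close> on \<open>W\<close> amounts to a map
  from \<open>W\<close> to the double cover.\<close>

lemma qcover_lift:
  assumes W: "W \<in> covers" and h: "h \<in> algebra_hom A V W"
    and t: "t \<in> carrier (fst W)" "t \<otimes>\<^bsub>fst W\<^esub> t = h u"
  obtains H where "H \<in> algebra_hom A (qcover V u) W" "H (quad_root (fst V)) = t"
    "\<And>b. b \<in> carrier (fst V) \<Longrightarrow> H (quad_incl (fst V) b) = h b"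
proof -
  have hr: "h \<in> ring_hom (fst V) (fst W)" "\<And>a. a \<in> carrier A \<Longrightarrow> h (snd V a) = snd W a"
    using h by (auto simp: algebra_hom_iff)
  define H where "H = (\<lambda>w\<in>carrier (quad_ext (fst V) u).
    h (Q.part0 w) \<oplus>\<^bsub>fst W\<^esub> h (Q.part1 w) \<otimes>\<^bsub>fst W\<^esub> t)"
  note e = Q.extend_hom[OF coversD(1)[OF W] hr(1) t, folded H_def]
  have "H \<in> algebra_hom A (qcover V u) W"
    using e hr(2) ring_homD(1)[OF coversD(2)[OF V]]
    by (auto simp: algebra_hom_iff qcover_def H_def)
  with e that show ?thesis by blast
qed

lemma compose_qincl:
  assumes "\<psi> \<in> fibre V" "z * z = \<psi> u"
  shows "compose (carrier (fst V)) (qpoint \<psi> z) (restrict (quad_incl (fst V)) (carrier (fst V))) = \<psi>"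
  using qpoint_fibre(3)[OF assms] assms(1)
  by (auto simp: compose_def fibre_iff extensional_def restrict_def fun_eq_iff)

text \<open>The rule behind all the others: as soon as some cover \<open>W\<close> over
  \<open>V\<close> contains a square root \<open>t\<close> of \<open>u\<close>, the action on square
  roots of \<open>u\<close> is the action on the values of \<open>t\<close>, by naturality along the
  map from \<open>qcover_lift\<close>.\<close>

lemma kummer_universal:
  assumes \<sigma>: "natural_family \<sigma>" and W: "W \<in> covers" and h: "h \<in> algebra_hom A V W"
    and t: "t \<in> carrier (fst W)" "t \<otimes>\<^bsub>fst W\<^esub> t = h u" and \<psi>: "\<psi> \<in> fibre W"
  shows "kummer \<sigma> V u (compose (carrier (fst V)) \<psi> h) (\<psi> t) = \<sigma> W \<psi> t"
proof -
  obtain H where H: "H \<in> algebra_hom A (qcover V u) W" "H (quad_root (fst V)) = t"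
    "\<And>b. b \<in> carrier (fst V) \<Longrightarrow> H (quad_incl (fst V) b) = h b"
    using qcover_lift[OF W h t] by blast
  have f: "compose (carrier (quad_ext (fst V) u)) \<psi> H \<in> fibre (qcover V u)"
    using compose_fibre[OF qcover_cover H(1) \<psi>] by (simp add: qcover_def)
  have "compose (carrier (quad_ext (fst V) u)) \<psi> H = qpoint (compose (carrier (fst V)) \<psi> h) (\<psi> t)"
    using qpoint_eq[OF f] H(2,3) by (simp add: compose_def cong: restrict_cong)
  moreover have "\<sigma> (qcover V u) (compose (carrier (fst (qcover V u))) \<psi> H) =
      compose (carrier (fst (qcover V u))) (\<sigma> W \<psi>) H"
    using \<sigma> qcover_cover W H(1) \<psi> unfolding natural_family_def by blast
  ultimately show ?thesis
    using H(2) by (simp add: kummer_qpoint qcover_def compose_def)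
qed

text \<open>Naturality for the inclusion of \<open>V\<close> gives the first coordinate. The image
  is again a ring homomorphism, so its second coordinate is a square root over the new
  point.\<close>

lemma natural_qpoint:
  assumes \<sigma>: "natural_family \<sigma>" and \<psi>: "\<psi> \<in> fibre V" "z * z = \<psi> u"
  shows "\<sigma> (qcover V u) (qpoint \<psi> z) = qpoint (\<sigma> V \<psi>) (kummer \<sigma> V u \<psi> z)"
    "kummer \<sigma> V u \<psi> z * kummer \<sigma> V u \<psi> z = \<sigma> V \<psi> u"
proof -
  let ?\<chi> = "\<sigma> (qcover V u) (qpoint \<psi> z)"
  have f: "?\<chi> \<in> fibre (qcover V u)"
    using \<sigma> qcover_cover qpoint_fibre(1)[OF \<psi>] unfolding natural_family_def by blast
  have c: "compose (carrier (fst V)) ?\<chi> (restrict (quad_incl (fst V)) (carrier (fst V))) = \<sigma> V \<psi>"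
    using \<sigma> V qcover_cover qincl_hom qpoint_fibre(1)[OF \<psi>] compose_qincl[OF \<psi>]
    unfolding natural_family_def by metis
  show "?\<chi> = qpoint (\<sigma> V \<psi>) (kummer \<sigma> V u \<psi> z)"
    using qpoint_eq[OF f] unfolding c kummer_qpoint .
  have "?\<chi> (quad_root (fst V)) * ?\<chi> (quad_root (fst V)) = ?\<chi> (quad_incl (fst V) u)"
    using f ring_homD(2)[of ?\<chi> "quad_ext (fst V) u" K "quad_root (fst V)" "quad_root (fst V)"]
    by (simp add: fibre_iff qcover_def Q.root_square)
  then show "kummer \<sigma> V u \<psi> z * kummer \<sigma> V u \<psi> z = \<sigma> V \<psi> u"
    using fun_cong[OF c, of u] u_closed by (simp add: kummer_qpoint compose_def)
qed

end

section \<open>Rules for the action on square roots\<close>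

lemma algebra_hom_unit:
  assumes "V \<in> covers" "W \<in> covers" "h \<in> algebra_hom A V W" "u \<in> Units (fst V)"
  shows "h u \<in> Units (fst W)"
proof -
  have h: "h \<in> ring_hom (fst V) (fst W)" using assms by (auto simp: algebra_hom_iff)
  interpret V: cring "fst V" using coversD assms by simp
  interpret W: cring "fst W" using coversD assms by simp
  note h = ring_homD[OF h]
  have "h u \<otimes>\<^bsub>fst W\<^esub> h (inv\<^bsub>fst V\<^esub> u) = \<one>\<^bsub>fst W\<^esub>"
    using assms(4) h by (metis V.Units_closed V.Units_inv_closed V.Units_r_inv)
  then show ?thesis
    using assms(4) h(1) W.m_comm[of "h u" "h (inv\<^bsub>fst V\<^esub> u)"] unfolding Units_def[of "fst W"]
    by (intro CollectI conjI bexI[of _ "h (inv\<^bsub>fst V\<^esub> u)"]) auto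
qed

lemma natural_hom:
  assumes "natural_family \<sigma>" "V \<in> covers" "\<psi> \<in> fibre V"
  shows "\<sigma> V \<psi> \<in> fibre V"
  using assms unfolding natural_family_def by blast

lemma id_algebra_hom:
  assumes "V \<in> covers"
  shows "restrict (\<lambda>x. x) (carrier (fst V)) \<in> algebra_hom A V V"
proof -
  interpret V: cring "fst V" using coversD assms by simp
  have "restrict (\<lambda>x. x) (carrier (fst V)) \<in> ring_hom (fst V) (fst V)"
    by (rule ring_hom_memI) auto
  then show ?thesis
    using ring_homD(1)[OF coversD(2)[OF assms]] by (auto simp: algebra_hom_iff)
qed

text \<open>Here \<open>V\<close> itself contains the root, so \<open>kummer_universal\<close>
  applies to the identity of \<open>V\<close>.\<close>

lemma kummer_square:
  assumes \<sigma>: "natural_family \<sigma>" and V: "V \<in> covers" and t: "t \<in> Units (fst V)" and \<psi>: "\<psi> \<in> fibre V"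
  shows "kummer \<sigma> V (t \<otimes>\<^bsub>fst V\<^esub> t) \<psi> (\<psi> t) = \<sigma> V \<psi> t"
proof -
  interpret V: cring "fst V" using coversD V by simp
  have "compose (carrier (fst V)) \<psi> (restrict (\<lambda>x. x) (carrier (fst V))) = \<psi>"
    using \<psi> by (auto simp: compose_def fibre_iff extensional_def fun_eq_iff restrict_def)
  then show ?thesis
    using kummer_universal[OF V _ \<sigma> V id_algebra_hom[OF V] _ _ \<psi>, of "t \<otimes>\<^bsub>fst V\<^esub> t" t] t
    by (simp add: V.Units_closed del: restrict_apply) (simp add: V.Units_closed)
qed

text \<open>The double cover of \<open>W\<close> by the roots of \<open>h u\<close> contains a root
  of \<open>u\<close>, so \<open>kummer_universal\<close> compares the two actions.\<close>

lemma kummer_natural: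
  assumes \<sigma>: "natural_family \<sigma>" and V: "V \<in> covers" and W: "W \<in> covers"
    and h: "h \<in> algebra_hom A V W" and u: "u \<in> Units (fst V)"
    and \<psi>: "\<psi> \<in> fibre W" "z * z = \<psi> (h u)"
  shows "kummer \<sigma> W (h u) \<psi> z = kummer \<sigma> V u (compose (carrier (fst V)) \<psi> h) z"
proof -
  have hu: "h u \<in> Units (fst W)" by (rule algebra_hom_unit[OF V W h u])
  interpret V: cring "fst V" using coversD V by simp
  interpret W: cring "fst W" using coversD W by simp
  interpret Q: quadratic_extension "fst W" "quad_ext (fst W) (h u)" "quad_incl (fst W)" "quad_root (fst W)" "h u"
    by (rule quadratic_extension_quad_ext[OF infinite_type W.cring_axioms]) (use hu in auto)
  have hr: "h \<in> ring_hom (fst V) (fst W)" using h by (auto simp: algebra_hom_iff)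
  have uc: "u \<in> carrier (fst V)" using u by auto
  let ?i = "restrict (quad_incl (fst W)) (carrier (fst W))"
  let ?g = "compose (carrier (fst V)) ?i h"
  have g: "?g \<in> algebra_hom A V (qcover W (h u))"
    by (rule algebra_hom_compose[OF V h qincl_hom[OF W hu]])
  have gu: "?g u = quad_incl (fst W) (h u)"
    using uc ring_homD(1)[OF hr] by (simp add: compose_def)
  have t: "quad_root (fst W) \<in> carrier (fst (qcover W (h u)))"
    "quad_root (fst W) \<otimes>\<^bsub>fst (qcover W (h u))\<^esub> quad_root (fst W) = ?g u"
    unfolding gu by (simp_all add: qcover_def Q.root_square)
  note p = qpoint_fibre[OF W hu \<psi>]
  have "compose (carrier (fst V)) (qpoint W (h u) \<psi> z) ?g = compose (carrier (fst V)) \<psi> h"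
    using p(3) ring_homD(1)[OF hr] by (auto simp: compose_def fun_eq_iff restrict_def)
  note pull = this
  show ?thesis
    using kummer_universal[OF V u \<sigma> qcover_cover[OF W hu] g t p(1)]
    unfolding kummer_qpoint[OF W hu] p(2) pull by (rule sym)
qed

text \<open>Both roots live on the iterated double cover \<open>Q2\<close>, and the action there is
  multiplicative because points are ring homomorphisms.\<close>

lemma kummer_mult:
  assumes \<sigma>: "natural_family \<sigma>" and V: "V \<in> covers" and \<psi>: "\<psi> \<in> fibre V"
    and u: "u \<in> Units (fst V)" "y * y = \<psi> u" and w: "w \<in> Units (fst V)" "z * z = \<psi> w"
  shows "kummer \<sigma> V (u \<otimes>\<^bsub>fst V\<^esub> w) \<psi> (y * z) = kummer \<sigma> V u \<psi> y * kummer \<sigma> V w \<psi> z"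
proof -
  interpret V: cring "fst V" using coversD V by simp
  have [simp]: "u \<in> carrier (fst V)" "w \<in> carrier (fst V)" using u w by auto
  interpret Q: quadratic_extension "fst V" "quad_ext (fst V) u" "quad_incl (fst V)" "quad_root (fst V)" u
    by (rule quadratic_extension_quad_ext[OF infinite_type V.cring_axioms]) auto
  define Q1 where "Q1 = qcover V u"
  have Q1: "Q1 \<in> covers" unfolding Q1_def by (rule qcover_cover[OF V u(1)])
  have fQ1: "fst Q1 = quad_ext (fst V) u" by (simp add: Q1_def qcover_def)
  let ?i1 = "restrict (quad_incl (fst V)) (carrier (fst V))"
  have i1: "?i1 \<in> algebra_hom A V Q1" unfolding Q1_def by (rule qincl_hom[OF V u(1)])
  define w' where "w' = quad_incl (fst V) w"
  have w': "w' \<in> Units (fst Q1)"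
    using algebra_hom_unit[OF V Q1 i1 w(1)] by (simp add: w'_def)
  interpret Q1: cring "fst Q1" using coversD Q1 by simp
  have [simp]: "w' \<in> carrier (fst Q1)" using w' by auto
  interpret Q': quadratic_extension "fst Q1" "quad_ext (fst Q1) w'" "quad_incl (fst Q1)" "quad_root (fst Q1)" w'
    by (rule quadratic_extension_quad_ext[OF infinite_type Q1.cring_axioms]) auto
  define Q2 where "Q2 = qcover Q1 w'"
  have Q2: "Q2 \<in> covers" unfolding Q2_def by (rule qcover_cover[OF Q1 w'])
  have fQ2: "fst Q2 = quad_ext (fst Q1) w'" by (simp add: Q2_def qcover_def)
  let ?i2 = "restrict (quad_incl (fst Q1)) (carrier (fst Q1))"
  have i2: "?i2 \<in> algebra_hom A Q1 Q2" unfolding Q2_def by (rule qincl_hom[OF Q1 w'])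
  define h where "h = compose (carrier (fst V)) ?i2 ?i1"
  have h: "h \<in> algebra_hom A V Q2" unfolding h_def by (rule algebra_hom_compose[OF V i1 i2])
  define a where "a = quad_incl (fst Q1) (quad_root (fst V))"
  define b where "b = quad_root (fst Q1)"
  have ab: "a \<in> carrier (fst Q2)" "b \<in> carrier (fst Q2)"
    unfolding a_def b_def fQ2 by (rule Q'.hom_closed, simp add: fQ1) (rule Q'.root_closed)
  have hv: "h x = quad_incl (fst Q1) (quad_incl (fst V) x)" if "x \<in> carrier (fst V)" for x
    using that by (simp add: h_def compose_def fQ1)
  have aa: "a \<otimes>\<^bsub>fst Q2\<^esub> a = h u"
    using Q'.hom_mult[of "quad_root (fst V)" "quad_root (fst V)"]
    by (simp add: a_def fQ2 hv Q.root_square fQ1)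
  have bb: "b \<otimes>\<^bsub>fst Q2\<^esub> b = h w"
    unfolding b_def fQ2 Q'.root_square by (simp add: hv w'_def)
  interpret Q2: cring "fst Q2" using coversD Q2 by simp
  have hr: "h \<in> ring_hom (fst V) (fst Q2)" using h by (auto simp: algebra_hom_iff)
  have abab: "(a \<otimes>\<^bsub>fst Q2\<^esub> b) \<otimes>\<^bsub>fst Q2\<^esub> (a \<otimes>\<^bsub>fst Q2\<^esub> b) = h (u \<otimes>\<^bsub>fst V\<^esub> w)"
  proof -
    have "(a \<otimes>\<^bsub>fst Q2\<^esub> b) \<otimes>\<^bsub>fst Q2\<^esub> (a \<otimes>\<^bsub>fst Q2\<^esub> b) = (a \<otimes>\<^bsub>fst Q2\<^esub> a) \<otimes>\<^bsub>fst Q2\<^esub> (b \<otimes>\<^bsub>fst Q2\<^esub> b)"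
      using ab by (simp add: Q2.m_ac)
    then show ?thesis unfolding aa bb by (simp add: ring_homD(2)[OF hr])
  qed
  define \<chi>1 where "\<chi>1 = qpoint V u \<psi> y"
  note c1 = qpoint_fibre[OF V u(1) \<psi> u(2), folded \<chi>1_def, folded Q1_def]
  have zz: "z * z = \<chi>1 w'" using c1(3)[of w] w(2) by (simp add: w'_def)
  define \<chi>2 where "\<chi>2 = qpoint Q1 w' \<chi>1 z"
  note c2 = qpoint_fibre[OF Q1 w' c1(1) zz, folded \<chi>2_def, folded Q2_def]
  have ca: "\<chi>2 a = y" using c2(3)[of "quad_root (fst V)"] c1(2) by (simp add: a_def fQ1)
  have cb: "\<chi>2 b = z" using c2(2) by (simp add: b_def)
  have ch: "compose (carrier (fst V)) \<chi>2 h = \<psi>"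
  proof
    fix x show "compose (carrier (fst V)) \<chi>2 h x = \<psi> x"
    proof (cases "x \<in> carrier (fst V)")
      case True
      then show ?thesis using c2(3)[of "quad_incl (fst V) x"] c1(3)[of x]
        by (simp add: compose_def hv fQ1)
    next
      case False
      then show ?thesis using \<psi> by (simp add: compose_def fibre_iff extensional_def)
    qed
  qed
  have cr: "\<chi>2 \<in> ring_hom (fst Q2) K" using c2(1) by (simp add: fibre_iff)
  have sr: "\<sigma> Q2 \<chi>2 \<in> ring_hom (fst Q2) K" using natural_hom[OF \<sigma> Q2 c2(1)] by (simp add: fibre_iff)
  have uw: "u \<otimes>\<^bsub>fst V\<^esub> w \<in> Units (fst V)" using u w by simp
  have "kummer \<sigma> V (u \<otimes>\<^bsub>fst V\<^esub> w) \<psi> (\<chi>2 (a \<otimes>\<^bsub>fst Q2\<^esub> b)) = \<sigma> Q2 \<chi>2 (a \<otimes>\<^bsub>fst Q2\<^esub> b)"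
    using kummer_universal[OF V uw \<sigma> Q2 h _ abab c2(1)] ab by (simp add: ch)
  moreover have "kummer \<sigma> V u \<psi> y = \<sigma> Q2 \<chi>2 a"
    using kummer_universal[OF V u(1) \<sigma> Q2 h ab(1) aa c2(1)] by (simp add: ch ca)
  moreover have "kummer \<sigma> V w \<psi> z = \<sigma> Q2 \<chi>2 b"
    using kummer_universal[OF V w(1) \<sigma> Q2 h ab(2) bb c2(1)] by (simp add: ch cb)
  ultimately show ?thesis
    using ab by (simp add: ring_homD(2)[OF cr] ring_homD(2)[OF sr] ca cb)
qed

text \<open>The double cover contains the negative of its root, which is again a root of
  \<open>u\<close>.\<close>

lemma kummer_minus:
  assumes \<sigma>: "natural_family \<sigma>" and V: "V \<in> covers" and \<psi>: "\<psi> \<in> fibre V"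
    and u: "u \<in> Units (fst V)" "z * z = \<psi> u"
  shows "kummer \<sigma> V u \<psi> (- z) = - kummer \<sigma> V u \<psi> z"
proof -
  interpret V: cring "fst V" using coversD V by simp
  have [simp]: "u \<in> carrier (fst V)" using u by auto
  interpret Q: quadratic_extension "fst V" "quad_ext (fst V) u" "quad_incl (fst V)" "quad_root (fst V)" u
    by (rule quadratic_extension_quad_ext[OF infinite_type V.cring_axioms]) auto
  define Q1 where "Q1 = qcover V u"
  have Q1: "Q1 \<in> covers" unfolding Q1_def by (rule qcover_cover[OF V u(1)])
  have fQ1: "fst Q1 = quad_ext (fst V) u" by (simp add: Q1_def qcover_def)
  let ?i = "restrict (quad_incl (fst V)) (carrier (fst V))"
  have i: "?i \<in> algebra_hom A V Q1" unfolding Q1_def by (rule qincl_hom[OF V u(1)])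
  define t where "t = \<ominus>\<^bsub>fst Q1\<^esub> quad_root (fst V)"
  have t: "t \<in> carrier (fst Q1)" "t \<otimes>\<^bsub>fst Q1\<^esub> t = ?i u"
    by (simp_all add: t_def fQ1 Q.W.l_minus Q.W.r_minus Q.root_square)
  have tr: "t \<oplus>\<^bsub>fst Q1\<^esub> quad_root (fst V) = \<zero>\<^bsub>fst Q1\<^esub>"
    by (simp add: t_def fQ1 Q.W.l_neg)
  have neg: "\<chi> t = - \<chi> (quad_root (fst V))" if "\<chi> \<in> fibre Q1" for \<chi>
  proof -
    have c: "\<chi> \<in> ring_hom (fst Q1) K" using that by (simp add: fibre_iff)
    have "\<chi> t + \<chi> (quad_root (fst V)) = \<chi> \<zero>\<^bsub>fst Q1\<^esub>"
      using ring_homD(3)[OF c t(1), of "quad_root (fst V)"] tr by (simp add: fQ1)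
    also have "\<dots> = 0"
      using ring_hom_zero[OF c] Q.W.ring_axioms cring_K fQ1 by (simp add: cring.axioms(1))
    finally show ?thesis by (simp add: eq_neg_iff_add_eq_0)
  qed
  note p = qpoint_fibre[OF V u(1) \<psi> u(2), folded Q1_def]
  have "kummer \<sigma> V u \<psi> (qpoint V u \<psi> z t) = \<sigma> Q1 (qpoint V u \<psi> z) t"
    using kummer_universal[OF V u(1) \<sigma> Q1 i t p(1)]
    unfolding compose_qincl[OF V u(1) \<psi> u(2)] .
  then show ?thesis
    using neg[OF p(1)] neg[OF natural_hom[OF \<sigma> Q1 p(1)]] p(2)
    by (simp add: kummer_qpoint[OF V u(1)] Q1_def)
qed

lemma natural_family_compose:
  assumes \<sigma>: "natural_family \<sigma>" and \<tau>: "natural_family \<tau>"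
  shows "natural_family (\<lambda>V \<psi>. \<sigma> V (\<tau> V \<psi>))"
  using assms unfolding natural_family_def by simp

lemma natural_family_funpow:
  assumes \<sigma>: "natural_family \<sigma>"
  shows "natural_family (\<lambda>V. \<sigma> V ^^ n)"
proof (induction n)
  case 0
  then show ?case by (simp add: natural_family_def)
next
  case (Suc n)
  have eq: "(\<lambda>V. \<sigma> V ^^ Suc n) = (\<lambda>V \<psi>. \<sigma> V ((\<sigma> V ^^ n) \<psi>))"
    by (intro ext) (simp only: funpow.simps comp_def)
  show ?case by (subst eq) (rule natural_family_compose[OF \<sigma> Suc.IH])
qed

lemma kummer_compose:
  assumes \<sigma>: "natural_family \<sigma>" and \<tau>: "natural_family \<tau>" and V: "V \<in> covers"
    and \<psi>: "\<psi> \<in> fibre V" and u: "u \<in> Units (fst V)" "z * z = \<psi> u"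
  shows "kummer (\<lambda>V \<psi>. \<sigma> V (\<tau> V \<psi>)) V u \<psi> z = kummer \<sigma> V u (\<tau> V \<psi>) (kummer \<tau> V u \<psi> z)"
  by (simp only: kummer_qpoint[OF V u(1), of "\<lambda>V \<psi>. \<sigma> V (\<tau> V \<psi>)"]
    kummer_qpoint[OF V u(1), of \<sigma>] natural_qpoint(1)[OF V u(1) \<tau> \<psi> u(2)])

end

section \<open>Values of rational functions\<close>

text \<open>By division with remainder, a nonzero element of least degree in the ideal of
  \<open>p\<close> and \<open>q\<close> divides both; coprimality makes it a unit.\<close>

lemma poly_bezout:
  fixes p q :: "'a::field poly"
  assumes "coprime p q"
  obtains a b where "a * p + b * q = 1"
proof -
  define I where "I = {g. g \<noteq> 0 \<and> (\<exists>a b. g = a * p + b * q)}"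
  have "p \<noteq> 0 \<or> q \<noteq> 0" using assms by auto
  moreover have "p = 1 * p + 0 * q" "q = 0 * p + 1 * q" by auto
  ultimately have "p \<in> I \<or> q \<in> I" unfolding I_def by blast
  then obtain g where g: "g \<in> I" and min: "\<And>h. h \<in> I \<Longrightarrow> Polynomial.degree g \<le> Polynomial.degree h"
    using exists_least_iff[of "\<lambda>n. \<exists>g\<in>I. Polynomial.degree g = n"] by (metis not_le)
  then obtain a b where ab: "g = a * p + b * q" and g0: "g \<noteq> 0" by (auto simp: I_def)
  have dvd: "g dvd r" if r: "\<exists>c d. r = c * p + d * q" for r
  proof (rule ccontr)
    assume "\<not> g dvd r"
    then have nz: "r mod g \<noteq> 0" by (simp add: dvd_eq_mod_eq_0)
    from r obtain c d where cd: "r = c * p + d * q" by blast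
    have "r mod g = r - (r div g) * g" by (simp add: minus_div_mult_eq_mod)
    then have "r mod g = (c - (r div g) * a) * p + (d - (r div g) * b) * q"
      unfolding ab by (subst (asm) (2) cd) (simp add: algebra_simps)
    with nz have "r mod g \<in> I" unfolding I_def by blast
    from min[OF this] degree_mod_less'[OF g0 nz] show False by simp
  qed
  have "p = 1 * p + 0 * q" "q = 0 * p + 1 * q" by auto
  then have "g dvd p" "g dvd q" using dvd by blast+
  then have "g dvd 1" using assms coprime_common_divisor by blast
  then obtain k where "1 = g * k" by blast
  then have "(k * a) * p + (k * b) * q = 1" by (simp add: ab algebra_simps)
  then show ?thesis using that by blast
qed

text \<open>With \<open>a p + b q = 1\<close> the factor is \<open>k = a p' + b q'\<close>.\<close>

lemma coprime_fract_unique: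
  fixes p q :: "'a::field poly"
  assumes "coprime p q" "q \<noteq> 0" "q' \<noteq> 0" "Fraction_Field.Fract p q = Fraction_Field.Fract p' q'"
  obtains k where "p' = k * p" "q' = k * q"
proof -
  have eq: "p * q' = p' * q" using assms by (simp add: eq_fract)
  obtain a b where ab: "a * p + b * q = 1" using poly_bezout[OF assms(1)] .
  have "q' = (a * p + b * q) * q'" by (simp add: ab)
  also have "\<dots> = a * (p * q') + b * q * q'" by (simp add: algebra_simps)
  also have "\<dots> = (a * p' + b * q') * q" unfolding eq by (simp add: algebra_simps)
  finally have q': "q' = (a * p' + b * q') * q" .
  then have "p' * q = (a * p' + b * q') * p * q" using eq by (metis mult.commute mult.left_commute)
  then have "p' = (a * p' + b * q') * p" using assms(2) by simp
  with q' that show ?thesis by blast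
qed

text \<open>A denominator of least degree leaves no common factor; scaling makes it monic.\<close>

lemma reduced_fraction_exists:
  fixes h :: "'a::field poly fract"
  obtains p q where "h = Fraction_Field.Fract p q" "coprime p q" "Polynomial.lead_coeff q = 1"
proof -
  obtain p0 q0 where h: "h = Fraction_Field.Fract p0 q0" "q0 \<noteq> 0" by (cases h) auto
  then obtain p q where pq: "h = Fraction_Field.Fract p q" "q \<noteq> 0"
    and min: "\<And>p' q'. h = Fraction_Field.Fract p' q' \<Longrightarrow> q' \<noteq> 0 \<Longrightarrow> Polynomial.degree q \<le> Polynomial.degree q'"
    using exists_least_iff[of "\<lambda>n. \<exists>p q. h = Fraction_Field.Fract p q \<and> q \<noteq> 0 \<and> Polynomial.degree q = n"] by (metis not_le)
  have cop: "coprime p q"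
  proof (rule coprimeI)
    fix c assume "c dvd p" "c dvd q"
    then obtain p' q' where c: "p = c * p'" "q = c * q'" by blast
    with pq have nz: "q' \<noteq> 0" "c \<noteq> 0" by auto
    have "h = Fraction_Field.Fract p' q'" using pq nz c by (simp add: eq_fract)
    from min[OF this nz(1)] have "Polynomial.degree c = 0" using c nz by (simp add: degree_mult_eq)
    then show "is_unit c" using nz by (simp add: is_unit_iff_degree)
  qed
  define l where "l = inverse (Polynomial.lead_coeff q)"
  have l: "l \<noteq> 0" using pq by (simp add: l_def)
  have "h = Fraction_Field.Fract (Polynomial.smult l p) (Polynomial.smult l q)" using pq l by (simp add: eq_fract)
  moreover have "coprime (Polynomial.smult l p) (Polynomial.smult l q)"
  proof (rule coprimeI)
    fix c assume "c dvd Polynomial.smult l p" "c dvd Polynomial.smult l q"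
    then have "c dvd p" "c dvd q" using l by (auto dest: dvd_smult_cancel)
    then show "is_unit c" using cop coprime_common_divisor by blast
  qed
  moreover have "Polynomial.lead_coeff (Polynomial.smult l q) = 1" using pq by (simp add: l_def)
  ultimately show ?thesis using that by blast
qed

text \<open>Two monic reduced forms differ by a unit polynomial with leading coefficient 1, so the
  definite description in the definition is legitimate.\<close>

lemma rf_rep:
  fixes h :: "'a::field poly fract"
  shows "h = Fraction_Field.Fract (rf_num h) (rf_den h)" "coprime (rf_num h) (rf_den h)"
    "Polynomial.lead_coeff (rf_den h) = 1" "rf_den h \<noteq> 0"
proof -
  have "\<exists>!x. case x of (p, q) \<Rightarrow> h = Fraction_Field.Fract p q \<and> coprime p q \<and> Polynomial.lead_coeff q = 1"
  proof -
    obtain p q where pq: "h = Fraction_Field.Fract p q" "coprime p q" "Polynomial.lead_coeff q = 1"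
      using reduced_fraction_exists .
    have "p' = p \<and> q' = q" if *: "h = Fraction_Field.Fract p' q'" "coprime p' q'" "Polynomial.lead_coeff q' = 1" for p' q'
    proof -
      have nz: "q \<noteq> 0" "q' \<noteq> 0" using pq * by auto
      obtain k where k: "p' = k * p" "q' = k * q"
        using coprime_fract_unique[OF pq(2) nz] pq(1) *(1) by metis
      have "k dvd p'" "k dvd q'" using k by auto
      then have "k dvd 1" using *(2) coprime_common_divisor by blast
      moreover have "Polynomial.lead_coeff k = 1" using pq(3) *(3) k by (simp add: lead_coeff_mult)
      moreover obtain c where "k = [:c:]"
        using \<open>k dvd 1\<close> by (auto elim: is_unit_polyE)
      ultimately have "k = 1" by (simp add: one_pCons)
      with k show ?thesis by simp
    qed
    note uniq = this
    show ?thesis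
    proof (rule ex1I[of _ "(p, q)"])
      show "case (p, q) of (p, q) \<Rightarrow> h = Fraction_Field.Fract p q \<and> coprime p q \<and> Polynomial.lead_coeff q = 1"
        using pq by (simp only: prod.case)
      fix x assume "case x of (p, q) \<Rightarrow> h = Fraction_Field.Fract p q \<and> coprime p q \<and> Polynomial.lead_coeff q = 1"
      then show "x = (p, q)" using uniq[of "fst x" "snd x"] by (simp add: case_prod_unfold prod_eq_iff)
    qed
  qed
  from theI'[OF this] have *: "case rf_rep h of (p, q) \<Rightarrow> h = Fraction_Field.Fract p q \<and> coprime p q \<and> Polynomial.lead_coeff q = 1"
    unfolding rf_rep_def .
  then show "h = Fraction_Field.Fract (rf_num h) (rf_den h)" "coprime (rf_num h) (rf_den h)"
    "Polynomial.lead_coeff (rf_den h) = 1"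
    by (auto simp: rf_num_def rf_den_def split: prod.splits)
  then show "rf_den h \<noteq> 0" by auto
qed

lemma rf_repI:
  fixes p q :: "'a::field poly"
  assumes "h = Fraction_Field.Fract p q" "coprime p q" "q \<noteq> 0"
  obtains l where "l \<noteq> 0" "p = Polynomial.smult l (rf_num h)" "q = Polynomial.smult l (rf_den h)"
proof -
  obtain k where k: "p = k * rf_num h" "q = k * rf_den h"
    using coprime_fract_unique[OF rf_rep(2,4)[of h] assms(3)] rf_rep(1)[of h] assms(1) by metis
  then have "k dvd p" "k dvd q" by auto
  then have "k dvd 1" using assms(2) coprime_common_divisor by blast
  then obtain l where "k = [:l:]" "l \<noteq> 0"
    by (metis assms(3) degree_eq_zeroE is_unit_iff_degree k(2) mult_zero_left pCons_0_0)
  with k that show ?thesis by simp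
qed

text \<open>The value at a point of the projective line of the homogenisation of degree \<open>d\<close>.\<close>

definition hval :: "nat \<Rightarrow> 'a::field poly \<Rightarrow> 'a option \<Rightarrow> 'a" where
  "hval d p y = (case y of Some z \<Rightarrow> poly p z | None \<Rightarrow> Polynomial.coeff p d)"

lemma hval_simps [simp]: "hval d p (Some z) = poly p z" "hval d p None = Polynomial.coeff p d"
  by (simp_all add: hval_def)

lemma hval_zero [simp]: "hval d 0 y = 0" by (cases y) auto

lemma hval_add: "hval d (p + q) y = hval d p y + hval d q y" by (cases y) auto

lemma hval_diff: "hval d (p - q) y = hval d p y - hval d q y" by (cases y) auto

lemma hval_smult: "hval d (Polynomial.smult c p) y = c * hval d p y" by (cases y) auto

text \<open>Makes the value at infinity multiplicative, like the values at finite points.\<close>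

lemma coeff_mult_top:
  fixes p q :: "'a::field poly"
  assumes "Polynomial.degree p \<le> d" "Polynomial.degree q \<le> e"
  shows "Polynomial.coeff (p * q) (d + e) = Polynomial.coeff p d * Polynomial.coeff q e"
proof -
  have "Polynomial.coeff (p * q) (d + e) = (\<Sum>i\<le>d + e. Polynomial.coeff p i * Polynomial.coeff q (d + e - i))"
    by (simp add: coeff_mult)
  also have "\<dots> = (\<Sum>i\<in>{d}. Polynomial.coeff p i * Polynomial.coeff q (d + e - i))"
  proof (rule sum.mono_neutral_right)
    show "\<forall>i\<in>{..d + e} - {d}. Polynomial.coeff p i * Polynomial.coeff q (d + e - i) = 0"
    proof
      fix i assume "i \<in> {..d + e} - {d}"
      then consider "i > d" | "d + e - i > e" by force
      then show "Polynomial.coeff p i * Polynomial.coeff q (d + e - i) = 0"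
        using assms coeff_eq_0[of p i] coeff_eq_0[of q "d + e - i"] by cases auto
    qed
  qed auto
  finally show ?thesis by simp
qed

lemma hval_mult:
  assumes "Polynomial.degree p \<le> d" "Polynomial.degree q \<le> e"
  shows "hval (d + e) (p * q) y = hval d p y * hval e q y"
  using coeff_mult_top[OF assms] by (cases y) auto

text \<open>Admits any representing fraction and any common degree of homogenisation, so that values
  of sums and products are found without cancelling; \<open>rf_eval_Some_iff\<close> links it to the
  reduced form.\<close>

definition has_value :: "'a::field poly fract \<Rightarrow> 'a option \<Rightarrow> 'a \<Rightarrow> bool" where
  "has_value h y c \<longleftrightarrow> (\<exists>p q d. h = Fraction_Field.Fract p q \<and> Polynomial.degree p \<le> d \<and> Polynomial.degree q \<le> d \<and>
     hval d q y \<noteq> 0 \<and> c = hval d p y / hval d q y)"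

lemma has_valueI:
  "Polynomial.degree p \<le> d \<Longrightarrow> Polynomial.degree q \<le> d \<Longrightarrow> hval d q y \<noteq> 0 \<Longrightarrow>
    has_value (Fraction_Field.Fract p q) y (hval d p y / hval d q y)"
  unfolding has_value_def by blast

lemma has_value_unique:
  assumes "has_value h y c" "has_value h y c'"
  shows "c = c'"
proof -
  obtain p q d where 1: "h = Fraction_Field.Fract p q" "Polynomial.degree p \<le> d" "Polynomial.degree q \<le> d" "hval d q y \<noteq> 0"
    "c = hval d p y / hval d q y" using assms(1) unfolding has_value_def by blast
  obtain p' q' d' where 2: "h = Fraction_Field.Fract p' q'" "Polynomial.degree p' \<le> d'" "Polynomial.degree q' \<le> d'" "hval d' q' y \<noteq> 0"
    "c' = hval d' p' y / hval d' q' y" using assms(2) unfolding has_value_def by blast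
  have "q \<noteq> 0" "q' \<noteq> 0" using 1 2 by auto
  then have "p * q' = p' * q" using 1 2 by (simp add: eq_fract)
  then have "hval (d + d') (p * q') y = hval (d' + d) (p' * q) y" by (simp add: add.commute)
  then show ?thesis using 1 2 by (simp add: hval_mult frac_eq_eq)
qed

lemma has_value_add:
  assumes "has_value h y c" "has_value h' y c'"
  shows "has_value (h + h') y (c + c')"
proof -
  obtain p q d where 1: "h = Fraction_Field.Fract p q" "Polynomial.degree p \<le> d" "Polynomial.degree q \<le> d" "hval d q y \<noteq> 0"
    "c = hval d p y / hval d q y" using assms(1) unfolding has_value_def by blast
  obtain p' q' e where 2: "h' = Fraction_Field.Fract p' q'" "Polynomial.degree p' \<le> e" "Polynomial.degree q' \<le> e" "hval e q' y \<noteq> 0"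
    "c' = hval e p' y / hval e q' y" using assms(2) unfolding has_value_def by blast
  have nz: "q \<noteq> 0" "q' \<noteq> 0" using 1 2 by auto
  have d: "Polynomial.degree (p * q') \<le> d + e" "Polynomial.degree (p' * q) \<le> d + e" "Polynomial.degree (q * q') \<le> d + e"
    using degree_mult_le[of p q'] degree_mult_le[of p' q] degree_mult_le[of q q'] 1 2 by linarith+
  have "hval (d + e) (p' * q) y = hval d q y * hval e p' y"
    using hval_mult[of q d p' e] 1 2 by (simp add: mult.commute)
  moreover have "hval (d + e) (p * q') y = hval d p y * hval e q' y"
    "hval (d + e) (q * q') y = hval d q y * hval e q' y"
    using 1 2 by (simp_all add: hval_mult)
  ultimately have "hval (d + e) (p * q' + p' * q) y / hval (d + e) (q * q') y = c + c'"
    using 1(4) 2(4) unfolding 1(5) 2(5) hval_add by (simp add: field_simps)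
  moreover have "h + h' = Fraction_Field.Fract (p * q' + p' * q) (q * q')" using 1 2 nz by simp
  moreover have "Polynomial.degree (p * q' + p' * q) \<le> d + e" using d by (simp add: degree_add_le)
  moreover have "hval (d + e) (q * q') y \<noteq> 0" using 1 2 by (simp add: hval_mult)
  ultimately show ?thesis using has_valueI[of _ "d + e" "q * q'" y] d by metis
qed

lemma has_value_mult:
  assumes "has_value h y c" "has_value h' y c'"
  shows "has_value (h * h') y (c * c')"
proof -
  obtain p q d where 1: "h = Fraction_Field.Fract p q" "Polynomial.degree p \<le> d" "Polynomial.degree q \<le> d" "hval d q y \<noteq> 0"
    "c = hval d p y / hval d q y" using assms(1) unfolding has_value_def by blast
  obtain p' q' e where 2: "h' = Fraction_Field.Fract p' q'" "Polynomial.degree p' \<le> e" "Polynomial.degree q' \<le> e" "hval e q' y \<noteq> 0"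
    "c' = hval e p' y / hval e q' y" using assms(2) unfolding has_value_def by blast
  have d: "Polynomial.degree (p * p') \<le> d + e" "Polynomial.degree (q * q') \<le> d + e"
    using degree_mult_le[of p p'] degree_mult_le[of q q'] 1 2 by linarith+
  have "h * h' = Fraction_Field.Fract (p * p') (q * q')" using 1 2 by simp
  moreover have "hval (d + e) (p * p') y / hval (d + e) (q * q') y = c * c'"
    "hval (d + e) (q * q') y \<noteq> 0"
    using 1 2 by (simp_all add: hval_mult)
  ultimately show ?thesis using has_valueI[OF d, of y] by metis
qed

lemma has_value_inverse:
  assumes "has_value h y c" "c \<noteq> 0"
  shows "has_value (inverse h) y (inverse c)"
proof -
  obtain p q d where 1: "h = Fraction_Field.Fract p q" "Polynomial.degree p \<le> d" "Polynomial.degree q \<le> d" "hval d q y \<noteq> 0"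
    "c = hval d p y / hval d q y" using assms(1) unfolding has_value_def by blast
  then have "hval d p y \<noteq> 0" "inverse c = hval d q y / hval d p y" using assms(2) by auto
  then show ?thesis using has_valueI[of q d p y] 1 by simp
qed

lemma has_value_const: "has_value (rf_const c) y c"
  using has_valueI[of "[:c:]" 0 1 y] by (cases y) (auto simp: rf_const_def)

lemma rf_const_simps [simp]: "rf_const 0 = 0" "rf_const 1 = 1"
  "rf_const (- a) = - rf_const a"
  by (simp_all add: rf_const_def Zero_fract_def One_fract_def one_pCons)

lemma has_value_zero: "has_value 0 y 0"
  using has_value_const[of 0] by simp

lemma has_value_one: "has_value 1 y 1"
  using has_value_const[of 1] by simp

lemma has_value_minus: "has_value h y c \<Longrightarrow> has_value (- h) y (- c)"
  using has_value_mult[OF has_value_const[of "-1" y], of h c] by simp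

lemma has_value_diff: "has_value h y c \<Longrightarrow> has_value h' y c' \<Longrightarrow> has_value (h - h') y (c - c')"
  using has_value_add[OF _ has_value_minus, of h y c h' c'] by simp

lemma has_value_divide:
  "has_value h y c \<Longrightarrow> has_value h' y c' \<Longrightarrow> c' \<noteq> 0 \<Longrightarrow> has_value (h / h') y (c / c')"
  using has_value_mult[OF _ has_value_inverse, of h y c h' c'] by (simp add: field_class.field_divide_inverse)

lemma has_value_power: "has_value h y c \<Longrightarrow> has_value (h ^ n) y (c ^ n)"
  by (induction n) (auto simp: has_value_one has_value_mult)

section \<open>Evaluation of rational functions in terms of values\<close>

lemma rf_eval_hval:
  "rf_eval h y = (if hval (rf_degree h) (rf_den h) y = 0 then None
     else Some (hval (rf_degree h) (rf_num h) y / hval (rf_degree h) (rf_den h) y))"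
  by (cases y) (auto simp: rf_eval_def)

lemma rf_degree_bounds: "Polynomial.degree (rf_num h) \<le> rf_degree h" "Polynomial.degree (rf_den h) \<le> rf_degree h"
  by (simp_all add: rf_degree_def)

lemma num_den_not_both_zero:
  "hval (rf_degree h) (rf_num h) y \<noteq> 0 \<or> hval (rf_degree h) (rf_den h) y \<noteq> 0"
proof (cases y)
  case None
  show ?thesis
  proof (cases "Polynomial.degree (rf_den h) = rf_degree h")
    case True
    then show ?thesis using rf_rep(4)[of h] None by (metis hval_simps(2) leading_coeff_0_iff)
  next
    case False
    then have "Polynomial.degree (rf_num h) = rf_degree h" "rf_degree h \<noteq> 0"
      by (auto simp: rf_degree_def max_def split: if_splits)
    then show ?thesis using None by (metis degree_0 hval_simps(2) leading_coeff_0_iff)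
  qed
next
  case (Some z)
  obtain a b where "a * rf_num h + b * rf_den h = 1" using poly_bezout[OF rf_rep(2)] .
  then have "poly (a * rf_num h + b * rf_den h) z = 1" by simp
  then show ?thesis using Some by auto
qed

text \<open>For the converse, an arbitrary representing fraction is \<open>k\<close> times the
  reduced one. Since \<open>d\<close> exceeds \<open>rf_degree h\<close> by at least the degree of
  \<open>k\<close>, the factor \<open>k\<close> has a homogenised value of its own, and a nonzero
  value of \<open>q\<close> forces a nonzero value of the reduced denominator.\<close>

lemma rf_eval_Some_iff: "rf_eval h y = Some c \<longleftrightarrow> has_value h y c"
proof
  assume "rf_eval h y = Some c"
  then show "has_value h y c"
    using has_valueI[OF rf_degree_bounds, of h y] rf_rep(1)[of h]
    by (auto simp: rf_eval_hval split: if_splits)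
next
  assume hv: "has_value h y c"
  then obtain p q d where 1: "h = Fraction_Field.Fract p q" "Polynomial.degree p \<le> d" "Polynomial.degree q \<le> d" "hval d q y \<noteq> 0"
    unfolding has_value_def by blast
  then have q0: "q \<noteq> 0" by auto
  obtain k where k: "p = k * rf_num h" "q = k * rf_den h"
    using coprime_fract_unique[OF rf_rep(2,4)[of h] q0] rf_rep(1)[of h] 1(1) by metis
  have k0: "k \<noteq> 0" using q0 k by auto
  have dk: "Polynomial.degree k + rf_degree h \<le> d"
  proof (cases "rf_num h = 0")
    case True
    then show ?thesis using 1(3) k k0 rf_rep(4)[of h] by (simp add: rf_degree_def degree_mult_eq)
  next
    case False
    then show ?thesis using 1(2,3) k k0 rf_rep(4)[of h] by (simp add: rf_degree_def degree_mult_eq)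
  qed
  have "hval d q y = hval (d - rf_degree h) k y * hval (rf_degree h) (rf_den h) y"
    using hval_mult[of k "d - rf_degree h" "rf_den h" "rf_degree h" y] rf_degree_bounds[of h] dk k
    by simp
  then have "hval (rf_degree h) (rf_den h) y \<noteq> 0" using 1(4) by auto
  then have "rf_eval h y = Some (hval (rf_degree h) (rf_num h) y / hval (rf_degree h) (rf_den h) y)"
    "has_value h y (hval (rf_degree h) (rf_num h) y / hval (rf_degree h) (rf_den h) y)"
    using has_valueI[OF rf_degree_bounds, of h y] rf_rep(1)[of h] by (auto simp: rf_eval_hval)
  then show "rf_eval h y = Some c" using has_value_unique[OF hv] by auto
qed

lemma rf_eval_None_iff: "rf_eval h y = None \<longleftrightarrow> h \<noteq> 0 \<and> has_value (inverse h) y 0"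
proof
  assume n: "rf_eval h y = None"
  then have h0: "h \<noteq> 0" using rf_eval_Some_iff[of 0 y 0] has_value_zero by auto
  have v: "hval (rf_degree h) (rf_den h) y = 0" using n by (simp add: rf_eval_hval split: if_splits)
  then have "hval (rf_degree h) (rf_num h) y \<noteq> 0" using num_den_not_both_zero by blast
  then have "has_value (Fraction_Field.Fract (rf_den h) (rf_num h)) y 0"
    using has_valueI[OF rf_degree_bounds(2,1), of h y] v by simp
  moreover have "inverse h = Fraction_Field.Fract (rf_den h) (rf_num h)"
    by (subst rf_rep(1)[of h]) (rule inverse_fract)
  ultimately show "h \<noteq> 0 \<and> has_value (inverse h) y 0" using h0 by simp
next
  assume *: "h \<noteq> 0 \<and> has_value (inverse h) y 0"
  show "rf_eval h y = None"
  proof (rule ccontr)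
    assume "rf_eval h y \<noteq> None"
    then obtain c where "has_value h y c" using rf_eval_Some_iff by auto
    from has_value_mult[OF this conjunct2[OF *]] * have "has_value 1 y 0" by simp
    with has_value_unique[OF has_value_one] show False by fastforce
  qed
qed

lemma rf_eval_cases:
  obtains c where "rf_eval h y = Some c" "has_value h y c"
  | "rf_eval h y = None" "h \<noteq> 0" "has_value (inverse h) y 0"
proof (cases "rf_eval h y")
  case None
  then show ?thesis using that(2) by (simp add: rf_eval_None_iff)
next
  case (Some c)
  then show ?thesis using that(1) by (simp add: rf_eval_Some_iff)
qed

lemma zero_of_infinitely_many_zeros:
  assumes "infinite Z" "\<And>z. z \<in> Z \<Longrightarrow> has_value h (Some z) 0"
  shows "h = 0"
proof -
  have "poly (rf_num h) z = 0" if "z \<in> Z" for z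
    using assms(2)[OF that] unfolding rf_eval_Some_iff[symmetric]
    by (auto simp: rf_eval_hval split: if_splits)
  then have "Z \<subseteq> {z. poly (rf_num h) z = 0}" by auto
  then have "rf_num h = 0" using assms(1) poly_roots_finite finite_subset by metis
  then show ?thesis using rf_rep(1)[of h] by (simp add: fract_collapse)
qed

text \<open>Identity principle; several equations between rational functions below are checked on
  values at all but finitely many points.\<close>

lemma rf_eqI:
  assumes "infinite Z" "\<And>z. z \<in> Z \<Longrightarrow> has_value h (Some z) (c z)"
    "\<And>z. z \<in> Z \<Longrightarrow> has_value h' (Some z) (c z)"
  shows "h = h'"
proof -
  have "has_value (h - h') (Some z) 0" if "z \<in> Z" for z
    using has_value_diff[OF assms(2,3)[OF that]] by simp
  then show ?thesis using zero_of_infinitely_many_zeros[OF assms(1)] by fastforce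
qed

lemma finite_poles: "finite {z. rf_eval h (Some z) = None}"
proof -
  have "{z. rf_eval h (Some z) = None} \<subseteq> {z. poly (rf_den h) z = 0}"
    by (auto simp: rf_eval_hval split: if_splits)
  then show ?thesis using poly_roots_finite[OF rf_rep(4)] finite_subset by metis
qed

lemma rf_ext:
  fixes h h' :: "'a::field poly fract"
  assumes "infinite (UNIV :: 'a set)" "\<And>y. rf_eval h y = rf_eval h' y"
  shows "h = h'"
proof (rule rf_eqI)
  let ?Z = "UNIV - {z. rf_eval h (Some z) = None}"
  show "infinite ?Z" by (rule Diff_infinite_finite[OF finite_poles assms(1)])
  fix z assume "z \<in> ?Z"
  then show "has_value h (Some z) (the (rf_eval h (Some z)))"
    "has_value h' (Some z) (the (rf_eval h (Some z)))"
    using assms(2)[of "Some z"] by (auto simp: rf_eval_Some_iff[symmetric])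
qed

section \<open>Composition\<close>

definition poly_at :: "'a::field poly \<Rightarrow> 'a poly fract \<Rightarrow> 'a poly fract" where
  "poly_at p g = poly (map_poly rf_const p) g"

lemma rf_const_add: "rf_const (a + b) = rf_const a + rf_const b"
  by (simp add: rf_const_def)

lemma rf_const_mult: "rf_const (a * b) = rf_const a * rf_const b"
  by (simp add: rf_const_def mult.commute)

lemma poly_at_pCons: "poly_at (pCons a p) g = rf_const a + g * poly_at p g"
  by (simp add: poly_at_def map_poly_pCons)

lemma poly_at_0 [simp]: "poly_at 0 g = 0"
  by (simp add: poly_at_def)

lemma poly_at_1 [simp]: "poly_at 1 g = 1"
  by (simp add: poly_at_pCons one_pCons)

lemma poly_at_add: "poly_at (p + q) g = poly_at p g + poly_at q g"
  by (induction p q rule: poly_induct2) (auto simp: poly_at_pCons rf_const_add algebra_simps)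

lemma poly_at_smult: "poly_at (Polynomial.smult c p) g = rf_const c * poly_at p g"
  by (induction p) (auto simp: poly_at_pCons rf_const_mult algebra_simps)

lemma poly_at_mult: "poly_at (p * q) g = poly_at p g * poly_at q g"
  by (induction p) (auto simp: poly_at_pCons poly_at_add poly_at_smult algebra_simps)

lemma has_value_poly_at: "has_value g y c \<Longrightarrow> has_value (poly_at p g) y (poly p c)"
  by (induction p)
    (auto simp: poly_at_pCons has_value_zero intro!: has_value_add has_value_mult has_value_const)

text \<open>At a pole of \<open>g\<close> the polynomial in \<open>g\<close> grows at most like
  \<open>g ^ d\<close>; after division by this power only the coefficient in degree \<open>d\<close>
  survives.\<close>

lemma poly_at_infinity:
  assumes "g \<noteq> 0" "has_value (inverse g) y 0" "Polynomial.degree p \<le> d"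
  shows "\<exists>w. has_value w y (Polynomial.coeff p d) \<and> poly_at p g = g ^ d * w"
  using assms(3)
proof (induction d arbitrary: p)
  case 0
  then obtain a where "p = [:a:]" using degree_eq_zeroE by auto
  then show ?case using has_value_const by (intro exI[of _ "rf_const a"]) (auto simp: poly_at_pCons)
next
  case (Suc d)
  obtain a q where p: "p = pCons a q" by (cases p) auto
  then have "Polynomial.degree q \<le> d" using Suc.prems by (cases "q = 0") auto
  then obtain w where w: "has_value w y (Polynomial.coeff q d)" "poly_at q g = g ^ d * w"
    using Suc.IH by blast
  have "has_value (rf_const a * inverse g ^ Suc d + w) y (a * 0 ^ Suc d + Polynomial.coeff q d)"
    using assms w by (intro has_value_add has_value_mult has_value_const has_value_power)
  moreover have "poly_at p g = g ^ Suc d * (rf_const a * inverse g ^ Suc d + w)"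
    using assms(1) w by (simp add: p poly_at_pCons field_simps)
  ultimately show ?case using p by auto
qed

text \<open>For such \<open>g\<close> no denominator vanishes on substitution, and
  \<open>rf_comp\<close> is a field homomorphism in its first argument.\<close>

definition transcendental :: "'a::field poly fract \<Rightarrow> bool" where
  "transcendental g \<longleftrightarrow> (\<forall>q. q \<noteq> 0 \<longrightarrow> poly_at q g \<noteq> 0)"

lemma transcendentalI:
  assumes "infinite {c. \<exists>y. rf_eval g y = Some c}"
  shows "transcendental g"
  unfolding transcendental_def
proof (intro allI impI notI)
  fix q assume q: "q \<noteq> 0" "poly_at q g = 0"
  have "poly q c = 0" if "rf_eval g y = Some c" for c y
    using has_value_poly_at[of g y c q] that q(2) has_value_unique[OF has_value_zero]
    by (simp add: rf_eval_Some_iff)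
  then have "{c. \<exists>y. rf_eval g y = Some c} \<subseteq> {c. poly q c = 0}" by auto
  then show False using assms poly_roots_finite[OF q(1)] finite_subset by metis
qed

lemma rf_comp_eq: "rf_comp h g = poly_at (rf_num h) g / poly_at (rf_den h) g"
  by (simp add: rf_comp_def poly_at_def)

lemma rf_comp_Fract:
  assumes "transcendental g" "q \<noteq> 0"
  shows "rf_comp (Fraction_Field.Fract p q) g = poly_at p g / poly_at q g"
proof -
  let ?h = "Fraction_Field.Fract p q"
  have "rf_num ?h * q = p * rf_den ?h"
    using rf_rep(1)[of ?h] rf_rep(4)[of ?h] assms(2) by (simp add: eq_fract)
  then have "poly_at (rf_num ?h) g * poly_at q g = poly_at p g * poly_at (rf_den ?h) g"
    by (metis poly_at_mult)
  moreover have "poly_at q g \<noteq> 0" "poly_at (rf_den ?h) g \<noteq> 0"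
    using assms rf_rep(4) unfolding transcendental_def by blast+
  ultimately show ?thesis by (simp add: rf_comp_eq frac_eq_eq)
qed

lemma rf_comp_hom:
  assumes g: "transcendental g"
  shows "rf_comp (h + h') g = rf_comp h g + rf_comp h' g"
    "rf_comp (h * h') g = rf_comp h g * rf_comp h' g"
    "rf_comp (inverse h) g = inverse (rf_comp h g)"
    "rf_comp (rf_const c) g = rf_const c"
    "rf_comp rf_X g = g"
proof -
  obtain p q where h: "h = Fraction_Field.Fract p q" "q \<noteq> 0" by (cases h) auto
  obtain p' q' where h': "h' = Fraction_Field.Fract p' q'" "q' \<noteq> 0" by (cases h') auto
  have nz: "poly_at q g \<noteq> 0" "poly_at q' g \<noteq> 0"
    using g h h' unfolding transcendental_def by blast+
  show "rf_comp (h + h') g = rf_comp h g + rf_comp h' g"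
    using h h' nz by (simp add: rf_comp_Fract[OF g] poly_at_add poly_at_mult field_simps)
  show "rf_comp (h * h') g = rf_comp h g * rf_comp h' g"
    using h h' nz by (simp add: rf_comp_Fract[OF g] poly_at_mult)
  show "rf_comp (rf_const c) g = rf_const c"
    by (simp add: rf_const_def rf_comp_Fract[OF g]) (simp add: poly_at_pCons rf_const_def)
  have z: "rf_comp 0 g = 0"
    using rf_comp_Fract[OF g, of 1 0] by (simp add: fract_collapse)
  show "rf_comp (inverse h) g = inverse (rf_comp h g)"
  proof (cases "p = 0")
    case True
    then show ?thesis using h z by (simp add: fract_collapse)
  next
    case False
    then show ?thesis using h by (simp add: rf_comp_Fract[OF g])
  qed
  show "rf_comp rf_X g = g"
    by (simp add: rf_X_def rf_comp_Fract[OF g]) (simp add: poly_at_pCons)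
qed

lemma rf_comp_simps:
  assumes g: "transcendental g"
  shows "rf_comp 0 g = 0" "rf_comp 1 g = 1" "rf_comp (- h) g = - rf_comp h g"
    "rf_comp (h - h') g = rf_comp h g - rf_comp h' g" "rf_comp (h / h') g = rf_comp h g / rf_comp h' g"
proof -
  show "rf_comp 0 g = 0" "rf_comp 1 g = 1"
    using rf_comp_hom(4)[OF g] rf_const_simps by metis+
  have "- h = rf_const (- 1) * h" for h :: "'a poly fract" by simp
  then show m: "rf_comp (- h) g = - rf_comp h g" for h
    using rf_comp_hom(2,4)[OF g] by (metis)
  show "rf_comp (h - h') g = rf_comp h g - rf_comp h' g"
    using rf_comp_hom(1)[OF g, of h "- h'"] m by simp
  show "rf_comp (h / h') g = rf_comp h g / rf_comp h' g"
    by (simp add: field_class.field_divide_inverse rf_comp_hom[OF g])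
qed

lemma rf_comp_eq_0_iff:
  assumes g: "transcendental g"
  shows "rf_comp h g = 0 \<longleftrightarrow> h = 0"
proof
  assume "rf_comp h g = 0"
  show "h = 0"
  proof (rule ccontr)
    assume "h \<noteq> 0"
    then have "rf_comp 1 g = rf_comp h g * rf_comp (inverse h) g"
      by (simp flip: rf_comp_hom(2)[OF g])
    then show False using \<open>rf_comp h g = 0\<close> rf_comp_simps(2)[OF g] by simp
  qed
qed (simp add: rf_comp_simps[OF g])

text \<open>At a pole of \<open>g\<close>, numerator and denominator are both divided by
  \<open>g\<close> to the degree of \<open>h\<close>. The quotient is unchanged, and the remaining
  values are the homogenised ones at infinity.\<close>

lemma rf_eval_comp:
  assumes g: "transcendental g"
  shows "rf_eval (rf_comp h g) y = rf_eval h (rf_eval g y)"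
proof -
  let ?d = "rf_degree h" and ?x = "rf_eval g y"
  have "\<exists>v w. has_value v y (hval ?d (rf_num h) ?x) \<and> has_value w y (hval ?d (rf_den h) ?x) \<and>
      w \<noteq> 0 \<and> rf_comp h g = v / w"
  proof (cases rule: rf_eval_cases[of g y])
    case (1 c)
    have "poly_at (rf_den h) g \<noteq> 0" using g rf_rep(4) unfolding transcendental_def by blast
    then show ?thesis using has_value_poly_at[OF 1(2)] 1(1)
      by (intro exI[of _ "poly_at (rf_num h) g"] exI[of _ "poly_at (rf_den h) g"])
        (simp add: rf_comp_eq)
  next
    case 2
    obtain v where v: "has_value v y (Polynomial.coeff (rf_num h) ?d)" "poly_at (rf_num h) g = g ^ ?d * v"
      using poly_at_infinity[OF 2(2,3) rf_degree_bounds(1)] by blast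
    obtain w where w: "has_value w y (Polynomial.coeff (rf_den h) ?d)" "poly_at (rf_den h) g = g ^ ?d * w"
      using poly_at_infinity[OF 2(2,3) rf_degree_bounds(2)] by blast
    have "poly_at (rf_den h) g \<noteq> 0" using g rf_rep(4) unfolding transcendental_def by blast
    then have "w \<noteq> 0" using w by auto
    moreover have "rf_comp h g = v / w" using 2(2) v w by (simp add: rf_comp_eq)
    ultimately show ?thesis using v w 2 by auto
  qed
  then obtain v w where vw: "has_value v y (hval ?d (rf_num h) ?x)"
    "has_value w y (hval ?d (rf_den h) ?x)" "w \<noteq> 0" "rf_comp h g = v / w" by blast
  show ?thesis
  proof (cases "hval ?d (rf_den h) ?x = 0")
    case True
    then have nz: "hval ?d (rf_num h) ?x \<noteq> 0" using num_den_not_both_zero by blast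
    then have "v \<noteq> 0" using vw(1) has_value_unique[OF has_value_zero] by fastforce
    moreover have "has_value (w / v) y 0" using has_value_divide[OF vw(2,1) nz] True by simp
    ultimately have "rf_eval (rf_comp h g) y = None"
      using vw(3,4) by (simp add: rf_eval_None_iff)
    then show ?thesis using True by (simp add: rf_eval_hval[of h])
  next
    case False
    then show ?thesis using has_value_divide[OF vw(1,2)] vw(4)
      by (simp add: rf_eval_hval[of h] rf_eval_Some_iff)
  qed
qed

section \<open>Rational functions over a subfield\<close>

definition coeffs_in :: "'a set \<Rightarrow> 'a::zero poly \<Rightarrow> bool" where
  "coeffs_in F p \<longleftrightarrow> range (Polynomial.coeff p) \<subseteq> F"

lemma coeffs_in_iff: "coeffs_in F p \<longleftrightarrow> (\<forall>n. Polynomial.coeff p n \<in> F)"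
  by (auto simp: coeffs_in_def)

definition rational_over :: "'a::field set \<Rightarrow> 'a poly fract \<Rightarrow> bool" where
  "rational_over F h \<longleftrightarrow>
     (\<exists>p q. q \<noteq> 0 \<and> h = Fraction_Field.Fract p q \<and> coeffs_in F p \<and> coeffs_in F q)"

definition points_over :: "'a set \<Rightarrow> 'a option set" where
  "points_over F = insert None (Some ` F)"

lemma coeffs_in_pCons: "coeffs_in F (pCons a p) \<longleftrightarrow> a \<in> F \<and> coeffs_in F p"
proof
  assume *: "coeffs_in F (pCons a p)"
  have "Polynomial.coeff (pCons a p) 0 \<in> F" "Polynomial.coeff (pCons a p) (Suc n) \<in> F" for n
    using * unfolding coeffs_in_iff by blast+
  then show "a \<in> F \<and> coeffs_in F p" by (auto simp: coeffs_in_iff)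
next
  assume "a \<in> F \<and> coeffs_in F p"
  then show "coeffs_in F (pCons a p)" by (auto simp: coeffs_in_iff coeff_pCons split: nat.split)
qed

locale subfield_set =
  fixes F :: "'a::field set"
  assumes one_in: "1 \<in> F"
    and diff_in: "a \<in> F \<Longrightarrow> b \<in> F \<Longrightarrow> a - b \<in> F"
    and mult_in: "a \<in> F \<Longrightarrow> b \<in> F \<Longrightarrow> a * b \<in> F"
    and inverse_in: "a \<in> F \<Longrightarrow> inverse a \<in> F"
begin

lemma zero_in: "0 \<in> F" using diff_in[OF one_in one_in] by simp

lemma minus_in: "a \<in> F \<Longrightarrow> - a \<in> F" using diff_in[OF zero_in, of a] by simp

lemma add_in: "a \<in> F \<Longrightarrow> b \<in> F \<Longrightarrow> a + b \<in> F" using diff_in[of a "- b"] minus_in[of b] by simp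

lemma divide_in: "a \<in> F \<Longrightarrow> b \<in> F \<Longrightarrow> a / b \<in> F"
  using mult_in[OF _ inverse_in, of a b] by (simp add: field_class.field_divide_inverse)

lemmas field_in = zero_in one_in minus_in add_in diff_in mult_in inverse_in divide_in

lemma coeffs_in_0: "coeffs_in F 0" using zero_in by (auto simp: coeffs_in_iff)

lemma coeffs_in_1: "coeffs_in F 1" using zero_in one_in by (auto simp: coeffs_in_iff)

lemma coeffs_in_add: "coeffs_in F p \<Longrightarrow> coeffs_in F q \<Longrightarrow> coeffs_in F (p + q)"
  using add_in by (auto simp: coeffs_in_iff)

lemma coeffs_in_smult: "c \<in> F \<Longrightarrow> coeffs_in F p \<Longrightarrow> coeffs_in F (Polynomial.smult c p)"
  using mult_in by (auto simp: coeffs_in_iff)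

lemma coeffs_in_mult:
  assumes "coeffs_in F p" "coeffs_in F q"
  shows "coeffs_in F (p * q)"
  using assms(1)
proof (induction p)
  case (pCons a p)
  then have *: "a \<in> F" "coeffs_in F (p * q)" by (auto simp: coeffs_in_pCons)
  then have "coeffs_in F (Polynomial.smult a q + pCons 0 (p * q))"
    using assms(2) zero_in by (intro coeffs_in_add coeffs_in_smult) (auto simp: coeffs_in_pCons)
  then show ?case by simp
qed (simp add: coeffs_in_0 zero_in)

lemma hval_in:
  assumes "coeffs_in F p" "y \<in> points_over F"
  shows "hval d p y \<in> F"
proof (cases y)
  case None
  then show ?thesis using assms(1) by (auto simp: coeffs_in_iff)
next
  case (Some z)
  then have "z \<in> F" using assms(2) by (auto simp: points_over_def)
  have "poly p z \<in> F" using assms(1)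
    by (induction p) (use \<open>z \<in> F\<close> in \<open>auto simp: zero_in coeffs_in_pCons intro!: add_in mult_in\<close>)
  then show ?thesis using Some by simp
qed

lemma rational_overI:
  "coeffs_in F p \<Longrightarrow> coeffs_in F q \<Longrightarrow> q \<noteq> 0 \<Longrightarrow> rational_over F (Fraction_Field.Fract p q)"
  unfolding rational_over_def by blast

lemma rational_const: "c \<in> F \<Longrightarrow> rational_over F (rf_const c)"
  unfolding rf_const_def by (rule rational_overI) (auto simp: coeffs_in_pCons coeffs_in_0 coeffs_in_1)

lemma rational_add:
  assumes "rational_over F h" "rational_over F h'"
  shows "rational_over F (h + h')"
proof -
  obtain p q p' q' where *: "h = Fraction_Field.Fract p q" "h' = Fraction_Field.Fract p' q'" "q \<noteq> 0" "q' \<noteq> 0"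
    "coeffs_in F p" "coeffs_in F q" "coeffs_in F p'" "coeffs_in F q'"
    using assms unfolding rational_over_def by blast
  then have "h + h' = Fraction_Field.Fract (p * q' + p' * q) (q * q')" by simp
  then show ?thesis using * by (auto intro!: rational_overI coeffs_in_add coeffs_in_mult
    simp del: add_fract)
qed

lemma rational_mult:
  assumes "rational_over F h" "rational_over F h'"
  shows "rational_over F (h * h')"
proof -
  obtain p q p' q' where *: "h = Fraction_Field.Fract p q" "h' = Fraction_Field.Fract p' q'" "q \<noteq> 0" "q' \<noteq> 0"
    "coeffs_in F p" "coeffs_in F q" "coeffs_in F p'" "coeffs_in F q'"
    using assms unfolding rational_over_def by blast
  then have "h * h' = Fraction_Field.Fract (p * p') (q * q')" by simp
  then show ?thesis using * by (auto intro!: rational_overI coeffs_in_mult simp del: mult_fract)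
qed

lemma rational_0: "rational_over F 0" using rational_const[OF zero_in] by simp

lemma rational_1: "rational_over F 1" using rational_const[OF one_in] by simp

lemma rational_inverse:
  assumes "rational_over F h"
  shows "rational_over F (inverse h)"
proof (cases "h = 0")
  case True
  then show ?thesis using rational_0 by simp
next
  case False
  obtain p q where *: "h = Fraction_Field.Fract p q" "q \<noteq> 0" "coeffs_in F p" "coeffs_in F q"
    using assms unfolding rational_over_def by blast
  then have "p \<noteq> 0" using False by (auto simp: fract_collapse)
  then show ?thesis using * by (auto intro!: rational_overI)
qed

lemma rational_minus: "rational_over F h \<Longrightarrow> rational_over F (- h)"
  using rational_mult[OF rational_const[OF minus_in[OF one_in]], of h] by simp

lemma rational_diff: "rational_over F h \<Longrightarrow> rational_over F h' \<Longrightarrow> rational_over F (h - h')"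
  using rational_add[OF _ rational_minus, of h h'] by simp

lemma rational_divide: "rational_over F h \<Longrightarrow> rational_over F h' \<Longrightarrow> rational_over F (h / h')"
  using rational_mult[OF _ rational_inverse, of h h'] by (simp add: field_class.field_divide_inverse)

text \<open>Brings constants found over the algebraic closure back to \<open>F\<close>, by comparing
  one coefficient.\<close>

lemma rational_const_iff: "rational_over F (rf_const c) \<longleftrightarrow> c \<in> F"
proof
  assume "rational_over F (rf_const c)"
  then obtain p q where *: "q \<noteq> 0" "Fraction_Field.Fract [:c:] 1 = Fraction_Field.Fract p q"
    "coeffs_in F p" "coeffs_in F q"
    unfolding rational_over_def rf_const_def by blast
  then have "Polynomial.smult c q = p" by (simp add: eq_fract)
  then have "c * Polynomial.coeff q (Polynomial.degree q) = Polynomial.coeff p (Polynomial.degree q)" by (metis coeff_smult)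
  then have "c = Polynomial.coeff p (Polynomial.degree q) / Polynomial.coeff q (Polynomial.degree q)" using *(1) by (simp add: field_simps)
  moreover have "Polynomial.coeff p (Polynomial.degree q) \<in> F" "Polynomial.coeff q (Polynomial.degree q) \<in> F" using * by (auto simp: coeffs_in_iff)
  ultimately show "c \<in> F" by (simp add: divide_in)
qed (rule rational_const)

text \<open>The field of rational functions over \<open>F\<close> is generated by \<open>F\<close>
  and \<open>rf_X\<close>.\<close>

lemma rational_over_induct [consumes 1, case_names const X add mult inverse]:
  assumes "rational_over F h"
    and const: "\<And>c. c \<in> F \<Longrightarrow> P (rf_const c)" and X: "P rf_X"
    and add: "\<And>g h. P g \<Longrightarrow> P h \<Longrightarrow> P (g + h)" and mult: "\<And>g h. P g \<Longrightarrow> P h \<Longrightarrow> P (g * h)"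
    and inverse: "\<And>g. P g \<Longrightarrow> P (inverse g)"
  shows "P h"
proof -
  have poly: "P (Fraction_Field.Fract p 1)" if "coeffs_in F p" for p
    using that
  proof (induction p)
    case 0
    then show ?case using const[OF zero_in] by (simp add: fract_collapse)
  next
    case (pCons a p)
    have "Fraction_Field.Fract (pCons a p) 1 = rf_const a + rf_X * Fraction_Field.Fract p 1"
      by (simp add: rf_const_def rf_X_def)
    then show ?case using pCons const X add mult by (auto simp: coeffs_in_pCons)
  qed
  obtain p q where *: "h = Fraction_Field.Fract p q" "q \<noteq> 0" "coeffs_in F p" "coeffs_in F q"
    using assms(1) unfolding rational_over_def by blast
  have "h = Fraction_Field.Fract p 1 * inverse (Fraction_Field.Fract q 1)" using * by simp
  then show ?thesis using poly *(3,4) mult inverse by metis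
qed

lemma rational_comp:
  assumes "transcendental g" "rational_over F g" "rational_over F h"
  shows "rational_over F (rf_comp h g)"
  using assms(3)
  by (induction rule: rational_over_induct)
    (auto simp: rf_comp_hom[OF assms(1)] assms(2) rational_const rational_add rational_mult rational_inverse)

section \<open>Coordinate rings\<close>

lemma coord_ring_simps:
  "h \<in> carrier (coord_ring F S) \<longleftrightarrow> rational_over F h \<and> (\<forall>y. y \<notin> S \<longrightarrow> rf_eval h y \<noteq> None)"
  "g \<oplus>\<^bsub>coord_ring F S\<^esub> h = g + h" "g \<otimes>\<^bsub>coord_ring F S\<^esub> h = g * h"
  "\<one>\<^bsub>coord_ring F S\<^esub> = 1" "\<zero>\<^bsub>coord_ring F S\<^esub> = 0"
  by (simp_all add: coord_ring_def ring_of_type_algebra_def rational_over_def coeffs_in_def)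

definition rf_value :: "'a poly fract \<Rightarrow> 'a option \<Rightarrow> 'a" where
  "rf_value h y = the (rf_eval h y)"

lemma rf_valueI: "has_value h y c \<Longrightarrow> rf_value h y = c"
  by (simp add: rf_value_def flip: rf_eval_Some_iff)

lemma coord_ring_has_value:
  "h \<in> carrier (coord_ring F S) \<Longrightarrow> y \<notin> S \<Longrightarrow> has_value h y (rf_value h y)"
  by (auto simp: coord_ring_simps rf_value_def simp flip: rf_eval_Some_iff)

lemma coord_ringI:
  "rational_over F h \<Longrightarrow> (\<And>y. y \<notin> S \<Longrightarrow> \<exists>c. has_value h y c) \<Longrightarrow> h \<in> carrier (coord_ring F S)"
  by (auto simp: coord_ring_simps simp flip: rf_eval_Some_iff)

lemma coord_ring_closed:
  assumes "g \<in> carrier (coord_ring F S)" "h \<in> carrier (coord_ring F S)"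
  shows "g + h \<in> carrier (coord_ring F S)" "g * h \<in> carrier (coord_ring F S)"
    "- g \<in> carrier (coord_ring F S)"
proof -
  have r: "rational_over F g" "rational_over F h" using assms by (auto simp: coord_ring_simps)
  show "g + h \<in> carrier (coord_ring F S)"
    using r coord_ring_has_value[OF assms(1)] coord_ring_has_value[OF assms(2)]
    by (intro coord_ringI rational_add exI) (auto intro: has_value_add)
  show "g * h \<in> carrier (coord_ring F S)"
    using r coord_ring_has_value[OF assms(1)] coord_ring_has_value[OF assms(2)]
    by (intro coord_ringI rational_mult exI) (auto intro: has_value_mult)
  show "- g \<in> carrier (coord_ring F S)"
    using r coord_ring_has_value[OF assms(1)]
    by (intro coord_ringI rational_minus exI) (auto intro: has_value_minus)
qed

lemma const_in_coord_ring: "c \<in> F \<Longrightarrow> rf_const c \<in> carrier (coord_ring F S)"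
  by (intro coord_ringI rational_const exI) (auto intro: has_value_const)

lemma zero_one_in_coord_ring: "0 \<in> carrier (coord_ring F S)" "1 \<in> carrier (coord_ring F S)"
  using const_in_coord_ring[OF zero_in] const_in_coord_ring[OF one_in] by auto

lemma cring_coord_ring: "cring (coord_ring F S)"
proof (rule cringI)
  show "abelian_group (coord_ring F S)"
  proof (rule abelian_groupI)
    fix g assume "g \<in> carrier (coord_ring F S)"
    then show "\<exists>h\<in>carrier (coord_ring F S). h \<oplus>\<^bsub>coord_ring F S\<^esub> g = \<zero>\<^bsub>coord_ring F S\<^esub>"
      using coord_ring_closed(3) by (intro bexI[of _ "- g"]) (auto simp: coord_ring_simps(2-))
  qed (auto simp: coord_ring_simps(2-) coord_ring_closed zero_one_in_coord_ring)
  show "Group.comm_monoid (coord_ring F S)"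
    by (rule comm_monoidI)
      (auto simp: coord_ring_simps(2-) coord_ring_closed zero_one_in_coord_ring)
qed (auto simp: coord_ring_simps(2-) distrib_right)

lemma eval_hom_value:
  "h \<in> carrier (coord_ring F S) \<Longrightarrow> eval_hom (coord_ring F S) y h = rf_value h y"
  by (simp add: eval_hom_def rf_value_def)

lemma eval_hom_ring_hom:
  assumes "y \<notin> S"
  shows "eval_hom (coord_ring F S) y \<in> ring_hom (coord_ring F S) ring_of_type_algebra"
proof (rule ring_hom_memI)
  fix g h assume gh: "g \<in> carrier (coord_ring F S)" "h \<in> carrier (coord_ring F S)"
  note v = coord_ring_has_value[OF gh(1) assms] coord_ring_has_value[OF gh(2) assms]
  show "eval_hom (coord_ring F S) y (g \<otimes>\<^bsub>coord_ring F S\<^esub> h) =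
      eval_hom (coord_ring F S) y g \<otimes>\<^bsub>ring_of_type_algebra\<^esub> eval_hom (coord_ring F S) y h"
    "eval_hom (coord_ring F S) y (g \<oplus>\<^bsub>coord_ring F S\<^esub> h) =
      eval_hom (coord_ring F S) y g \<oplus>\<^bsub>ring_of_type_algebra\<^esub> eval_hom (coord_ring F S) y h"
    using gh rf_valueI[OF has_value_mult[OF v]] rf_valueI[OF has_value_add[OF v]]
    by (simp_all add: coord_ring_simps(2-) coord_ring_closed eval_hom_value ring_of_type_algebra_def)
next
  show "eval_hom (coord_ring F S) y \<one>\<^bsub>coord_ring F S\<^esub> = \<one>\<^bsub>ring_of_type_algebra\<^esub>"
    using rf_valueI[OF has_value_one]
    by (simp add: coord_ring_simps(2-) zero_one_in_coord_ring eval_hom_value ring_of_type_algebra_def)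
qed (simp add: ring_of_type_algebra_def)

lemma coord_ring_unitI:
  assumes "g \<in> carrier (coord_ring F S)" "h \<in> carrier (coord_ring F S)" "g * h = 1"
  shows "g \<in> Units (coord_ring F S)"
  using assms unfolding Units_def by (auto simp: coord_ring_simps(2-) mult.commute)

lemma const_unit: "c \<in> F \<Longrightarrow> c \<noteq> 0 \<Longrightarrow> rf_const c \<in> Units (coord_ring F S)"
  by (rule coord_ring_unitI[of _ _ "rf_const (inverse c)"])
    (auto intro: const_in_coord_ring inverse_in simp flip: rf_const_mult)

end

section \<open>Moebius functions\<close>

text \<open>\<open>pdet x y\<close> is the determinant of the representatives \<open>(a, 1)\<close> of \<open>Some a\<close> and \<open>(1, 0)\<close>
  of \<open>None\<close>.\<close>

definition pdet :: "'a::field option \<Rightarrow> 'a option \<Rightarrow> 'a" where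
  "pdet x y = (case x of
       Some a \<Rightarrow> (case y of Some b \<Rightarrow> a - b | None \<Rightarrow> - 1)
     | None \<Rightarrow> (case y of Some b \<Rightarrow> 1 | None \<Rightarrow> 0))"

lemma pdet_simps [simp]: "pdet (Some a) (Some b) = a - b" "pdet (Some a) None = - 1"
  "pdet None (Some b) = 1" "pdet None None = 0"
  by (simp_all add: pdet_def)

lemma pdet_eq_0_iff [simp]: "pdet x y = 0 \<longleftrightarrow> x = y"
  by (cases x; cases y) auto

lemma pdet_swap: "pdet y x = - pdet x y"
  by (cases x; cases y) auto

text \<open>The Pluecker relation; it turns equality of ratios of determinants into equality of
  points.\<close>

lemma pdet_pluecker: "pdet a c * pdet b d - pdet b c * pdet a d = pdet a b * pdet c d"
  by (cases a; cases b; cases c; cases d) (auto simp: algebra_simps)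

lemma pdet_ratio_eq:
  assumes "c \<noteq> d" "pdet a c * pdet b d = pdet b c * pdet a d"
  shows "a = b"
  using pdet_pluecker[of a c b d] assms by simp

text \<open>The constant at infinity is chosen so that \<open>hval_lin\<close> holds with no sign
  and no case distinction.\<close>

definition lin :: "'a::field option \<Rightarrow> 'a poly" where
  "lin a = (case a of Some z \<Rightarrow> [:- z, 1:] | None \<Rightarrow> [:- 1:])"

lemma lin_nonzero [simp]: "lin a \<noteq> 0" by (cases a) (auto simp: lin_def)

lemma degree_lin: "Polynomial.degree (lin a) \<le> 1" by (cases a) (auto simp: lin_def)

lemma hval_lin: "hval 1 (lin a) y = pdet y a"
  by (cases a; cases y) (auto simp: lin_def)

definition mobius :: "'a::field option \<Rightarrow> 'a option \<Rightarrow> 'a poly fract" where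
  "mobius a b = Fraction_Field.Fract (lin a) (lin b)"

lemma has_value_mobius: "y \<noteq> b \<Longrightarrow> has_value (mobius a b) y (pdet y a / pdet y b)"
  using has_valueI[OF degree_lin degree_lin, of b y a] unfolding mobius_def hval_lin by simp

lemma mobius_mult: "mobius a b * mobius b c = mobius a c"
  by (simp add: mobius_def eq_fract)

lemma mobius_self [simp]: "mobius a a = 1"
  by (simp add: mobius_def One_fract_def eq_fract)

lemma mobius_nonzero [simp]: "mobius a b \<noteq> 0"
  using mobius_mult[of a b a] by auto

text \<open>A Moebius function takes every nonzero value away from its pole; if zero and pole are
  finite, the value 1 is taken at infinity.\<close>

lemma mobius_solve:
  assumes "a \<noteq> b" "s \<noteq> 0"
  obtains x where "x \<noteq> b" "pdet x a = s * pdet x b"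
proof -
  have "\<exists>x. x \<noteq> b \<and> pdet x a = s * pdet x b"
  proof (cases a)
    case None
    then obtain z where b: "b = Some z" using assms by (cases b) auto
    show ?thesis using None b assms by (intro exI[of _ "Some (z - inverse s)"]) (auto simp: algebra_simps)
  next
    case (Some w)
    show ?thesis
    proof (cases b)
      case None
      then show ?thesis using Some by (intro exI[of _ "Some (w - s)"]) auto
    next
      case b: (Some z)
      show ?thesis
      proof (cases "s = 1")
        case True
        then show ?thesis using Some b by (intro exI[of _ None]) auto
      next
        case False
        have wz: "w \<noteq> z" using assms Some b by auto
        have s1: "1 - s \<noteq> 0" using False by simp
        have "(w - s * z) / (1 - s) - w = s * ((w - s * z) / (1 - s) - z)"
          using s1 by (simp add: field_simps)
        moreover have "(w - s * z) / (1 - s) \<noteq> z" using s1 wz by (simp add: field_simps)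
        ultimately show ?thesis using Some b by (intro exI[of _ "Some ((w - s * z) / (1 - s))"]) auto
      qed
    qed
  qed
  then show ?thesis using that by blast
qed

lemma (in subfield_set) rational_mobius:
  assumes "a \<in> points_over F" "b \<in> points_over F"
  shows "rational_over F (mobius a b)"
proof -
  have "coeffs_in F (lin a)" if "a \<in> points_over F" for a
    using that by (cases a) (auto simp: lin_def points_over_def coeffs_in_pCons coeffs_in_0 field_in)
  then show ?thesis unfolding mobius_def using assms by (intro rational_overI) auto
qed

lemma (in subfield_set) mobius_unit:
  assumes "a \<in> points_over F" "b \<in> points_over F" "a \<in> S" "b \<in> S"
  shows "mobius a b \<in> Units (coord_ring F S)"
proof -
  have "mobius a b \<in> carrier (coord_ring F S)"
    if "a \<in> points_over F" "b \<in> points_over F" "a \<in> S" "b \<in> S" for a b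
  proof (rule coord_ringI)
    show "\<exists>c. has_value (mobius a b) y c" if "y \<notin> S" for y
      using has_value_mobius[of y b a] \<open>b \<in> S\<close> that by blast
  qed (rule rational_mobius[OF that(1,2)])
  then show ?thesis
    using assms by (intro coord_ring_unitI[of _ _ "mobius b a"]) (auto simp: mobius_mult)
qed

text \<open>\<open>rf_X\<close> is a rational expression in a Moebius function, with coefficients
  from its zero and pole; so a property closed under field operations passes from that function to
  \<open>rf_X\<close>.\<close>

lemma X_from_mobius:
  assumes "a \<noteq> b" and P: "\<And>c. c \<in> C \<Longrightarrow> P (rf_const c)" "a \<in> points_over C" "b \<in> points_over C" "1 \<in> C" "- 1 \<in> C"
    and add: "\<And>g h. P g \<Longrightarrow> P h \<Longrightarrow> P (g + h)" and mult: "\<And>g h. P g \<Longrightarrow> P h \<Longrightarrow> P (g * h)"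
    and inverse: "\<And>g. P g \<Longrightarrow> P (inverse g)" and m: "P (mobius a b)"
  shows "P (rf_X :: 'a::field poly fract)"
proof -
  have c1: "P 1" "P (- 1)" using P(1)[OF P(4)] P(1)[OF P(5)] by simp_all
  have neg: "P (- g)" if "P g" for g using mult[OF c1(2) that] by simp
  have diff: "P (g - h)" if "P g" "P h" for g h using add[OF that(1) neg[OF that(2)]] by simp
  have X: "rf_X - rf_const z = Fraction_Field.Fract [:- z, 1:] 1" for z :: 'a
    by (simp add: rf_X_def rf_const_def)
  have l: "mobius (Some w) (Some z) = (rf_X - rf_const w) / (rf_X - rf_const z)" 
    "mobius (Some w) None = rf_const w - rf_X" "mobius None (Some z) = - inverse (rf_X - rf_const z)"
    for w z :: 'a
    unfolding X by (simp_all add: mobius_def lin_def eq_fract rf_X_def rf_const_def)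
  have nz: "rf_X - rf_const z \<noteq> 0" for z :: 'a
    unfolding X by (simp add: Zero_fract_def eq_fract)
  have inj: "rf_const w \<noteq> rf_const z" if "w \<noteq> z" for w z :: 'a
    using that by (simp add: rf_const_def eq_fract)
  show ?thesis
  proof (cases a)
    case None
    then obtain z where b: "b = Some z" using assms by (cases b) auto
    then have "rf_X = rf_const z - inverse (mobius a b)" using None l by simp
    moreover have "P (rf_const z)" using P b by (auto simp: points_over_def)
    ultimately show ?thesis using diff inverse m by metis
  next
    case (Some w)
    then have w: "P (rf_const w)" using P by (auto simp: points_over_def)
    show ?thesis
    proof (cases b)
      case None
      then have "rf_X = rf_const w - mobius a b" using Some l by simp
      then show ?thesis using diff w m by metis
    next
      case b: (Some z)
      then have z: "P (rf_const z)" using P by (auto simp: points_over_def)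
      have wz: "w \<noteq> z" using assms(1) Some b by auto
      have "mobius a b * (rf_X - rf_const z) = rf_X - rf_const w"
        using Some b l nz[of z] by simp
      then have "rf_X * (1 - mobius a b) = rf_const w - rf_const z * mobius a b"
        by (simp add: algebra_simps)
      moreover have "1 - mobius a b \<noteq> 0"
        using Some b l nz[of z] inj[OF wz] by auto
      ultimately have "rf_X = (rf_const w - rf_const z * mobius a b) * inverse (1 - mobius a b)"
        by (simp add: field_simps)
      then show ?thesis using diff mult inverse c1 w z m by metis
    qed
  qed
qed

section \<open>Quadratic rational maps with two rational critical points\<close>

text \<open>As a binary quadratic form, \<open>g\<close> is divisible by the linear forms of its
  zeros; a zero at infinity shows up as a drop of the degree.\<close>

lemma form_two_zeros:
  fixes g :: "'a::field poly"
  assumes "g \<noteq> 0" "Polynomial.degree g \<le> 2" "x0 \<noteq> x1" "hval 2 g x0 = 0" "hval 2 g x1 = 0"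
  obtains e where "e \<noteq> 0" "\<And>x. hval 2 g x = e * pdet x x0 * pdet x x1"
proof -
  have finite_infinite: "\<exists>e. e \<noteq> 0 \<and> (\<forall>x. hval 2 g x = e * pdet x (Some a) * pdet x None)"
    if "poly g a = 0" "Polynomial.coeff g 2 = 0" for a
  proof -
    have "[:- a, 1:] dvd g" using that(1) unfolding poly_eq_0_iff_dvd .
    then obtain k where k: "g = [:- a, 1:] * k" by (rule dvdE)
    with assms(1) have k0: "k \<noteq> 0" by auto
    then have dg: "Polynomial.degree g = Suc (Polynomial.degree k)"
      unfolding k by (subst degree_mult_eq) auto
    have "Polynomial.degree g \<noteq> 2" using that(2) assms(1) by (metis leading_coeff_0_iff)
    then have "Polynomial.degree k = 0" using dg assms(2) by simp
    then obtain e where e: "k = [:e:]" using degree_eq_zeroE by blast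
    have "hval 2 g x = (- e) * pdet x (Some a) * pdet x None" for x
      using that(2) by (cases x) (auto simp: k e algebra_simps)
    then show ?thesis using k0 e by (intro exI[of _ "- e"]) auto
  qed
  have finite_finite: "\<exists>e. e \<noteq> 0 \<and> (\<forall>x. hval 2 g x = e * pdet x (Some a) * pdet x (Some b))"
    if "poly g a = 0" "poly g b = 0" "a \<noteq> b" for a b
  proof -
    have "[:- a, 1:] dvd g" using that(1) unfolding poly_eq_0_iff_dvd .
    then obtain k where k: "g = [:- a, 1:] * k" by (rule dvdE)
    then have "poly k b = 0" using that(2,3) by auto
    then have "[:- b, 1:] dvd k" unfolding poly_eq_0_iff_dvd .
    then obtain l where l: "k = [:- b, 1:] * l" by (rule dvdE)
    have l0: "l \<noteq> 0" using assms(1) k l by auto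
    then have dk: "Polynomial.degree k = Suc (Polynomial.degree l)"
      unfolding l by (subst degree_mult_eq) auto
    moreover have "k \<noteq> 0" using assms(1) k by auto
    ultimately have "Polynomial.degree g = Suc (Suc (Polynomial.degree l))"
      unfolding k by (subst degree_mult_eq) auto
    then have "Polynomial.degree l = 0" using assms(2) by simp
    then obtain e where e: "l = [:e:]" using degree_eq_zeroE by blast
    have "hval 2 g x = e * pdet x (Some a) * pdet x (Some b)" for x
      by (cases x) (auto simp: k l e algebra_simps numeral_2_eq_2)
    then show ?thesis using l0 e by (intro exI[of _ e]) auto
  qed
  have "\<exists>e. e \<noteq> 0 \<and> (\<forall>x. hval 2 g x = e * pdet x x0 * pdet x x1)"
  proof (cases x0)
    case None
    then obtain b where "x1 = Some b" using assms(3) by (cases x1) auto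
    then show ?thesis using finite_infinite[of b] assms None by (auto simp: mult.commute mult.left_commute)
  next
    case (Some a)
    then show ?thesis using finite_infinite[of a] finite_finite[of a] assms by (cases x1) auto
  qed
  then show ?thesis using that by blast
qed

text \<open>The analogue for a double zero, which is assumed in the shape in which
  \<open>ramification_index\<close> supplies it.\<close>

lemma form_double_zero:
  fixes g :: "'a::field poly"
  assumes "g \<noteq> 0" "Polynomial.degree g \<le> 2"
    and "case c of Some z \<Rightarrow> Polynomial.order z g > 1 | None \<Rightarrow> 2 - Polynomial.degree g > 1"
  obtains e where "e \<noteq> 0" "\<And>x. hval 2 g x = e * (pdet x c)\<^sup>2"
proof (cases c)
  case None
  then have "Polynomial.degree g = 0" using assms by simp
  then obtain e where e: "g = [:e:]" using degree_eq_zeroE by blast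
  then have "e \<noteq> 0" using assms by auto
  moreover have "hval 2 g x = e * (pdet x c)\<^sup>2" for x
    by (cases x) (auto simp: e None numeral_2_eq_2)
  ultimately show ?thesis using that by blast
next
  case (Some z)
  then have "[:- z, 1:] ^ 2 dvd g" using assms order_divides[of z 2 g] by auto
  then obtain k where k: "g = [:- z, 1:] ^ 2 * k" by (rule dvdE)
  have k0: "k \<noteq> 0" using k assms by auto
  then have "Polynomial.degree g = 2 + Polynomial.degree k"
    unfolding k by (subst degree_mult_eq) (auto simp: degree_power_eq)
  then have "Polynomial.degree k = 0" using assms(2) by simp
  then obtain e where e: "k = [:e:]" using degree_eq_zeroE by blast
  have "hval 2 g x = e * (pdet x c)\<^sup>2" for x
    by (cases x) (auto simp: k e Some power2_eq_square algebra_simps numeral_2_eq_2)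
  moreover have "e \<noteq> 0" using k0 e by auto
  ultimately show ?thesis using that by blast
qed

text \<open>The factor between the homogeneous vector (numerator, denominator) at \<open>x\<close>
  and the representative of \<open>rf_eval f x\<close> that \<open>pdet\<close> uses.\<close>

definition fibre_scale :: "'a::field poly fract \<Rightarrow> 'a option \<Rightarrow> 'a" where
  "fibre_scale f x = (if hval (rf_degree f) (rf_den f) x \<noteq> 0 then hval (rf_degree f) (rf_den f) x
     else hval (rf_degree f) (rf_num f) x)"

lemma fibre_scale_nonzero: "fibre_scale f x \<noteq> 0"
  using num_den_not_both_zero[of f x] unfolding fibre_scale_def by (cases "hval (rf_degree f) (rf_den f) x = 0") auto

text \<open>The sign at infinity arises because \<open>fibre_poly f None\<close> is the denominator
  itself, while \<open>pdet\<close> of a finite point against \<open>None\<close> is -1.\<close>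

lemma hval_fibre_poly:
  "hval (rf_degree f) (fibre_poly f y) x =
    (case y of None \<Rightarrow> - 1 | Some _ \<Rightarrow> 1) * fibre_scale f x * pdet (rf_eval f x) y"
  by (cases y)
    (auto simp: fibre_poly_def fibre_scale_def rf_eval_hval hval_diff hval_smult field_simps)

lemma fibre_poly_nonzero:
  assumes "rf_degree f \<noteq> 0"
  shows "fibre_poly f y \<noteq> 0"
proof (cases y)
  case None
  then show ?thesis using rf_rep(4) by (simp add: fibre_poly_def)
next
  case (Some c)
  show ?thesis
  proof
    assume "fibre_poly f y = 0"
    then have n: "rf_num f = Polynomial.smult c (rf_den f)" using Some by (simp add: fibre_poly_def)
    then have "rf_den f dvd rf_num f" by (simp add: n dvd_smult)
    then have unit: "rf_den f dvd 1" by (rule coprime_common_divisor[OF rf_rep(2) _ dvd_refl])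
    obtain d where "rf_den f = [:d:]" using unit by (rule is_unit_polyE)
    then have "Polynomial.degree (rf_den f) = 0" by simp
    then show False using assms n by (simp add: rf_degree_def split: if_splits)
  qed
qed

lemma degree_fibre_poly: "Polynomial.degree (fibre_poly f y) \<le> rf_degree f"
proof (cases y)
  case None
  then show ?thesis using rf_degree_bounds by (simp add: fibre_poly_def)
next
  case (Some c)
  have "Polynomial.degree (Polynomial.smult c (rf_den f)) \<le> rf_degree f"
    using degree_smult_le rf_degree_bounds(2) order_trans by blast
  then show ?thesis using Some rf_degree_bounds(1)[of f] by (simp add: fibre_poly_def degree_diff_le)
qed

text \<open>For the geometric group \<open>F\<close> is the whole closure, for the arithmetic group
  the image of the number field; in the latter case \<open>critical_over\<close> is the content of
  \<open>critical_points_rational\<close>.\<close>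

locale quadratic_rational_map = subfield_set F for F :: "'a::{alg_closed_field, field_char_0} set" +
  fixes f :: "'a poly fract" and c1 c2 :: "'a option"
  assumes degree_two: "rf_degree f = 2"
    and coeffs_over: "coeffs_in F (rf_num f)" "coeffs_in F (rf_den f)"
    and critical: "ramification_index f c1 > 1" "ramification_index f c2 > 1" "c1 \<noteq> c2"
    and critical_over: "c1 \<in> points_over F" "c2 \<in> points_over F"
begin

section \<open>Fibres of a quadratic map and their coordinates\<close>

definition v1 where "v1 = rf_eval f c1"
definition v2 where "v2 = rf_eval f c2"

lemma fibre_poly_sign:
  "\<exists>s. s * s = 1 \<and> (\<forall>x. hval 2 (fibre_poly f y) x = s * fibre_scale f x * pdet (rf_eval f x) y)"
  using hval_fibre_poly[of f y]
  by (intro exI[of _ "case y of None \<Rightarrow> - 1 | Some _ \<Rightarrow> 1"]) (auto simp: degree_two split: option.split)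

text \<open>In homogeneous coordinates the fibre over \<open>y\<close> is cut out by a single
  quadratic form, so the factor \<open>e\<close> is the same for all \<open>x\<close>.\<close>

lemma fibre_form:
  assumes "x0 \<noteq> x1" "rf_eval f x0 = y" "rf_eval f x1 = y"
  obtains e where "e \<noteq> 0"
    "\<And>x. fibre_scale f x * pdet (rf_eval f x) y = e * pdet x x0 * pdet x x1"
proof -
  have "hval 2 (fibre_poly f y) x0 = 0" "hval 2 (fibre_poly f y) x1 = 0"
    using assms hval_fibre_poly[of f y] by (simp_all add: degree_two)
  from form_two_zeros[OF fibre_poly_nonzero _ assms(1) this] degree_fibre_poly[of f y]
  obtain e where e: "e \<noteq> 0" "\<And>x. hval 2 (fibre_poly f y) x = e * pdet x x0 * pdet x x1"
    by (auto simp: degree_two)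
  obtain s where s: "s * s = 1" "\<And>x. hval 2 (fibre_poly f y) x = s * fibre_scale f x * pdet (rf_eval f x) y"
    using fibre_poly_sign[of y] by blast
  have "fibre_scale f x * pdet (rf_eval f x) y = (s * e) * pdet x x0 * pdet x x1" for x
  proof -
    have "s * (s * (fibre_scale f x * pdet (rf_eval f x) y)) = s * (e * pdet x x0 * pdet x x1)"
      using e(2)[of x] s(2)[of x] by (simp add: mult.assoc)
    then show ?thesis using s(1) by (simp add: mult.assoc[symmetric])
  qed
  moreover have "s * e \<noteq> 0" using e(1) s(1) by auto
  ultimately show ?thesis using that by blast
qed

lemma critical_form:
  assumes "ramification_index f c > 1"
  obtains e where "e \<noteq> 0"
    "\<And>x. fibre_scale f x * pdet (rf_eval f x) (rf_eval f c) = e * (pdet x c)\<^sup>2"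
proof -
  let ?y = "rf_eval f c"
  have "case c of Some z \<Rightarrow> Polynomial.order z (fibre_poly f ?y) > 1 | None \<Rightarrow> 2 - Polynomial.degree (fibre_poly f ?y) > 1"
    using assms by (auto simp: ramification_index_def Let_def degree_two split: option.splits)
  from form_double_zero[OF fibre_poly_nonzero _ this] degree_fibre_poly[of f ?y]
  obtain e where e: "e \<noteq> 0" "\<And>x. hval 2 (fibre_poly f ?y) x = e * (pdet x c)\<^sup>2"
    by (auto simp: degree_two)
  obtain s where s: "s * s = 1" "\<And>x. hval 2 (fibre_poly f ?y) x = s * fibre_scale f x * pdet (rf_eval f x) ?y"
    using fibre_poly_sign[of ?y] by blast
  have "fibre_scale f x * pdet (rf_eval f x) ?y = (s * e) * (pdet x c)\<^sup>2" for x
  proof -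
    have "s * (s * (fibre_scale f x * pdet (rf_eval f x) ?y)) = s * (e * (pdet x c)\<^sup>2)"
      using e(2)[of x] s(2)[of x] by (simp add: mult.assoc)
    then show ?thesis using s(1) by (simp add: mult.assoc[symmetric])
  qed
  moreover have "s * e \<noteq> 0" using e(1) s(1) by auto
  ultimately show ?thesis using that by blast
qed

lemma v1_iff: "rf_eval f x = v1 \<longleftrightarrow> x = c1"
proof -
  obtain e where "e \<noteq> 0" "\<And>x. fibre_scale f x * pdet (rf_eval f x) v1 = e * (pdet x c1)\<^sup>2"
    using critical_form[OF critical(1)] unfolding v1_def by blast
  then show ?thesis using fibre_scale_nonzero[of f x]
    by (metis mult_eq_0_iff pdet_eq_0_iff zero_eq_power2)
qed

lemma v2_iff: "rf_eval f x = v2 \<longleftrightarrow> x = c2"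
proof -
  obtain e where "e \<noteq> 0" "\<And>x. fibre_scale f x * pdet (rf_eval f x) v2 = e * (pdet x c2)\<^sup>2"
    using critical_form[OF critical(2)] unfolding v2_def by blast
  then show ?thesis using fibre_scale_nonzero[of f x]
    by (metis mult_eq_0_iff pdet_eq_0_iff zero_eq_power2)
qed

lemma v1_neq_v2: "v1 \<noteq> v2"
  using v1_iff[of c2] critical(3) by (auto simp: v2_def)

text \<open>The fibres over \<open>v1\<close> and \<open>v2\<close> are the double points
  \<open>c1\<close> and \<open>c2\<close>; dividing their two forms shows that \<open>f\<close> is
  squaring in suitable Moebius coordinates, up to the constant \<open>e2 / e1\<close>.\<close>

lemma square_relation:
  obtains C where "C \<noteq> 0"
    "\<And>x. x \<noteq> c2 \<Longrightarrow> (pdet x c1 / pdet x c2)\<^sup>2 = C * (pdet (rf_eval f x) v1 / pdet (rf_eval f x) v2)"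
proof -
  obtain e1 where e1: "e1 \<noteq> 0" "\<And>x. fibre_scale f x * pdet (rf_eval f x) v1 = e1 * (pdet x c1)\<^sup>2"
    using critical_form[OF critical(1)] unfolding v1_def by blast
  obtain e2 where e2: "e2 \<noteq> 0" "\<And>x. fibre_scale f x * pdet (rf_eval f x) v2 = e2 * (pdet x c2)\<^sup>2"
    using critical_form[OF critical(2)] unfolding v2_def by blast
  have "(pdet x c1 / pdet x c2)\<^sup>2 = (e2 / e1) * (pdet (rf_eval f x) v1 / pdet (rf_eval f x) v2)"
    if "x \<noteq> c2" for x
  proof -
    have nz: "pdet x c2 \<noteq> 0" "pdet (rf_eval f x) v2 \<noteq> 0" using that v2_iff[of x] by auto
    have 1: "(pdet x c1)\<^sup>2 = fibre_scale f x * pdet (rf_eval f x) v1 / e1"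
      "(pdet x c2)\<^sup>2 = fibre_scale f x * pdet (rf_eval f x) v2 / e2"
      using e1 e2 by (simp_all add: field_simps)
    show ?thesis
      unfolding power_divide 1 using nz e1(1) e2(1) fibre_scale_nonzero[of f x]
      by (simp add: field_simps)
  qed
  then show ?thesis using that[of "e2 / e1"] e1(1) e2(1) by simp
qed

text \<open>The coordinates of the two points have equal squares, and equal coordinates would mean
  equal points.\<close>

lemma opposite:
  assumes "x0 \<noteq> x1" "rf_eval f x0 = rf_eval f x1" "x0 \<noteq> c2"
  shows "pdet x1 c1 / pdet x1 c2 = - (pdet x0 c1 / pdet x0 c2)"
proof -
  obtain C where C: "C \<noteq> 0" "\<And>x. x \<noteq> c2 \<Longrightarrow>
      (pdet x c1 / pdet x c2)\<^sup>2 = C * (pdet (rf_eval f x) v1 / pdet (rf_eval f x) v2)"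
    using square_relation by blast
  have x1: "x1 \<noteq> c2" using assms v2_iff by metis
  have "(pdet x1 c1 / pdet x1 c2)\<^sup>2 = (pdet x0 c1 / pdet x0 c2)\<^sup>2"
    using C(2)[OF x1] C(2)[OF assms(3)] assms(2) by simp
  moreover have "pdet x1 c1 / pdet x1 c2 \<noteq> pdet x0 c1 / pdet x0 c2"
  proof
    assume "pdet x1 c1 / pdet x1 c2 = pdet x0 c1 / pdet x0 c2"
    then have "pdet x1 c1 * pdet x0 c2 = pdet x0 c1 * pdet x1 c2"
      using x1 assms(3) by (simp add: frac_eq_eq)
    then show False using pdet_ratio_eq[OF critical(3)] assms(1) by metis
  qed
  ultimately show ?thesis using power2_eq_iff by blast
qed

text \<open>The coordinate of a preimage is prescribed up to sign by its square, which is finite and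
  nonzero away from the critical values; each sign gives a point.\<close>

lemma two_preimages:
  assumes "y \<noteq> v1" "y \<noteq> v2"
  obtains x0 x1 where "x0 \<noteq> x1" "rf_eval f x0 = y" "rf_eval f x1 = y"
proof -
  obtain C where C: "C \<noteq> 0" "\<And>x. x \<noteq> c2 \<Longrightarrow>
      (pdet x c1 / pdet x c2)\<^sup>2 = C * (pdet (rf_eval f x) v1 / pdet (rf_eval f x) v2)"
    using square_relation by blast
  define t where "t = C * (pdet y v1 / pdet y v2)"
  obtain s where s: "s ^ 2 = t" using nth_root_exists[of 2 t] by auto
  have t0: "t \<noteq> 0" using C assms by (simp add: t_def)
  then have s0: "s \<noteq> 0" using s by auto
  have root: "\<exists>x. x \<noteq> c2 \<and> pdet x c1 / pdet x c2 = r \<and> rf_eval f x = y" if r: "r\<^sup>2 = t" "r \<noteq> 0" for r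
  proof -
    obtain x where x: "x \<noteq> c2" "pdet x c1 = r * pdet x c2"
      using mobius_solve[OF critical(3) r(2)] by blast
    then have q: "pdet x c1 / pdet x c2 = r" by simp
    have fx: "rf_eval f x \<noteq> v2" using x v2_iff by blast
    have "C * (pdet y v1 / pdet y v2) = C * (pdet (rf_eval f x) v1 / pdet (rf_eval f x) v2)"
      using C(2)[OF x(1)] unfolding q r(1) t_def .
    then have "pdet (rf_eval f x) v1 / pdet (rf_eval f x) v2 = pdet y v1 / pdet y v2"
      using C(1) by (simp only: mult_cancel_left) simp
    then have "pdet (rf_eval f x) v1 * pdet y v2 = pdet y v1 * pdet (rf_eval f x) v2"
      using fx assms by (simp add: frac_eq_eq)
    then have "rf_eval f x = y" using pdet_ratio_eq[OF v1_neq_v2] by blast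
    with x q show ?thesis by blast
  qed
  obtain x0 x1 where "pdet x0 c1 / pdet x0 c2 = s" "rf_eval f x0 = y"
    "pdet x1 c1 / pdet x1 c2 = - s" "rf_eval f x1 = y"
    using root[of s] root[of "- s"] s s0 by auto
  moreover from this have "x0 \<noteq> x1" using s0 by auto
  ultimately show ?thesis using that by blast
qed

lemma surjective: "\<exists>x. rf_eval f x = y"
  using two_preimages[of y] v1_iff v2_iff by metis

lemma transcendental_of_surjective:
  assumes "\<And>y. \<exists>x. rf_eval g x = y"
  shows "transcendental (g :: 'a poly fract)"
proof -
  have "{c. \<exists>y. rf_eval g y = Some c} = UNIV" using assms by blast
  then show ?thesis using infinite_UNIV_char_0[where 'a = 'a] by (intro transcendentalI) simp
qed

lemma transcendental_f: "transcendental f"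
  by (rule transcendental_of_surjective) (rule surjective)

lemma finite_fibre: "finite {x. rf_eval f x = y}"
proof -
  have "{x. rf_eval f x = y} \<subseteq> insert None (Some ` {z. poly (fibre_poly f y) z = 0})"
  proof
    fix x assume "x \<in> {x. rf_eval f x = y}"
    then have "hval 2 (fibre_poly f y) x = 0" using hval_fibre_poly[of f y x] by (simp add: degree_two)
    then show "x \<in> insert None (Some ` {z. poly (fibre_poly f y) z = 0})" by (cases x) auto
  qed
  then show ?thesis
    using poly_roots_finite[OF fibre_poly_nonzero[of f y]] degree_two finite_subset by auto
qed

text \<open>Evaluating the form of the fibre over \<open>y\<close> at \<open>a\<close> and at
  \<open>b\<close> gives the two products over that fibre, and the factor \<open>e\<close> cancels.
  So the norm along \<open>f\<close> of a Moebius function is again one, with zero and pole moved by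
  \<open>f\<close>, up to a ratio of \<open>fibre_scale\<close>.\<close>

lemma norm_mobius:
  assumes "x0 \<noteq> x1" "rf_eval f x0 = y" "rf_eval f x1 = y" "rf_eval f b \<noteq> y"
  shows "(pdet x0 a / pdet x0 b) * (pdet x1 a / pdet x1 b) =
    (fibre_scale f a / fibre_scale f b) * (pdet y (rf_eval f a) / pdet y (rf_eval f b))"
proof -
  obtain e where e: "e \<noteq> 0" "\<And>x. fibre_scale f x * pdet (rf_eval f x) y = e * pdet x x0 * pdet x x1"
    using fibre_form[OF assms(1-3)] by blast
  have n: "pdet x0 c * pdet x1 c = - (fibre_scale f c / e) * pdet y (rf_eval f c)" for c
  proof -
    have "pdet x0 c * pdet x1 c = pdet c x0 * pdet c x1"
      by (simp add: pdet_swap[of x0 c] pdet_swap[of x1 c])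
    also have "\<dots> = fibre_scale f c * pdet (rf_eval f c) y / e" using e by (simp add: field_simps)
    finally show ?thesis using e(1) by (simp add: pdet_swap[of "rf_eval f c" y] field_simps)
  qed
  have "(pdet x0 a / pdet x0 b) * (pdet x1 a / pdet x1 b) = (pdet x0 a * pdet x1 a) / (pdet x0 b * pdet x1 b)"
    by simp
  then show ?thesis unfolding n using e(1) by simp
qed

lemma eval_over:
  assumes "y \<in> points_over F"
  shows "rf_eval f y \<in> points_over F"
proof -
  have "hval 2 (rf_num f) y \<in> F" "hval 2 (rf_den f) y \<in> F" using hval_in assms coeffs_over by auto
  then show ?thesis by (auto simp: rf_eval_hval degree_two points_over_def intro!: divide_in)
qed

lemma fibre_scale_over: "y \<in> points_over F \<Longrightarrow> fibre_scale f y \<in> F"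
  using hval_in coeffs_over by (auto simp: fibre_scale_def)

lemma rational_f: "rational_over F f"
  using rf_rep(1,4)[of f] coeffs_over unfolding rational_over_def by blast

lemma v_over: "v1 \<in> points_over F" "v2 \<in> points_over F"
  using eval_over critical_over by (auto simp: v1_def v2_def)

lemma has_value_comp: "has_value h (rf_eval f x) c \<Longrightarrow> has_value (rf_comp h f) x c"
  using rf_eval_comp[OF transcendental_f, of h x] by (simp flip: rf_eval_Some_iff)

section \<open>The function field as a quadratic extension along f\<close>

abbreviation S :: "'a poly fract" where "S \<equiv> mobius c1 c2"

text \<open>A single choice secures membership in \<open>F\<close>, the identity of functions and
  the identity of values for the same constant.\<close>

definition disc_const :: 'a where
  "disc_const = (SOME C. C \<in> F \<and> C \<noteq> 0 \<and> S * S = rf_const C * rf_comp (mobius v1 v2) f \<and>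
     (\<forall>x. x \<noteq> c2 \<longrightarrow> (pdet x c1 / pdet x c2)\<^sup>2 = C * (pdet (rf_eval f x) v1 / pdet (rf_eval f x) v2)))"

lemma disc_const: "disc_const \<in> F" "disc_const \<noteq> 0"
  "S * S = rf_const disc_const * rf_comp (mobius v1 v2) f"
  "x \<noteq> c2 \<Longrightarrow> (pdet x c1 / pdet x c2)\<^sup>2 = disc_const * (pdet (rf_eval f x) v1 / pdet (rf_eval f x) v2)"
proof -
  obtain C where C: "C \<noteq> 0" "\<And>x. x \<noteq> c2 \<Longrightarrow>
      (pdet x c1 / pdet x c2)\<^sup>2 = C * (pdet (rf_eval f x) v1 / pdet (rf_eval f x) v2)"
    using square_relation by blast
  have SS: "S * S = rf_const C * rf_comp (mobius v1 v2) f"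
  proof (rule rf_eqI)
    show "infinite {z. Some z \<noteq> c2}"
    proof -
      have "finite {z. Some z = c2}" by (cases c2) auto
      moreover have "{z. Some z \<noteq> c2} = UNIV - {z. Some z = c2}" by auto
      ultimately show ?thesis using infinite_UNIV_char_0 Diff_infinite_finite by metis
    qed
    fix z assume "z \<in> {z. Some z \<noteq> c2}"
    then have z: "Some z \<noteq> c2" "rf_eval f (Some z) \<noteq> v2" using v2_iff by auto
    show "has_value (S * S) (Some z) ((pdet (Some z) c1 / pdet (Some z) c2)\<^sup>2)"
      unfolding power2_eq_square by (intro has_value_mult has_value_mobius z)
    show "has_value (rf_const C * rf_comp (mobius v1 v2) f) (Some z) ((pdet (Some z) c1 / pdet (Some z) c2)\<^sup>2)"
      unfolding C(2)[OF z(1)] by (intro has_value_mult has_value_const has_value_comp has_value_mobius z)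
  qed
  have "rf_comp (mobius v1 v2) f \<noteq> 0" by (simp add: rf_comp_eq_0_iff[OF transcendental_f])
  \<comment> \<open>As a quotient of functions over \<open>F\<close> the constant lies in
    \<open>F\<close>.\<close>
  then have "rf_const C = S * S / rf_comp (mobius v1 v2) f" using SS by simp
  moreover have "rational_over F (S * S / rf_comp (mobius v1 v2) f)"
    by (intro rational_divide rational_mult rational_mobius rational_comp transcendental_f rational_f
        critical_over v_over)
  ultimately have "C \<in> F" by (simp add: rational_const_iff[symmetric])
  with C SS have "\<exists>C. C \<in> F \<and> C \<noteq> 0 \<and> S * S = rf_const C * rf_comp (mobius v1 v2) f \<and>
     (\<forall>x. x \<noteq> c2 \<longrightarrow> (pdet x c1 / pdet x c2)\<^sup>2 = C * (pdet (rf_eval f x) v1 / pdet (rf_eval f x) v2))"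
    by blast
  from someI_ex[OF this] show "disc_const \<in> F" "disc_const \<noteq> 0"
    "S * S = rf_const disc_const * rf_comp (mobius v1 v2) f"
    "x \<noteq> c2 \<Longrightarrow> (pdet x c1 / pdet x c2)\<^sup>2 = disc_const * (pdet (rf_eval f x) v1 / pdet (rf_eval f x) v2)"
    unfolding disc_const_def[symmetric] by blast+
qed

definition disc :: "'a poly fract" where
  "disc = rf_const disc_const * mobius v1 v2"

lemma rational_disc: "rational_over F disc"
  unfolding disc_def by (intro rational_mult rational_const rational_mobius disc_const v_over)

lemma S_square: "S * S = rf_comp disc f"
  by (simp add: disc_def rf_comp_hom[OF transcendental_f] disc_const(3))

text \<open>On the two points of a fibre a pulled back function takes equal values, whereas
  \<open>S\<close> takes opposite nonzero ones.\<close>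

lemma S_not_pullback: "S \<noteq> rf_comp g f"
proof
  assume *: "S = rf_comp g f"
  have "infinite (UNIV - {v1, v2})"
    using Diff_infinite_finite[of "{v1, v2}" "UNIV :: 'a option set"] infinite_UNIV_char_0[where 'a = 'a]
    by simp
  then have "UNIV - {v1, v2} \<noteq> {}" by (metis finite.emptyI)
  then obtain y where "y \<noteq> v1" "y \<noteq> v2" by blast
  then obtain x0 x1 where x: "x0 \<noteq> x1" "rf_eval f x0 = y" "rf_eval f x1 = y"
    using two_preimages by blast
  have c: "x0 \<noteq> c2" "x1 \<noteq> c2" "x0 \<noteq> c1" using x \<open>y \<noteq> v2\<close> \<open>y \<noteq> v1\<close> v2_iff v1_iff by metis+
  have "rf_eval S x0 = rf_eval S x1"
    unfolding * rf_eval_comp[OF transcendental_f] x ..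
  then have "pdet x0 c1 / pdet x0 c2 = pdet x1 c1 / pdet x1 c2"
    using has_value_mobius c by (metis option.inject rf_eval_Some_iff)
  then have "2 * (pdet x0 c1 / pdet x0 c2) = 0" using opposite[OF x(1) _ c(1)] x by simp
  then show False using c by simp
qed

lemma decomposition_unique:
  assumes "rf_comp a f + rf_comp b f * S = rf_comp a' f + rf_comp b' f * S"
  shows "a = a' \<and> b = b'"
proof -
  note t = transcendental_f
  have eq: "rf_comp (a - a') f = rf_comp (b' - b) f * S"
    using assms by (simp add: rf_comp_simps[OF t] algebra_simps)
  have "b = b'"
  proof (rule ccontr)
    assume "b \<noteq> b'"
    then have "rf_comp (b' - b) f \<noteq> 0" by (simp add: rf_comp_eq_0_iff[OF t])
    then have "S = rf_comp ((a - a') / (b' - b)) f" using eq by (simp add: rf_comp_simps(5)[OF t])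
    then show False using S_not_pullback by blast
  qed
  moreover from this eq have "rf_comp (a - a') f = 0" by (simp add: rf_comp_simps[OF t])
  ultimately show ?thesis by (simp add: rf_comp_eq_0_iff[OF t])
qed

text \<open>The functions of this shape form a field that contains the constants of \<open>F\<close>
  and \<open>S\<close>. Since \<open>S\<close> is a Moebius function, the field contains
  \<open>rf_X\<close>, hence everything.\<close>

lemma decomposition_exists:
  assumes "rational_over F h"
  shows "\<exists>a b. rational_over F a \<and> rational_over F b \<and> h = rf_comp a f + rf_comp b f * S"
proof -
  note t = transcendental_f
  define P where "P = (\<lambda>h. \<exists>a b. rational_over F a \<and> rational_over F b \<and> h = rf_comp a f + rf_comp b f * S)"
  have PI: "P h" if "rational_over F a" "rational_over F b" "h = rf_comp a f + rf_comp b f * S" for h a b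
    unfolding P_def using that by blast
  have const: "P (rf_const c)" if "c \<in> F" for c
    by (rule PI[of "rf_const c" 0]) (auto simp: rational_const rational_0 that rf_comp_hom[OF t] rf_comp_simps[OF t])
  have add: "P (g + h)" if "P g" "P h" for g h
  proof -
    obtain a b c d where *: "rational_over F a" "rational_over F b" "rational_over F c" "rational_over F d"
      "g = rf_comp a f + rf_comp b f * S" "h = rf_comp c f + rf_comp d f * S"
      using \<open>P g\<close> \<open>P h\<close> unfolding P_def by blast
    show ?thesis
      by (rule PI[of "a + c" "b + d"])
        (auto simp: * rational_add rf_comp_hom[OF t] algebra_simps)
  qed
  have mult: "P (g * h)" if "P g" "P h" for g h
  proof -
    obtain a b c d where *: "rational_over F a" "rational_over F b" "rational_over F c" "rational_over F d"
      "g = rf_comp a f + rf_comp b f * S" "h = rf_comp c f + rf_comp d f * S"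
      using \<open>P g\<close> \<open>P h\<close> unfolding P_def by blast
    have "g * h = rf_comp a f * rf_comp c f + rf_comp b f * rf_comp d f * (S * S) +
        (rf_comp a f * rf_comp d f + rf_comp b f * rf_comp c f) * S"
      unfolding * by (simp add: algebra_simps)
    then show ?thesis
      by (intro PI[of "a * c + b * d * disc" "a * d + b * c"])
        (auto simp: * S_square rational_add rational_mult rational_disc rf_comp_hom[OF t])
  qed
  have inverse: "P (inverse g)" if "P g" for g
  proof (cases "g = 0")
    case True
    then show ?thesis using that by simp
  next
    case False
    obtain a b where *: "rational_over F a" "rational_over F b" "g = rf_comp a f + rf_comp b f * S"
      using \<open>P g\<close> unfolding P_def by blast
    \<comment> \<open>The norm of \<open>g\<close>: the conjugate divided by it is the inverse of
      \<open>g\<close>.\<close>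
    define n where "n = a * a - b * b * disc"
    have n: "g * (rf_comp a f - rf_comp b f * S) = rf_comp n f"
    proof -
      have "g * (rf_comp a f - rf_comp b f * S) = rf_comp a f * rf_comp a f - rf_comp b f * rf_comp b f * (S * S)"
        unfolding * by (simp add: algebra_simps)
      then show ?thesis by (simp add: n_def S_square rf_comp_hom[OF t] rf_comp_simps[OF t])
    qed
    have "rf_comp a f - rf_comp b f * S \<noteq> 0"
    proof
      assume "rf_comp a f - rf_comp b f * S = 0"
      then have "rf_comp a f + rf_comp 0 f * S = rf_comp 0 f + rf_comp b f * S"
        by (simp add: rf_comp_simps[OF t])
      from decomposition_unique[OF this] have "a = 0" "b = 0" by simp_all
      then show False using False * by (simp add: rf_comp_simps[OF t])
    qed
    then have n0: "rf_comp n f \<noteq> 0" using n False by auto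
    then have "inverse g = (rf_comp a f - rf_comp b f * S) / rf_comp n f"
      using n False by (simp add: field_simps)
    also have "\<dots> = rf_comp (a / n) f + rf_comp (- b / n) f * S"
      by (simp only: rf_comp_simps[OF t]) (simp add: diff_divide_distrib)
    finally show ?thesis
      by (intro PI[of "a / n" "- b / n"])
        (auto simp: * n_def rational_divide rational_minus rational_diff rational_mult rational_disc)
  qed
  have "P S"
    by (rule PI[of 0 1]) (auto simp: rational_0 rational_1 rf_comp_simps[OF t])
  then have X: "P rf_X"
    using X_from_mobius[where P = P and C = F] critical(3) const critical_over one_in minus_in add mult inverse
    by blast
  have "P h" using assms const X add mult inverse by (induction rule: rational_over_induct) auto
  then show ?thesis unfolding P_def .
qed

text \<open>Scaling by the inverse of the function with the higher pole keeps both products finite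
  and one of them nonzero, while the scaling factor itself vanishes.\<close>

lemma clear_poles:
  assumes "rf_eval a y = None \<or> rf_eval b y = None"
  obtains g \<alpha> \<beta> where "has_value g y 0" "has_value (a * g) y \<alpha>" "has_value (b * g) y \<beta>" "\<alpha> \<noteq> 0 \<or> \<beta> \<noteq> (0::'a)"
proof -
  have main: "\<exists>g \<alpha> \<beta>. has_value g y 0 \<and> has_value (a * g) y \<alpha> \<and> has_value (b * g) y \<beta> \<and> (\<alpha> \<noteq> 0 \<or> \<beta> \<noteq> 0)"
    if "rf_eval a y = None" for a b
  proof -
    from that have a: "a \<noteq> 0" "has_value (inverse a) y 0" by (auto simp: rf_eval_None_iff)
    show ?thesis
    proof (cases rule: rf_eval_cases[of "b * inverse a" y])
      case (1 c)
      then show ?thesis using a has_value_one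
        by (intro exI[of _ "inverse a"] exI[of _ 1] exI[of _ c]) auto
    next
      case 2
      then have b: "b \<noteq> 0" by auto
      have ab: "has_value (a * inverse b) y 0" using 2(3) by (simp add: mult.commute)
      have "has_value (inverse a * (a * inverse b)) y 0" using has_value_mult[OF a(2) ab] by simp
      then have "has_value (inverse b) y 0" using a(1) by (simp add: mult.assoc[symmetric])
      then show ?thesis using ab b has_value_one
        by (intro exI[of _ "inverse b"] exI[of _ 0] exI[of _ 1]) auto
    qed
  qed
  show ?thesis using assms main[of a b] main[of b a] that by blast
qed

text \<open>If a coefficient had a pole at \<open>y\<close>, scaling as in
  \<open>clear_poles\<close> would kill \<open>h\<close> at both points of the fibre, where
  \<open>S\<close> takes opposite nonzero values t and -t. The equations \<alpha> + \<beta> t = 0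
  and \<alpha> - \<beta> t = 0 force \<alpha> = \<beta> = 0.\<close>

lemma decomposition_regular:
  assumes h: "h = rf_comp a f + rf_comp b f * S"
    and x: "x0 \<noteq> x1" "rf_eval f x0 = y" "rf_eval f x1 = y" "y \<noteq> v1" "y \<noteq> v2"
    and reg: "has_value h x0 k0" "has_value h x1 k1"
  shows "rf_eval a y \<noteq> None \<and> rf_eval b y \<noteq> None"
proof (rule ccontr)
  note t = transcendental_f
  assume "\<not> ?thesis"
  then have "rf_eval a y = None \<or> rf_eval b y = None" by blast
  then obtain g \<alpha> \<beta> where g: "has_value g y 0" "has_value (a * g) y \<alpha>" "has_value (b * g) y \<beta>"
    "\<alpha> \<noteq> 0 \<or> \<beta> \<noteq> 0" by (rule clear_poles)
  have c: "x0 \<noteq> c2" "x1 \<noteq> c2" "x0 \<noteq> c1" using x v2_iff v1_iff by metis+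
  have hg: "h * rf_comp g f = rf_comp (a * g) f + rf_comp (b * g) f * S"
    unfolding h by (simp add: rf_comp_hom[OF t] algebra_simps)
  have key: "\<alpha> + \<beta> * (pdet w c1 / pdet w c2) = 0"
    if "rf_eval f w = y" "w \<noteq> c2" "has_value h w k" for w k
  proof -
    have "has_value (rf_comp (a * g) f + rf_comp (b * g) f * S) w (\<alpha> + \<beta> * (pdet w c1 / pdet w c2))"
      using g that by (intro has_value_add has_value_mult has_value_comp has_value_mobius) auto
    moreover have "has_value (h * rf_comp g f) w (k * 0)"
      using g that by (intro has_value_mult has_value_comp) auto
    ultimately show ?thesis using has_value_unique unfolding hg by fastforce
  qed
  have 0: "\<alpha> + \<beta> * (pdet x0 c1 / pdet x0 c2) = 0" using key[OF x(2) c(1) reg(1)] .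
  have 1: "\<alpha> - \<beta> * (pdet x0 c1 / pdet x0 c2) = 0"
    using key[OF x(3) c(2) reg(2)] opposite[OF x(1) _ c(1)] x by simp
  have "2 * \<alpha> = 0" using arg_cong2[OF 0 1, of "(+)"] by simp
  then have "\<alpha> = 0" by simp
  with 0 c have "\<beta> = 0" by simp
  with \<open>\<alpha> = 0\<close> g(4) show False by simp
qed

section \<open>Coordinate rings as quadratic extensions\<close>

lemma S_unit:
  assumes "v1 \<in> T" "v2 \<in> T"
  shows "S \<in> Units (coord_ring F {x. rf_eval f x \<in> T})"
  using assms by (intro mobius_unit critical_over) (auto simp: v1_def v2_def)

lemma disc_unit:
  assumes "v1 \<in> T" "v2 \<in> T"
  shows "disc \<in> Units (coord_ring F T)"
proof -
  interpret B: cring "coord_ring F T" by (rule cring_coord_ring)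
  have "rf_const disc_const \<otimes>\<^bsub>coord_ring F T\<^esub> mobius v1 v2 \<in> Units (coord_ring F T)"
    by (intro B.Units_m_closed const_unit disc_const mobius_unit v_over assms)
  then show ?thesis by (simp add: coord_ring_simps disc_def)
qed

lemma pullback_closed:
  assumes "h \<in> carrier (coord_ring F T)"
  shows "rf_comp h f \<in> carrier (coord_ring F {x. rf_eval f x \<in> T})"
  using assms by (auto simp: coord_ring_simps(1) rf_eval_comp[OF transcendental_f]
      intro!: rational_comp transcendental_f rational_f)

text \<open>Because \<open>T\<close> contains the critical values, \<open>S\<close> and
  \<open>disc\<close> have no zeros or poles on the respective complements, and
  \<open>decomposition_regular\<close> restricts the splitting of the function field to regular
  functions.\<close>

theorem quadratic_extension_coord_ring:
  assumes "v1 \<in> T" "v2 \<in> T"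
  shows "quadratic_extension (coord_ring F T) (coord_ring F {x. rf_eval f x \<in> T})
    (\<lambda>h. rf_comp h f) S disc"
proof -
  note t = transcendental_f
  let ?B = "coord_ring F T" and ?W = "coord_ring F {x. rf_eval f x \<in> T}"
  interpret B: cring ?B by (rule cring_coord_ring)
  interpret W: cring ?W by (rule cring_coord_ring)
  show ?thesis
  proof (intro quadratic_extension.intro quadratic_extension_axioms.intro B.cring_axioms W.cring_axioms)
    show "(\<lambda>h. rf_comp h f) \<in> ring_hom ?B ?W"
      by (rule ring_hom_memI)
        (auto simp: pullback_closed coord_ring_simps(2-) rf_comp_hom[OF t] rf_comp_simps[OF t])
    show "S \<in> carrier ?W" using S_unit[OF assms] by auto
    show "disc \<in> carrier ?B" using disc_unit[OF assms] by auto
    show "S \<otimes>\<^bsub>?W\<^esub> S = rf_comp disc f" by (simp add: coord_ring_simps(2-) S_square)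
    show "a = a' \<and> b = b'" if "rf_comp a f \<oplus>\<^bsub>?W\<^esub> rf_comp b f \<otimes>\<^bsub>?W\<^esub> S = rf_comp a' f \<oplus>\<^bsub>?W\<^esub> rf_comp b' f \<otimes>\<^bsub>?W\<^esub> S"
      for a b a' b' by (rule decomposition_unique) (use that in \<open>simp add: coord_ring_simps(2-)\<close>)
    show "\<exists>a\<in>carrier ?B. \<exists>b\<in>carrier ?B. h = rf_comp a f \<oplus>\<^bsub>?W\<^esub> rf_comp b f \<otimes>\<^bsub>?W\<^esub> S"
      if h: "h \<in> carrier ?W" for h
    proof -
      obtain a b where ab: "rational_over F a" "rational_over F b" "h = rf_comp a f + rf_comp b f * S"
        using decomposition_exists[of h] h by (auto simp: coord_ring_simps(1))
      have "rf_eval a y \<noteq> None \<and> rf_eval b y \<noteq> None" if "y \<notin> T" for y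
      proof -
        have y: "y \<noteq> v1" "y \<noteq> v2" using that assms by auto
        then obtain x0 x1 where x: "x0 \<noteq> x1" "rf_eval f x0 = y" "rf_eval f x1 = y"
          using two_preimages by blast
        have "has_value h x0 (rf_value h x0)" "has_value h x1 (rf_value h x1)"
          using coord_ring_has_value[OF h] x that by auto
        then show ?thesis by (rule decomposition_regular[OF ab(3) x y])
      qed
      then have "a \<in> carrier ?B" "b \<in> carrier ?B" using ab by (auto simp: coord_ring_simps(1))
      then show ?thesis using ab(3) by (auto simp: coord_ring_simps(2-))
    qed
  qed
qed

end

section \<open>The tower of iterated preimages\<close>

lemma rf_eval_X: "rf_eval rf_X y = y"
proof (cases y)
  case None
  have "rf_X \<noteq> (0 :: 'a poly fract)" by (simp add: rf_X_def Zero_fract_def eq_fract)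
  moreover have "has_value (inverse (rf_X :: 'a poly fract)) None 0"
    using has_valueI[of 1 1 "[:0, 1:] :: 'a poly" None] by (simp add: rf_X_def)
  ultimately show ?thesis using None by (simp add: rf_eval_None_iff)
next
  case (Some z)
  have "has_value (rf_X :: 'a poly fract) (Some z) z"
    using has_valueI[of "[:0, 1:]" 1 1 "Some z"] by (simp add: rf_X_def)
  then show ?thesis using Some by (simp add: rf_eval_Some_iff)
qed

locale preimage_tower = quadratic_rational_map F f c1 c2
  for F :: "'a::{alg_closed_field, field_char_0} set" and f c1 c2 +
  fixes x :: "'a option"
  assumes finite_pcs: "finite (post_critical_set f)"
    and pcs_over: "post_critical_set f \<subseteq> points_over F"
    and v_pcs: "v1 \<in> post_critical_set f" "v2 \<in> post_critical_set f"
    and pcs_invariant: "y \<in> post_critical_set f \<Longrightarrow> rf_eval f y \<in> post_critical_set f"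
    and base_point: "x \<notin> post_critical_set f"
begin

definition level :: "nat \<Rightarrow> 'a option set" where
  "level l = {y. (rf_eval f ^^ l) y \<in> post_critical_set f}"

lemma level_0: "level 0 = post_critical_set f"
  by (simp add: level_def)

lemma level_Suc: "{y. rf_eval f y \<in> level l} = level (Suc l)"
  by (simp add: level_def funpow_swap1)

lemma pcs_subset_level: "y \<in> post_critical_set f \<Longrightarrow> y \<in> level l"
proof -
  assume "y \<in> post_critical_set f"
  then have "(rf_eval f ^^ l) y \<in> post_critical_set f" by (induction l) (auto simp: pcs_invariant)
  then show ?thesis by (simp add: level_def)
qed

lemma finite_level: "finite (level l)"
proof (induction l)
  case 0
  then show ?case by (simp add: level_0 finite_pcs)
next
  case (Suc l)
  have "level (Suc l) = (\<Union>y\<in>level l. {w. rf_eval f w = y})" by (auto simp flip: level_Suc)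
  then show ?case using Suc finite_fibre by simp
qed

abbreviation B :: "nat \<Rightarrow> 'a poly fract ring" where "B l \<equiv> coord_ring F (level l)"
abbreviation A :: "'a poly fract ring" where "A \<equiv> coord_ring F (post_critical_set f)"
abbreviation V :: "nat \<Rightarrow> 'a poly fract ring \<times> ('a poly fract \<Rightarrow> 'a poly fract)" where
  "V l \<equiv> iterate_cover F f l"
abbreviation ev :: "nat \<Rightarrow> 'a option \<Rightarrow> 'a poly fract \<Rightarrow> 'a" where "ev l y \<equiv> eval_hom (B l) y"

lemma V_eq: "V l = (B l, \<lambda>h\<in>carrier A. rf_comp h (rf_iter f l))"
  by (simp add: iterate_cover_def level_def)

lemma fst_V [simp]: "fst (V l) = B l"
  by (simp add: V_eq)

lemma iter_facts: "rf_eval (rf_iter f n) y = (rf_eval f ^^ n) y" "transcendental (rf_iter f n)"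
proof -
  have "(\<forall>y. rf_eval (rf_iter f n) y = (rf_eval f ^^ n) y) \<and> (\<forall>y. \<exists>w. (rf_eval f ^^ n) w = y)"
  proof (induction n)
    case 0
    then show ?case by (simp add: rf_iter_def rf_eval_X)
  next
    case (Suc n)
    then have t: "transcendental (rf_iter f n)" by (intro transcendental_of_surjective) auto
    have "rf_iter f (Suc n) = rf_comp f (rf_iter f n)" by (simp add: rf_iter_def)
    then have "rf_eval (rf_iter f (Suc n)) y = (rf_eval f ^^ Suc n) y" for y
      using Suc by (simp add: rf_eval_comp[OF t])
    moreover have "\<exists>w. (rf_eval f ^^ Suc n) w = y" for y
    proof -
      obtain u where "rf_eval f u = y" using surjective by blast
      moreover obtain w where "(rf_eval f ^^ n) w = u" using Suc by blast
      ultimately show ?thesis by auto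
    qed
    ultimately show ?case by blast
  qed
  then show "rf_eval (rf_iter f n) y = (rf_eval f ^^ n) y" "transcendental (rf_iter f n)"
    by (auto intro!: transcendental_of_surjective)
qed

text \<open>\<open>rf_iter\<close> adds the new copy of \<open>f\<close> on the outside, the tower
  adds it on the inside; on values the two agree.\<close>

lemma comp_iter_Suc: "rf_comp h (rf_iter f (Suc l)) = rf_comp (rf_comp h (rf_iter f l)) f"
  by (rule rf_ext[OF infinite_UNIV_char_0])
    (simp add: rf_eval_comp transcendental_f iter_facts funpow_swap1)

lemma comp_iter_0: "rf_comp h (rf_iter f 0) = h"
  by (rule rf_ext[OF infinite_UNIV_char_0]) (simp add: rf_eval_comp iter_facts)

sublocale pointed_base A "eval_hom A x"
proof (rule pointed_base.intro)
  have "inj (rf_const :: 'a \<Rightarrow> 'a poly fract)" by (auto simp: inj_def rf_const_def eq_fract)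
  then show "infinite (UNIV :: 'a poly fract set)"
    using infinite_UNIV_char_0[where 'a = 'a] finite_imageD
    by (metis finite_subset subset_UNIV)
  show "cring A" by (rule cring_coord_ring)
  show "eval_hom A x \<in> ring_hom A ring_of_type_algebra"
    by (rule eval_hom_ring_hom[OF base_point])
  have "rf_const (1 + 1) \<in> Units A" by (rule const_unit[OF add_in[OF one_in one_in]]) simp
  then show "\<one>\<^bsub>A\<^esub> \<oplus>\<^bsub>A\<^esub> \<one>\<^bsub>A\<^esub> \<in> Units A" unfolding rf_const_add by (simp add: coord_ring_simps(2-))
qed

lemma v_level: "v1 \<in> level l" "v2 \<in> level l"
  using pcs_subset_level v_pcs by auto

lemma quadratic_step: "quadratic_extension (B l) (B (Suc l)) (\<lambda>h. rf_comp h f) S disc"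
  using quadratic_extension_coord_ring[OF v_level] unfolding level_Suc .

text \<open>Each level adjoins to the previous one a square root of the unit \<open>disc\<close>, so
  being finite etale propagates up the tower.\<close>

lemma V_cover: "V l \<in> covers"
proof (induction l)
  case 0
  have "V 0 = (A, \<lambda>a\<in>carrier A. a)" by (simp add: V_eq level_0 comp_iter_0 cong: restrict_cong)
  then show ?case using finite_etale_self[OF cring_base] by (simp add: covers_def)
next
  case (Suc l)
  interpret quadratic_extension "B l" "B (Suc l)" "\<lambda>h. rf_comp h f" S disc by (rule quadratic_step)
  have "rf_const (1 + 1) \<in> Units (B l)" by (rule const_unit[OF add_in[OF one_in one_in]]) simp
  then have two: "\<one>\<^bsub>B l\<^esub> \<oplus>\<^bsub>B l\<^esub> \<one>\<^bsub>B l\<^esub> \<in> Units (B l)"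
    unfolding rf_const_add by (simp add: coord_ring_simps(2-))
  have "finite_etale A (B l) (\<lambda>h\<in>carrier A. rf_comp h (rf_iter f l))"
    using Suc by (simp add: covers_def V_eq)
  from finite_etale_quadratic[OF cring_base this disc_unit[OF v_level] two] show ?case
    by (simp add: covers_def V_eq comp_iter_Suc cong: restrict_cong)
qed

definition pull :: "nat \<Rightarrow> 'a poly fract \<Rightarrow> 'a poly fract" where
  "pull l = (\<lambda>h\<in>carrier (B l). rf_comp h f)"

lemma structure_closed: "h \<in> carrier A \<Longrightarrow> rf_comp h (rf_iter f l) \<in> carrier (B l)"
  using ring_homD(1)[OF coversD(2)[OF V_cover[of l]], of h] by (simp add: V_eq)

lemma pull_hom: "pull l \<in> algebra_hom A (V l) (V (Suc l))"
proof -
  interpret quadratic_extension "B l" "B (Suc l)" "\<lambda>h. rf_comp h f" S disc by (rule quadratic_step)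
  have "pull l \<in> ring_hom (B l) (B (Suc l))"
    by (rule ring_hom_memI) (auto simp: pull_def hom_mult hom_add hom_one)
  then show ?thesis
    by (auto simp: algebra_hom_iff V_eq pull_def structure_closed comp_iter_Suc)
qed

lemma not_in_level: "(rf_eval f ^^ l) y = x \<Longrightarrow> y \<notin> level l"
  using base_point by (simp add: level_def)

lemma ev_value: "h \<in> carrier (B l) \<Longrightarrow> y \<notin> level l \<Longrightarrow> has_value h y (ev l y h)"
  using coord_ring_has_value by (simp add: eval_hom_value)

lemma ev_eqI: "h \<in> carrier (B l) \<Longrightarrow> has_value h y c \<Longrightarrow> ev l y h = c"
  by (simp add: eval_hom_value rf_valueI)

lemma ev_fibre:
  assumes "(rf_eval f ^^ l) y = x"
  shows "ev l y \<in> fibre (V l)"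
proof -
  have "ev l y (rf_comp a (rf_iter f l)) = eval_hom A x a" if "a \<in> carrier A" for a
  proof -
    have "has_value a x (eval_hom A x a)"
      using coord_ring_has_value[OF that base_point] that by (simp add: eval_hom_value)
    then have "has_value (rf_comp a (rf_iter f l)) y (eval_hom A x a)"
      by (simp add: rf_eval_comp iter_facts assms flip: rf_eval_Some_iff)
    then show ?thesis using ev_eqI structure_closed[OF that] by blast
  qed
  moreover have "ev l y \<in> extensional (carrier (B l))" by (simp add: eval_hom_def)
  ultimately show ?thesis
    using eval_hom_ring_hom[OF not_in_level[OF assms]]
    by (auto simp: fibre_iff V_eq)
qed

lemma pull_ev:
  assumes "rf_eval f w \<notin> level l"
  shows "compose (carrier (B l)) (ev (Suc l) w) (pull l) = ev l (rf_eval f w)"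
proof
  interpret quadratic_extension "B l" "B (Suc l)" "\<lambda>h. rf_comp h f" S disc by (rule quadratic_step)
  fix h show "compose (carrier (B l)) (ev (Suc l) w) (pull l) h = ev l (rf_eval f w) h"
  proof (cases "h \<in> carrier (B l)")
    case True
    have "has_value (rf_comp h f) w (ev l (rf_eval f w) h)"
      by (intro has_value_comp ev_value True assms)
    then show ?thesis using True ev_eqI[OF hom_closed[OF True]] by (simp add: compose_def pull_def)
  next
    case False
    then show ?thesis by (simp add: compose_def eval_hom_def)
  qed
qed

text \<open>The deck transformation sending \<open>S\<close> to \<open>- S\<close>. It exchanges the
  points of each fibre, so values at the second point become values at the first, and the norm
  becomes a product of two functions on one cover.\<close>

lemma conjugation:
  obtains T where "T \<in> algebra_hom A (V (Suc l)) (V (Suc l))"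
    "\<And>x0 x1. x0 \<noteq> x1 \<Longrightarrow> rf_eval f x0 = rf_eval f x1 \<Longrightarrow> rf_eval f x0 \<notin> level l \<Longrightarrow>
      compose (carrier (B (Suc l))) (ev (Suc l) x0) T = ev (Suc l) x1"
proof -
  interpret quadratic_extension "B l" "B (Suc l)" "\<lambda>h. rf_comp h f" S disc by (rule quadratic_step)
  have "- S \<in> carrier (B (Suc l))" "(- S) \<otimes>\<^bsub>B (Suc l)\<^esub> (- S) = rf_comp disc f"
    using coord_ring_closed(3)[OF root_closed root_closed] root_square by (simp_all add: coord_ring_simps(2-))
  note E = extend_hom[OF W.cring_axioms hom this]
  define T where "T = (\<lambda>w\<in>carrier (B (Suc l)). rf_comp (part0 w) f \<oplus>\<^bsub>B (Suc l)\<^esub>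
    rf_comp (part1 w) f \<otimes>\<^bsub>B (Suc l)\<^esub> - S)"
  have Th: "T \<in> ring_hom (B (Suc l)) (B (Suc l))" and
    Tj: "\<And>b. b \<in> carrier (B l) \<Longrightarrow> T (rf_comp b f) = rf_comp b f"
    using E unfolding T_def by blast+
  have "T (rf_comp a (rf_iter f (Suc l))) = rf_comp a (rf_iter f (Suc l))" if "a \<in> carrier A" for a
    using Tj[OF structure_closed[OF that]] by (simp add: comp_iter_Suc)
  then have T: "T \<in> algebra_hom A (V (Suc l)) (V (Suc l))"
    using Th structure_closed[of _ "Suc l"] by (auto simp: algebra_hom_iff V_eq T_def)
  moreover have "compose (carrier (B (Suc l))) (ev (Suc l) x0) T = ev (Suc l) x1"
    if x: "x0 \<noteq> x1" "rf_eval f x0 = rf_eval f x1" "rf_eval f x0 \<notin> level l" for x0 x1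
  proof
    have c: "x0 \<noteq> c2" "x1 \<noteq> c2"
      using x v_level[of l] v2_iff by metis+
    fix w show "compose (carrier (B (Suc l))) (ev (Suc l) x0) T w = ev (Suc l) x1 w"
    proof (cases "w \<in> carrier (B (Suc l))")
      case True
      let ?y = "rf_eval f x0"
      let ?a = "ev l ?y (part0 w)" and ?b = "ev l ?y (part1 w)"
      have p: "has_value (part0 w) ?y ?a" "has_value (part1 w) ?y ?b"
        using x True by (auto intro!: ev_value)
      have "has_value (rf_comp (part0 w) f + rf_comp (part1 w) f * S) x1 (?a + ?b * (pdet x1 c1 / pdet x1 c2))"
        using p x c by (intro has_value_add has_value_mult has_value_comp has_value_mobius) auto
      then have 1: "ev (Suc l) x1 w = ?a + ?b * (pdet x1 c1 / pdet x1 c2)"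
        using ev_eqI[OF True] parts[OF True] by (simp add: coord_ring_simps(2-))
      have "has_value (rf_comp (part0 w) f + rf_comp (part1 w) f * (- S)) x0 (?a + ?b * (- (pdet x0 c1 / pdet x0 c2)))"
        using p x c by (intro has_value_add has_value_mult has_value_minus has_value_comp has_value_mobius) auto
      moreover have "T w = rf_comp (part0 w) f + rf_comp (part1 w) f * (- S)"
        using True by (simp add: T_def coord_ring_simps(2-))
      moreover have "T w \<in> carrier (B (Suc l))" using ring_homD(1)[OF Th True] .
      ultimately have "ev (Suc l) x0 (T w) = ?a + ?b * (- (pdet x0 c1 / pdet x0 c2))"
        using ev_eqI by metis
      then show ?thesis using True 1 opposite[OF x(1,2) c(1)] by (simp add: compose_def)
    next
      case False
      then show ?thesis by (simp add: compose_def eval_hom_def)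
    qed
  qed
  ultimately show ?thesis using that by blast
qed

section \<open>Signs of the action on the levels\<close>

text \<open>\<open>norm_unit n\<close> is, up to squares, the discriminant of \<open>f\<^sup>n\<^sup>+\<^sup>1\<close>: a family swapping the two
  halves of every level above \<open>y\<close> negates its square roots at \<open>y\<close>.\<close>

fun norm_const :: "nat \<Rightarrow> 'a" where
  "norm_const 0 = disc_const"
| "norm_const (Suc n) = norm_const n * norm_const n *
     (fibre_scale f ((rf_eval f ^^ n) v1) / fibre_scale f ((rf_eval f ^^ n) v2))"

definition norm_unit :: "nat \<Rightarrow> 'a poly fract" where
  "norm_unit n = rf_const (norm_const n) * mobius ((rf_eval f ^^ n) v1) ((rf_eval f ^^ n) v2)"

lemma iterate_v_pcs: "(rf_eval f ^^ n) v1 \<in> post_critical_set f" "(rf_eval f ^^ n) v2 \<in> post_critical_set f"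
  by (induction n) (auto simp: v_pcs pcs_invariant)

lemma norm_const_over: "norm_const n \<in> F" "norm_const n \<noteq> 0"
proof -
  have "norm_const n \<in> F \<and> norm_const n \<noteq> 0"
    using disc_const(1,2) iterate_v_pcs pcs_over
    by (induction n) (auto simp: fibre_scale_nonzero subset_iff intro!: mult_in divide_in fibre_scale_over)
  then show "norm_const n \<in> F" "norm_const n \<noteq> 0" by auto
qed

lemma norm_unit_unit: "norm_unit n \<in> Units (B l)"
proof -
  interpret B: cring "B l" by (rule cring_coord_ring)
  have "rf_const (norm_const n) \<otimes>\<^bsub>B l\<^esub> mobius ((rf_eval f ^^ n) v1) ((rf_eval f ^^ n) v2) \<in> Units (B l)"
    using iterate_v_pcs pcs_over
    by (intro B.Units_m_closed const_unit norm_const_over mobius_unit pcs_subset_level) auto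
  then show ?thesis by (simp add: coord_ring_simps(2-) norm_unit_def)
qed

lemma norm_unit_closed: "norm_unit n \<in> carrier (B l)"
  using norm_unit_unit[of n l] by (auto simp: Units_def)

lemma ev_norm_unit:
  assumes "y \<notin> level l"
  shows "ev l y (norm_unit n) = norm_const n * (pdet y ((rf_eval f ^^ n) v1) / pdet y ((rf_eval f ^^ n) v2))"
    "ev l y (norm_unit n) \<noteq> 0"
proof -
  have y: "y \<noteq> (rf_eval f ^^ n) v1" "y \<noteq> (rf_eval f ^^ n) v2"
    using assms iterate_v_pcs pcs_subset_level by metis+
  have "has_value (norm_unit n) y (norm_const n * (pdet y ((rf_eval f ^^ n) v1) / pdet y ((rf_eval f ^^ n) v2)))"
    unfolding norm_unit_def by (intro has_value_mult has_value_const has_value_mobius y)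
  then show 1: "ev l y (norm_unit n) = norm_const n * (pdet y ((rf_eval f ^^ n) v1) / pdet y ((rf_eval f ^^ n) v2))"
    by (rule ev_eqI[OF norm_unit_closed])
  show "ev l y (norm_unit n) \<noteq> 0" unfolding 1 using norm_const_over y by simp
qed

text \<open>The source of the recursion for \<open>norm_const\<close>: a constant contributes its
  square, and the Moebius function contributes the ratio from \<open>norm_mobius\<close>.\<close>

lemma ev_norm:
  assumes "x0 \<noteq> x1" "rf_eval f x0 = y" "rf_eval f x1 = y" "y \<notin> level l"
  shows "ev (Suc l) x0 (norm_unit n) * ev (Suc l) x1 (norm_unit n) = ev l y (norm_unit (Suc n))"
proof -
  have x: "x0 \<notin> level (Suc l)" "x1 \<notin> level (Suc l)" using assms by (auto simp flip: level_Suc)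
  have "rf_eval f ((rf_eval f ^^ n) v2) \<noteq> y"
    using assms(4) pcs_subset_level iterate_v_pcs(2)[of "Suc n"] by auto
  note N = norm_mobius[OF assms(1-3) this, of "(rf_eval f ^^ n) v1"]
  have "(k * a) * (k * b) = k * k * (a * b)" for k a b :: 'a by simp
  then show ?thesis
    unfolding ev_norm_unit(1)[OF x(1)] ev_norm_unit(1)[OF x(2)] ev_norm_unit(1)[OF assms(4)]
    by (simp only: N norm_const.simps funpow.simps comp_def mult.assoc)
qed

text \<open>The identity of functions behind \<open>ev_norm\<close>: on the upper level the norm
  splits into the unit and its conjugate.\<close>

lemma pull_norm_unit:
  assumes T: "T \<in> algebra_hom A (V (Suc l)) (V (Suc l))"
    "\<And>x0 x1. x0 \<noteq> x1 \<Longrightarrow> rf_eval f x0 = rf_eval f x1 \<Longrightarrow> rf_eval f x0 \<notin> level l \<Longrightarrow>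
      compose (carrier (B (Suc l))) (ev (Suc l) x0) T = ev (Suc l) x1"
  shows "pull l (norm_unit (Suc n)) = norm_unit n \<otimes>\<^bsub>B (Suc l)\<^esub> T (norm_unit n)"
proof -
  have Tc: "T (norm_unit n) \<in> carrier (B (Suc l))"
    using T(1) norm_unit_closed by (auto simp: algebra_hom_iff dest: ring_homD(1))
  have "rf_comp (norm_unit (Suc n)) f = norm_unit n * T (norm_unit n)"
  proof (rule rf_eqI)
    let ?Z = "{z. Some z \<notin> level (Suc l)}"
    have "finite (Some -` level (Suc l))" by (rule finite_vimageI[OF finite_level]) auto
    moreover have "?Z = UNIV - Some -` level (Suc l)" by auto
    ultimately show "infinite ?Z" using infinite_UNIV_char_0 Diff_infinite_finite by metis
    fix z assume "z \<in> ?Z"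
    let ?y = "rf_eval f (Some z)"
    have y: "?y \<notin> level l" "Some z \<notin> level (Suc l)" using \<open>z \<in> ?Z\<close> by (auto simp flip: level_Suc)
    then obtain x1 where x1: "Some z \<noteq> x1" "rf_eval f x1 = ?y"
      using two_preimages[of ?y] v_level[of l] by metis
    show "has_value (rf_comp (norm_unit (Suc n)) f) (Some z) (ev l ?y (norm_unit (Suc n)))"
      by (intro has_value_comp ev_value norm_unit_closed y)
    have "ev (Suc l) (Some z) (T (norm_unit n)) = ev (Suc l) x1 (norm_unit n)"
      using fun_cong[OF T(2)[OF x1(1) x1(2)[symmetric] y(1)], of "norm_unit n"] norm_unit_closed
      by (simp add: compose_def)
    then have "has_value (T (norm_unit n)) (Some z) (ev (Suc l) x1 (norm_unit n))"
      using ev_value[OF Tc y(2)] by simp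
    then show "has_value (norm_unit n * T (norm_unit n)) (Some z) (ev l ?y (norm_unit (Suc n)))"
      unfolding ev_norm[OF x1(1) refl x1(2) y(1), symmetric]
      by (intro has_value_mult ev_value norm_unit_closed y)
  qed
  then show ?thesis using norm_unit_closed by (simp add: pull_def coord_ring_simps(2-))
qed

section \<open>Negation of square roots along the tower\<close>

lemma square_cases:
  fixes z w :: 'a
  assumes "z * z = w * w"
  shows "z = w \<or> z = - w"
  using assms square_eq_iff by blast

lemma sqrt_exists: "\<exists>z :: 'a. z * z = a"
  using nth_root_exists[of 2 a] by (auto simp: power2_eq_square)

text \<open>Both square roots are included, so that no choice of a root enters;
  \<open>negatesI\<close> reduces the check to a single one.\<close>

definition negates :: "('a poly fract ring \<times> ('a poly fract \<Rightarrow> 'a poly fract) \<Rightarrow>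
    ('a poly fract \<Rightarrow> 'a) \<Rightarrow> 'a poly fract \<Rightarrow> 'a) \<Rightarrow> nat \<Rightarrow> 'a poly fract \<Rightarrow> 'a option \<Rightarrow> bool" where
  "negates \<sigma> l u y \<longleftrightarrow> (\<forall>z. z * z = ev l y u \<longrightarrow> kummer \<sigma> (V l) u (ev l y) z = - z)"

lemma negatesI:
  assumes \<sigma>: "natural_family \<sigma>" and y: "(rf_eval f ^^ l) y = x" and u: "u \<in> Units (B l)"
    and w: "w * w = ev l y u" "kummer \<sigma> (V l) u (ev l y) w = - w"
  shows "negates \<sigma> l u y"
  unfolding negates_def
proof (intro allI impI)
  fix z assume "z * z = ev l y u"
  then have "z = w \<or> z = - w" using square_cases w(1) by metis
  then show "kummer \<sigma> (V l) u (ev l y) z = - z"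
    using kummer_minus[OF \<sigma> V_cover ev_fibre[OF y], of u w] u w by auto
qed

text \<open>On the next level \<open>S\<close> is a root of \<open>disc\<close> with opposite values
  at the two points of the fibre, so swapping these points negates the root.\<close>

lemma negates_disc:
  assumes \<sigma>: "natural_family \<sigma>" and y: "(rf_eval f ^^ l) y = x"
    and x: "x0 \<noteq> x1" "rf_eval f x0 = y" "rf_eval f x1 = y"
    and swap: "\<sigma> (V (Suc l)) (ev (Suc l) x0) = ev (Suc l) x1"
  shows "negates \<sigma> l (norm_unit 0) y"
proof -
  have d: "norm_unit 0 = disc" by (simp add: norm_unit_def disc_def)
  have yl: "y \<notin> level l" by (rule not_in_level[OF y])
  have y0: "(rf_eval f ^^ Suc l) x0 = x" using y x by (simp add: funpow_swap1)
  have c: "x0 \<noteq> c2" "x1 \<noteq> c2" using x yl v_level[of l] v2_iff by metis+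
  have SU: "S \<in> Units (B (Suc l))" using S_unit[OF v_level[of l]] unfolding level_Suc .
  then have Sc: "S \<in> carrier (B (Suc l))" using quadratic_extension.root_closed[OF quadratic_step] by blast
  let ?w = "ev (Suc l) x0 S"
  have s: "ev (Suc l) x0 S = pdet x0 c1 / pdet x0 c2" "ev (Suc l) x1 S = pdet x1 c1 / pdet x1 c2"
    using has_value_mobius[OF c(1), of c1] has_value_mobius[OF c(2), of c1] Sc by (auto intro: ev_eqI)
  have dU: "disc \<in> Units (B l)" using norm_unit_unit[of 0 l] d by simp
  have dc: "disc \<in> carrier (B l)" using norm_unit_closed[of 0 l] d by simp
  have pd: "pull l disc = S \<otimes>\<^bsub>B (Suc l)\<^esub> S"
    using dc by (simp add: pull_def coord_ring_simps(2-) S_square)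
  have comp: "compose (carrier (B l)) (ev (Suc l) x0) (pull l) = ev l y"
    using pull_ev[of x0 l] x yl by simp
  have "ev (Suc l) x0 (pull l disc) = ev l y disc"
    using fun_cong[OF comp, of disc] dc by (simp add: compose_def)
  moreover have "ev (Suc l) x0 (S \<otimes>\<^bsub>B (Suc l)\<^esub> S) = ?w * ?w"
    using ev_fibre[OF y0] Sc by (auto simp: fibre_iff dest: ring_homD(2))
  ultimately have ww: "?w * ?w = ev l y disc" using pd by simp
  have "kummer \<sigma> (V l) disc (ev l y) ?w = kummer \<sigma> (V (Suc l)) (S \<otimes>\<^bsub>B (Suc l)\<^esub> S) (ev (Suc l) x0) ?w"
    using kummer_natural[OF \<sigma> V_cover V_cover pull_hom, of disc l "ev (Suc l) x0" ?w]
      dU ev_fibre[OF y0] ww pd comp \<open>ev (Suc l) x0 (pull l disc) = ev l y disc\<close> by simp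
  also have "\<dots> = ev (Suc l) x1 S"
    using kummer_square[OF \<sigma> V_cover, of S "Suc l" "ev (Suc l) x0"] SU ev_fibre[OF y0] swap by simp
  also have "\<dots> = - ?w" unfolding s using opposite[OF x(1) _ c(1)] x by simp
  finally show ?thesis unfolding d by (rule negatesI[OF \<sigma> y dU ww])
qed

text \<open>The roots move from \<open>z0\<close> to \<open>z1\<close> to \<open>- z0\<close>, so
  their product changes sign; the hypothesis on the square of the family is the second half of this
  orbit.\<close>

lemma negates_norm:
  assumes \<sigma>: "natural_family \<sigma>" and y: "(rf_eval f ^^ l) y = x"
    and x: "x0 \<noteq> x1" "rf_eval f x0 = y" "rf_eval f x1 = y"
    and swap: "\<sigma> (V (Suc l)) (ev (Suc l) x0) = ev (Suc l) x1"
    and neg: "negates (\<lambda>V \<psi>. \<sigma> V (\<sigma> V \<psi>)) (Suc l) (norm_unit n) x0"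
  shows "negates \<sigma> l (norm_unit (Suc n)) y"
proof -
  let ?u = "norm_unit n" and ?g = "norm_unit (Suc n)"
  have yl: "y \<notin> level l" by (rule not_in_level[OF y])
  have y0: "(rf_eval f ^^ Suc l) x0 = x" and y1: "(rf_eval f ^^ Suc l) x1 = x"
    using y x by (simp_all add: funpow_swap1)
  note f0 = ev_fibre[OF y0] and f1 = ev_fibre[OF y1]
  obtain T where T: "T \<in> algebra_hom A (V (Suc l)) (V (Suc l))"
    "\<And>x0 x1. x0 \<noteq> x1 \<Longrightarrow> rf_eval f x0 = rf_eval f x1 \<Longrightarrow> rf_eval f x0 \<notin> level l \<Longrightarrow>
      compose (carrier (B (Suc l))) (ev (Suc l) x0) T = ev (Suc l) x1"
    using conjugation by blast
  have Tx: "compose (carrier (B (Suc l))) (ev (Suc l) x0) T = ev (Suc l) x1"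
    using T(2)[OF x(1)] x yl by simp
  have Tu: "ev (Suc l) x0 (T ?u) = ev (Suc l) x1 ?u"
    using fun_cong[OF Tx, of ?u] norm_unit_closed by (simp add: compose_def)
  have uU: "?u \<in> Units (fst (V (Suc l)))" using norm_unit_unit by simp
  have TU: "T ?u \<in> Units (fst (V (Suc l)))" by (rule algebra_hom_unit[OF V_cover V_cover T(1) uU])
  obtain z0 where z0: "z0 * z0 = ev (Suc l) x0 ?u" using sqrt_exists by blast
  define z1 where "z1 = kummer \<sigma> (V (Suc l)) ?u (ev (Suc l) x0) z0"
  have z1: "z1 * z1 = ev (Suc l) x1 ?u"
    unfolding z1_def using natural_qpoint(2)[OF V_cover uU \<sigma> f0 z0] swap by simp
  have "kummer (\<lambda>V \<psi>. \<sigma> V (\<sigma> V \<psi>)) (V (Suc l)) ?u (ev (Suc l) x0) z0 = - z0"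
    using neg z0 by (simp add: negates_def)
  then have k1: "kummer \<sigma> (V (Suc l)) ?u (ev (Suc l) x1) z1 = - z0"
    using kummer_compose[OF \<sigma> \<sigma> V_cover f0 uU z0] swap by (simp add: z1_def)
  have comp: "compose (carrier (B l)) (ev (Suc l) x0) (pull l) = ev l y"
    using pull_ev[of x0 l] x yl by simp
  have pg: "ev (Suc l) x0 (pull l ?g) = ev l y ?g"
    using fun_cong[OF comp, of ?g] norm_unit_closed by (simp add: compose_def)
  have zz: "(z0 * z1) * (z0 * z1) = ev l y ?g"
  proof -
    have "(z0 * z1) * (z0 * z1) = (z0 * z0) * (z1 * z1)" by simp
    then show ?thesis unfolding z0 z1 ev_norm[OF x yl] .
  qed
  have "kummer \<sigma> (V l) ?g (ev l y) (z0 * z1) = kummer \<sigma> (V (Suc l)) (pull l ?g) (ev (Suc l) x0) (z0 * z1)"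
    using kummer_natural[OF \<sigma> V_cover V_cover pull_hom, of ?g l "ev (Suc l) x0" "z0 * z1"]
      norm_unit_unit f0 zz pg comp by simp
  also have "\<dots> = kummer \<sigma> (V (Suc l)) ?u (ev (Suc l) x0) z0 * kummer \<sigma> (V (Suc l)) (T ?u) (ev (Suc l) x0) z1"
    using kummer_mult[OF \<sigma> V_cover f0 uU z0 TU, of z1] z1 Tu pull_norm_unit[OF T] by simp
  \<comment> \<open>The deck transformation trades the second factor at \<open>x0\<close> for the
    unit itself at \<open>x1\<close>, where the root \<open>z1\<close> goes to
    \<open>- z0\<close>.\<close>
  also have "kummer \<sigma> (V (Suc l)) (T ?u) (ev (Suc l) x0) z1 = kummer \<sigma> (V (Suc l)) ?u (ev (Suc l) x1) z1"
    using kummer_natural[OF \<sigma> V_cover V_cover T(1) uU f0, of z1] z1 Tu Tx by simp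
  finally have "kummer \<sigma> (V l) ?g (ev l y) (z0 * z1) = - (z0 * z1)"
    unfolding k1 z1_def[symmetric] by simp
  then show ?thesis by (rule negatesI[OF \<sigma> y norm_unit_unit zz])
qed

text \<open>Multiplicativity collects one sign per factor. The power of -1 is kept so that the
  parity of the number of factors can be used for the telescoping product.\<close>

lemma kummer_prod:
  assumes \<sigma>: "natural_family \<sigma>" and y: "(rf_eval f ^^ l) y = x"
    and g: "\<And>j. j < m \<Longrightarrow> g j \<in> Units (B l)" "\<And>j. j < m \<Longrightarrow> negates \<sigma> l (g j) y"
  shows "(\<Prod>j<m. g j) \<in> Units (B l) \<and> (\<forall>z. z * z = ev l y (\<Prod>j<m. g j) \<longrightarrow>
    kummer \<sigma> (V l) (\<Prod>j<m. g j) (ev l y) z = (- 1) ^ m * z)"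
  using g
proof (induction m)
  case 0
  interpret B: cring "B l" by (rule cring_coord_ring)
  have one: "1 \<in> Units (B l)" using B.Units_one_closed by (simp add: coord_ring_simps(2-))
  have ev1: "ev l y 1 = 1" using ev_eqI[OF zero_one_in_coord_ring(2) has_value_one] .
  have fy: "\<sigma> (V l) (ev l y) \<in> fibre (V l)" by (rule natural_hom[OF \<sigma> V_cover ev_fibre[OF y]])
  have "\<sigma> (V l) (ev l y) 1 = 1"
    using fy ring_homD(4)[of "\<sigma> (V l) (ev l y)" "B l" K] by (simp add: fibre_iff coord_ring_simps(2-))
  then have k1: "kummer \<sigma> (V l) 1 (ev l y) 1 = 1"
    using kummer_square[OF \<sigma> V_cover, of 1 l "ev l y"] one ev_fibre[OF y] ev1
    by (simp add: coord_ring_simps(2-))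
  have "kummer \<sigma> (V l) 1 (ev l y) z = z" if "z * z = 1" for z
  proof -
    have "z = 1 \<or> z = - 1" using that square_cases[of z 1] by simp
    then show ?thesis
      using k1 kummer_minus[OF \<sigma> V_cover ev_fibre[OF y], of 1 1] one ev1 by auto
  qed
  then show ?case using one ev1 by simp
next
  case (Suc m)
  interpret B: cring "B l" by (rule cring_coord_ring)
  let ?p = "\<Prod>j<m. g j"
  have p: "?p \<in> Units (B l)" and kp: "\<And>z. z * z = ev l y ?p \<Longrightarrow>
      kummer \<sigma> (V l) ?p (ev l y) z = (- 1) ^ m * z"
    using Suc by auto
  have gm: "g m \<in> Units (B l)" "negates \<sigma> l (g m) y" using Suc.prems by auto
  have eq: "(\<Prod>j<Suc m. g j) = ?p \<otimes>\<^bsub>B l\<^esub> g m" by (simp add: coord_ring_simps(2-))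
  have U: "(\<Prod>j<Suc m. g j) \<in> Units (B l)" unfolding eq using p gm by simp
  have evm: "ev l y (?p \<otimes>\<^bsub>B l\<^esub> g m) = ev l y ?p * ev l y (g m)"
    using ev_fibre[OF y] p gm ring_homD(2)[of "ev l y" "B l" K ?p "g m"] by (auto simp: fibre_iff)
  have "kummer \<sigma> (V l) (?p \<otimes>\<^bsub>B l\<^esub> g m) (ev l y) z = (- 1) ^ Suc m * z"
    if z: "z * z = ev l y (?p \<otimes>\<^bsub>B l\<^esub> g m)" for z
  proof -
    obtain b where b: "b * b = ev l y (g m)" using sqrt_exists by blast
    have "ev l y (g m) \<noteq> 0"
    proof -
      have "ev l y (inv\<^bsub>B l\<^esub> g m \<otimes>\<^bsub>B l\<^esub> g m) = 1"
        using gm ev_eqI[OF zero_one_in_coord_ring(2) has_value_one]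
        by (simp add: coord_ring_simps(4))
      then have "ev l y (inv\<^bsub>B l\<^esub> g m) * ev l y (g m) = 1"
        using ev_fibre[OF y] gm ring_homD(2)[of "ev l y" "B l" K "inv\<^bsub>B l\<^esub> g m" "g m"]
        by (auto simp: fibre_iff)
      then show ?thesis by auto
    qed
    then have b0: "b \<noteq> 0" using b by auto
    \<comment> \<open>A root of the product is split into a root of the first \<open>m\<close>
      factors and the chosen root \<open>b\<close> of the last one.\<close>
    define a where "a = z / b"
    have za: "z = a * b" using b0 by (simp add: a_def)
    have "a * a * (b * b) = ev l y ?p * (b * b)" using z evm b za by (simp add: mult_ac)
    then have a: "a * a = ev l y ?p" using b0 by simp
    have "kummer \<sigma> (V l) (?p \<otimes>\<^bsub>B l\<^esub> g m) (ev l y) (a * b) =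
        kummer \<sigma> (V l) ?p (ev l y) a * kummer \<sigma> (V l) (g m) (ev l y) b"
      using kummer_mult[OF \<sigma> V_cover ev_fibre[OF y], of ?p a "g m" b] p gm(1) a b by simp
    also have "\<dots> = ((- 1) ^ m * a) * (- b)" using kp[OF a] gm(2) b by (simp add: negates_def)
    finally show ?thesis by (simp add: za)
  qed
  with U show ?case unfolding eq by blast
qed

lemma mobius_telescope:
  "(\<Prod>j<m. rf_const (k j) * mobius (a j) (a (Suc j))) = rf_const (\<Prod>j<m. k j) * mobius (a 0) (a m)"
proof (induction m)
  case (Suc m)
  have "(\<Prod>j<Suc m. rf_const (k j) * mobius (a j) (a (Suc j))) =
      rf_const (\<Prod>j<Suc m. k j) * (mobius (a 0) (a m) * mobius (a m) (a (Suc m)))"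
    using Suc by (simp add: rf_const_mult mult_ac)
  then show ?case by (simp only: mobius_mult)
qed simp

text \<open>The constant \<open>K\<close> obtained by telescoping does not depend on the vertex, so the same family
  \<open>\<rho>\<close> would have to negate \<open>\<surd>K\<close> at the vertex \<open>v\<close>, and its square \<open>\<rho>\<^sup>2\<close> at a child of \<open>v\<close>.\<close>

theorem no_dyadic_odometer:
  assumes lab: "tree_labelling f x \<phi>" and \<sigma>: "natural_family \<sigma>"
    and swap: "\<And>e b. (\<sigma> (V (length v + length e + 1)) ^^ (2 ^ length e * k))
        (ev (length v + length e + 1) (\<phi> (v @ e @ [b]))) = ev (length v + length e + 1) (\<phi> (v @ e @ [\<not> b]))"
    and period: "(rf_eval f ^^ d) v1 = v2" "(rf_eval f ^^ (q * d)) v1 = v1" and q: "odd q"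
  shows False
proof -
  have \<phi>_level: "(rf_eval f ^^ length w) (\<phi> w) = x" for w
    using lab unfolding tree_labelling_def bij_betw_def by blast
  have \<phi>_step: "rf_eval f (\<phi> (w @ [b])) = \<phi> w" for w b
    using lab unfolding tree_labelling_def by blast
  have \<phi>_inj: "\<phi> (w @ [True]) \<noteq> \<phi> (w @ [False])" for w
  proof
    assume *: "\<phi> (w @ [True]) = \<phi> (w @ [False])"
    have "inj_on \<phi> {u. length u = Suc (length w)}"
      using lab unfolding tree_labelling_def bij_betw_def by blast
    from inj_onD[OF this *] show False by simp
  qed
  \<comment> \<open>For \<open>m = 2 ^ length e * k\<close> this power fixes the vertex
    \<open>v @ e\<close> and swaps its two children, by \<open>swap\<close>.\<close>
  define \<rho> where "\<rho> = (\<lambda>m V. \<sigma> V ^^ m)"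
  have \<rho>: "natural_family (\<rho> m)" for m unfolding \<rho>_def by (rule natural_family_funpow[OF \<sigma>])
  have \<rho>2: "(\<lambda>V \<psi>. \<rho> m V (\<rho> m V \<psi>)) = \<rho> (2 * m)" for m
    by (intro ext) (simp add: \<rho>_def mult_2 funpow_add)
  \<comment> \<open>The induction on \<open>n\<close> runs over all \<open>e\<close> because going
    up one level doubles the exponent: the hypothesis for the child \<open>e @ [True]\<close>
    concerns the square of the current family, as \<open>negates_norm\<close> demands.\<close>
  have neg: "negates (\<rho> (2 ^ length e * k)) (length v + length e) (norm_unit n) (\<phi> (v @ e))" for n e
  proof (induction n arbitrary: e)
    case 0
    show ?case
    proof (rule negates_disc[OF \<rho>])
      show "(rf_eval f ^^ (length v + length e)) (\<phi> (v @ e)) = x" using \<phi>_level[of "v @ e"] by simp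
      show "\<phi> (v @ e @ [True]) \<noteq> \<phi> (v @ e @ [False])" using \<phi>_inj[of "v @ e"] by simp
      show "rf_eval f (\<phi> (v @ e @ [True])) = \<phi> (v @ e)" "rf_eval f (\<phi> (v @ e @ [False])) = \<phi> (v @ e)"
        using \<phi>_step[of "v @ e"] by simp_all
      show "\<rho> (2 ^ length e * k) (V (Suc (length v + length e))) (ev (Suc (length v + length e)) (\<phi> (v @ e @ [True]))) =
          ev (Suc (length v + length e)) (\<phi> (v @ e @ [False]))"
        using swap[of e True] by (simp add: \<rho>_def)
    qed
  next
    case (Suc n)
    show ?case
    proof (rule negates_norm[OF \<rho>])
      show "(rf_eval f ^^ (length v + length e)) (\<phi> (v @ e)) = x" using \<phi>_level[of "v @ e"] by simp
      show "\<phi> (v @ e @ [True]) \<noteq> \<phi> (v @ e @ [False])" using \<phi>_inj[of "v @ e"] by simp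
      show "rf_eval f (\<phi> (v @ e @ [True])) = \<phi> (v @ e)" "rf_eval f (\<phi> (v @ e @ [False])) = \<phi> (v @ e)"
        using \<phi>_step[of "v @ e"] by simp_all
      show "\<rho> (2 ^ length e * k) (V (Suc (length v + length e))) (ev (Suc (length v + length e)) (\<phi> (v @ e @ [True]))) =
          ev (Suc (length v + length e)) (\<phi> (v @ e @ [False]))"
        using swap[of e True] by (simp add: \<rho>_def)
      show "negates (\<lambda>V \<psi>. \<rho> (2 ^ length e * k) V (\<rho> (2 ^ length e * k) V \<psi>)) (Suc (length v + length e))
          (norm_unit n) (\<phi> (v @ e @ [True]))"
        unfolding \<rho>2 using Suc.IH[of "e @ [True]"] by (simp add: mult.assoc)
    qed
  qed
  define K0 where "K0 = (\<Prod>j<q. norm_const (j * d))"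
  have K0: "K0 \<in> F" "K0 \<noteq> 0"
  proof -
    have "(\<Prod>j<m. norm_const (j * d)) \<in> F" for m
      by (induction m) (auto intro: one_in mult_in norm_const_over)
    then show "K0 \<in> F" by (simp add: K0_def)
    show "K0 \<noteq> 0" by (simp add: K0_def norm_const_over)
  qed
  \<comment> \<open>Since \<open>v2\<close> lies \<open>d\<close> steps after \<open>v1\<close>, the
    pole of each factor is the zero of the next, and after \<open>q\<close> factors the cycle
    closes.\<close>
  have prod: "(\<Prod>j<q. norm_unit (j * d)) = rf_const K0"
  proof -
    have "norm_unit (j * d) = rf_const (norm_const (j * d)) *
        mobius ((rf_eval f ^^ (j * d)) v1) ((rf_eval f ^^ (Suc j * d)) v1)" for j
    proof -
      have "(rf_eval f ^^ (Suc j * d)) v1 = (rf_eval f ^^ (j * d)) v2"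
        by (simp add: add.commute[of d] funpow_add period(1))
      then show ?thesis by (simp add: norm_unit_def)
    qed
    then have "(\<Prod>j<q. norm_unit (j * d)) = (\<Prod>j<q. rf_const (norm_const (j * d)) *
        mobius ((rf_eval f ^^ (j * d)) v1) ((rf_eval f ^^ (Suc j * d)) v1))"
      by (intro prod.cong) auto
    also have "\<dots> = rf_const K0 * mobius ((rf_eval f ^^ (0 * d)) v1) ((rf_eval f ^^ (q * d)) v1)"
      unfolding K0_def by (rule mobius_telescope[of _ "\<lambda>j. (rf_eval f ^^ (j * d)) v1"])
    finally show ?thesis by (simp add: period(2))
  qed
  obtain z where z: "z * z = K0" using sqrt_exists by blast
  have z0: "z \<noteq> 0" using z K0 by auto
  have KA: "rf_const K0 \<in> Units (fst (V 0))" using const_unit[OF K0] by (simp add: level_0)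
  have xx: "(rf_eval f ^^ 0) x = x" by simp
  \<comment> \<open>A constant is pulled back from the base, so the sign computed at
    \<open>v @ e\<close> is a sign at the base point \<open>x\<close>; only the exponent still
    depends on \<open>e\<close>.\<close>
  have base: "kummer (\<rho> (2 ^ length e * k)) (V 0) (rf_const K0) (ev 0 x) z = - z" for e :: "bool list"
  proof -
    let ?l = "length v + length e" and ?y = "\<phi> (v @ e)"
    have y: "(rf_eval f ^^ ?l) ?y = x" using \<phi>_level[of "v @ e"] by simp
    have evK: "ev l u (rf_const K0) = K0" for l u
      by (rule ev_eqI[OF const_in_coord_ring[OF K0(1)] has_value_const])
    have "kummer (\<rho> (2 ^ length e * k)) (V ?l) (rf_const K0) (ev ?l ?y) z = (- 1) ^ q * z"
      using kummer_prod[OF \<rho> y, of q "\<lambda>j. norm_unit (j * d)"] norm_unit_unit neg z evK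
      unfolding prod by auto
    then have 1: "kummer (\<rho> (2 ^ length e * k)) (V ?l) (rf_const K0) (ev ?l ?y) z = - z" using q by simp
    let ?h = "snd (V ?l)"
    have h: "?h \<in> algebra_hom A (V 0) (V ?l)"
      using coversD(2)[OF V_cover[of ?l]] by (auto simp: algebra_hom_iff V_eq level_0 comp_iter_0)
    have hK: "?h (rf_const K0) = rf_const K0"
      using const_in_coord_ring[OF K0(1)] by (simp add: V_eq rf_comp_hom(4)[OF iter_facts(2)])
    have "compose (carrier (B 0)) (ev ?l ?y) ?h = ev 0 x"
      using compose_fibre[OF V_cover h ev_fibre[OF y]] ev_fibre[OF xx] 
      by (auto simp: fibre_iff V_eq level_0 comp_iter_0 extensional_def fun_eq_iff compose_def)
    then show ?thesis
      using kummer_natural[OF \<rho> V_cover V_cover h KA ev_fibre[OF y], of z] hK evK z 1 by simp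
  qed
  \<comment> \<open>\<open>V 0\<close> is the trivial cover, with a single point over
    \<open>x\<close>.\<close>
  have fix_base: "\<rho> m (V 0) (ev 0 x) = ev 0 x" for m
  proof -
    have "\<rho> m (V 0) (ev 0 x) \<in> fibre (V 0)" by (rule natural_hom[OF \<rho> V_cover ev_fibre[OF xx]])
    then show ?thesis
      using ev_fibre[OF xx] by (auto simp: fibre_iff V_eq level_0 comp_iter_0 extensional_def fun_eq_iff)
  qed
  \<comment> \<open>For \<open>e = []\<close> the family \<open>\<rho> k\<close> negates the root,
    so its square fixes it; for \<open>e = [True]\<close> that same square negates it.\<close>
  have "kummer (\<rho> (2 * k)) (V 0) (rf_const K0) (ev 0 x) z = - (- z)"
  proof -
    have evK: "z * z = ev 0 x (rf_const K0)"
      using ev_eqI[OF const_in_coord_ring[OF K0(1)] has_value_const] z by simp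
    have k: "kummer (\<rho> k) (V 0) (rf_const K0) (ev 0 x) z = - z" using base[of "[]"] by simp
    show ?thesis
      using kummer_compose[OF \<rho> \<rho> V_cover ev_fibre[OF xx] KA evK, of k k] k fix_base
        kummer_minus[OF \<rho> V_cover ev_fibre[OF xx] KA evK] unfolding \<rho>2 by simp
  qed
  moreover have "kummer (\<rho> (2 * k)) (V 0) (rf_const K0) (ev 0 x) z = - z" using base[of "[True]"] by simp
  ultimately show False using z0 by simp
qed

end

section \<open>Stable cycles\<close>

text \<open>Inductively \<open>\<gamma>\<close> respects parents: a child of \<open>w\<close> sent
  to the parent of \<open>\<gamma> w\<close> would have the same image as the parent of
  \<open>w\<close>.\<close>

lemma tree_aut_child:
  assumes "\<gamma> \<in> tree_aut"
  shows "length (\<gamma> w) = length w" "\<exists>c. \<gamma> (w @ [b]) = \<gamma> w @ [c]"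
proof -
  have \<gamma>: "bij \<gamma>" "\<gamma> [] = []" "\<And>v w. tree_adj (\<gamma> v) (\<gamma> w) \<longleftrightarrow> tree_adj v w"
    using assms by (auto simp: tree_aut_def)
  have inj: "\<gamma> v = \<gamma> w \<longleftrightarrow> v = w" for v w using \<gamma>(1) by (simp add: bij_def inj_eq)
  have step: "\<exists>c. \<gamma> (w @ [b]) = \<gamma> w @ [c]"
    if parent: "w = [] \<or> (\<exists>c. \<gamma> w = \<gamma> (butlast w) @ [c])" for w b
  proof -
    have "tree_adj w (w @ [b])" by (auto simp: tree_adj_def)
    then have "tree_adj (\<gamma> w) (\<gamma> (w @ [b]))" using \<gamma>(3) by blast
    then consider c where "\<gamma> (w @ [b]) = \<gamma> w @ [c]" | c where "\<gamma> w = \<gamma> (w @ [b]) @ [c]"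
      unfolding tree_adj_def by blast
    then show ?thesis
    proof cases
      case 2
      then have "w \<noteq> []" using \<gamma>(2) by auto
      then obtain d where "\<gamma> w = \<gamma> (butlast w) @ [d]" using parent by blast
      with 2 have "\<gamma> (w @ [b]) = \<gamma> (butlast w)" by simp
      then have "w @ [b] = butlast w" by (simp add: inj)
      then have "length (w @ [b]) = length (butlast w)" by simp
      then show ?thesis by simp
    qed blast
  qed
  have main: "length (\<gamma> w) = length w \<and> (w = [] \<or> (\<exists>c. \<gamma> w = \<gamma> (butlast w) @ [c]))" for w
  proof (induction w rule: rev_induct)
    case Nil
    then show ?case using \<gamma>(2) by simp
  next
    case (snoc b w)
    from step[of w b] snoc obtain c where "\<gamma> (w @ [b]) = \<gamma> w @ [c]" by blast
    then show ?case using snoc by simp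
  qed
  show "length (\<gamma> w) = length w" "\<exists>c. \<gamma> (w @ [b]) = \<gamma> w @ [c]"
    using main[of w] step[of w b] by blast+
qed

lemma tree_aut_funpow_child:
  assumes "\<gamma> \<in> tree_aut"
  shows "length ((\<gamma> ^^ m) w) = length w" "\<exists>c. (\<gamma> ^^ m) (w @ [b]) = (\<gamma> ^^ m) w @ [c]"
proof -
  have "length ((\<gamma> ^^ m) w) = length w \<and> (\<exists>c. (\<gamma> ^^ m) (w @ [b]) = (\<gamma> ^^ m) w @ [c])"
    by (induction m) (auto simp: tree_aut_child[OF assms])
  then show "length ((\<gamma> ^^ m) w) = length w" "\<exists>c. (\<gamma> ^^ m) (w @ [b]) = (\<gamma> ^^ m) w @ [c]" by auto
qed

text \<open>An injective map is purely periodic on a finite orbit, so the size of the orbit is the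
  first return time.\<close>

lemma card_forward_orbit:
  assumes "inj \<gamma>" "card (forward_orbit \<gamma> u) = c" "c > 0"
  shows "(\<gamma> ^^ c) u = u" "\<And>i. 0 < i \<Longrightarrow> i < c \<Longrightarrow> (\<gamma> ^^ i) u \<noteq> u"
proof -
  have fin: "finite (forward_orbit \<gamma> u)" using assms(2,3) card_gt_0_iff by metis
  have orb: "forward_orbit \<gamma> u = range (\<lambda>i. (\<gamma> ^^ i) u)" by (auto simp: forward_orbit_def)
  note injm = inj_fn[OF assms(1)]
  have cancel: "(\<gamma> ^^ (j - i)) u = u" if "(\<gamma> ^^ i) u = (\<gamma> ^^ j) u" "i < j" for i j
  proof -
    have "(\<gamma> ^^ j) u = (\<gamma> ^^ i) ((\<gamma> ^^ (j - i)) u)"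
      using that(2) by (metis add_diff_inverse_nat comp_apply funpow_add less_imp_not_less)
    then show ?thesis using injD[OF injm[of i]] that(1) by metis
  qed
  have "\<not> inj (\<lambda>i. (\<gamma> ^^ i) u)" using fin unfolding orb by (auto dest: finite_imageD)
  then obtain i j where ij: "(\<gamma> ^^ i) u = (\<gamma> ^^ j) u" "i < j"
    unfolding inj_def by (metis nat_neq_iff)
  then have ex: "\<exists>n>0. (\<gamma> ^^ n) u = u" using cancel[OF ij] by (intro exI[of _ "j - i"]) auto
  define n where "n = (LEAST n. n > 0 \<and> (\<gamma> ^^ n) u = u)"
  have n: "n > 0" "(\<gamma> ^^ n) u = u" using LeastI_ex[OF ex] unfolding n_def by auto
  have least: "(\<gamma> ^^ i) u \<noteq> u" if "0 < i" "i < n" for i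
    using not_less_Least[of i "\<lambda>n. n > 0 \<and> (\<gamma> ^^ n) u = u"] that unfolding n_def by auto
  have mult: "(\<gamma> ^^ (n * m)) u = u" for m
    by (induction m) (auto simp: funpow_add n(2))
  have "(\<gamma> ^^ i) u = (\<gamma> ^^ (i mod n)) u" for i
  proof -
    have "(\<gamma> ^^ i) u = (\<gamma> ^^ (i mod n + n * (i div n))) u" by simp
    then show ?thesis by (simp only: funpow_add comp_apply mult)
  qed
  then have "forward_orbit \<gamma> u = (\<lambda>i. (\<gamma> ^^ i) u) ` {..<n}"
    unfolding orb using n(1) by (auto intro!: image_eqI[of _ _ "_ mod n"])
  moreover have "inj_on (\<lambda>i. (\<gamma> ^^ i) u) {..<n}"
  proof (rule inj_onI, rule ccontr)
    fix i j assume *: "i \<in> {..<n}" "j \<in> {..<n}" "(\<gamma> ^^ i) u = (\<gamma> ^^ j) u" "i \<noteq> j"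
    then consider "i < j" | "j < i" by linarith
    then show False
    proof cases
      case 1
      moreover have "j - i < n" using *(2) by auto
      ultimately show False using cancel[of i j] least[of "j - i"] *(3) by simp
    next
      case 2
      moreover have "i - j < n" using *(1) by auto
      ultimately show False using cancel[of j i] least[of "i - j"] *(3) by simp
    qed
  qed
  ultimately have "c = n" using assms(2) by (simp add: card_image)
  then show "(\<gamma> ^^ c) u = u" "\<And>i. 0 < i \<Longrightarrow> i < c \<Longrightarrow> (\<gamma> ^^ i) u \<noteq> u" using n least by auto
qed

text \<open>The first return time of \<open>v @ e\<close> is \<open>2 ^ length e * k\<close>, and
  that of its children is twice as long; at the shorter time a child has therefore moved to its
  sibling.\<close>

lemma stable_cycle_swap:
  assumes \<gamma>: "\<gamma> \<in> tree_aut" and stable: "in_stable_cycle \<gamma> v k"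
  shows "(\<gamma> ^^ (2 ^ length e * k)) (v @ e @ [b]) = v @ e @ [\<not> b]"
proof -
  have k: "k > 0" "card (forward_orbit \<gamma> v) = k" using stable by (auto simp: in_stable_cycle_def)
  have inj: "inj \<gamma>" using \<gamma> by (auto simp: tree_aut_def bij_def)
  note injm = inj_fn[OF inj]
  have v_in: "v \<in> forward_orbit \<gamma> v" unfolding forward_orbit_def by (auto intro: exI[of _ 0])
  have period: "(\<gamma> ^^ (2 ^ length e * k)) (v @ e) = v @ e \<and>
      (\<forall>i. 0 < i \<longrightarrow> i < 2 ^ length e * k \<longrightarrow> (\<gamma> ^^ i) (v @ e) \<noteq> v @ e)" for e
  \<comment> \<open>Stability speaks of the levels strictly above \<open>v\<close>; at
    \<open>v\<close> itself the cycle length is given directly.\<close>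
  proof (cases "e = []")
    case True
    then show ?thesis using card_forward_orbit[OF inj k(2,1)] by simp
  next
    case False
    define m where "m = length v + length e"
    have "m > length v" using False by (simp add: m_def)
    then obtain u where u: "{w. length w = m \<and> take (length v) w \<in> forward_orbit \<gamma> v} \<subseteq> forward_orbit \<gamma> u"
      "card (forward_orbit \<gamma> u) = 2 ^ (m - length v) * k"
      using stable unfolding in_stable_cycle_def by blast
    then have c: "card (forward_orbit \<gamma> u) = 2 ^ length e * k" by (simp add: m_def)
    have "v @ e \<in> forward_orbit \<gamma> u" using u(1) v_in by (auto simp: m_def)
    then obtain i where i: "v @ e = (\<gamma> ^^ i) u" by (auto simp: forward_orbit_def)
    \<comment> \<open>Return times agree along an orbit, so those of \<open>v @ e\<close> can be
      read off at \<open>u\<close>.\<close>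
    have comm: "(\<gamma> ^^ t) (v @ e) = (\<gamma> ^^ i) ((\<gamma> ^^ t) u)" for t
      unfolding i by (metis add.commute comp_apply funpow_add)
    have iff: "(\<gamma> ^^ t) (v @ e) = v @ e \<longleftrightarrow> (\<gamma> ^^ t) u = u" for t
      unfolding comm using i injD[OF injm[of i]] by metis
    show ?thesis unfolding iff using card_forward_orbit[OF inj c] k(1) by simp
  qed
  let ?K = "2 ^ length e * k"
  obtain c where c: "(\<gamma> ^^ ?K) ((v @ e) @ [b]) = (\<gamma> ^^ ?K) (v @ e) @ [c]"
    using tree_aut_funpow_child(2)[OF \<gamma>] by blast
  have "(\<gamma> ^^ ?K) (v @ e @ [b]) \<noteq> v @ e @ [b]"
    using period[of "e @ [b]"] k(1) by simp
  then show ?thesis using c period[of e] by auto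
qed

text \<open>A limit of 1 makes the proportion positive at some level.\<close>

lemma settled_imp_stable_cycle:
  assumes "settled \<gamma>"
  obtains v k where "in_stable_cycle \<gamma> v k"
proof -
  let ?r = "\<lambda>n. real (card {v. length v = n \<and> (\<exists>k. in_stable_cycle \<gamma> v k)})
          / real (card {v :: bool list. length v = n})"
  have "?r \<longlonglongrightarrow> 1" using assms by (simp add: settled_def)
  then have "eventually (\<lambda>n. ?r n > 0) sequentially" by (rule order_tendstoD(1)) simp
  then obtain n where "?r n > 0" by (auto simp: eventually_sequentially)
  then have "{v. length v = n \<and> (\<exists>k. in_stable_cycle \<gamma> v k)} \<noteq> {}" by (intro notI) simp
  then show ?thesis using that by blast
qed

theorem (in preimage_tower) iterated_monodromy_not_settled:
  assumes lab: "tree_labelling f x \<phi>" and \<gamma>: "\<gamma> \<in> iterated_monodromy F f x \<phi>"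
    and period: "(rf_eval f ^^ d) v1 = v2" "(rf_eval f ^^ (q * d)) v1 = v1" and q: "odd q"
  shows "\<not> settled \<gamma>"
proof
  assume "settled \<gamma>"
  then obtain v k where stable: "in_stable_cycle \<gamma> v k" by (rule settled_imp_stable_cycle)
  obtain \<sigma> where aut: "\<gamma> \<in> tree_aut" and \<sigma>: "\<sigma> \<in> etale_pi1 F (post_critical_set f) x"
    and act: "\<And>w. ev (length w) (\<phi> (\<gamma> w)) = \<sigma> (V (length w)) (ev (length w) (\<phi> w))"
    using \<gamma> unfolding iterated_monodromy_def by auto
  have cov: "etale_covers F (post_critical_set f) = covers"
    by (simp add: etale_covers_def covers_def)
  have fib: "etale_fibre F (post_critical_set f) x W = fibre W" for W
    by (simp add: etale_fibre_def fibre_def)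
  have nat: "natural_family \<sigma>"
    using \<sigma> Bij_imp_funcset unfolding natural_family_def etale_pi1_def cov fib by fastforce
  have iter: "(\<sigma> (V n) ^^ m) (ev n (\<phi> w)) = ev n (\<phi> ((\<gamma> ^^ m) w))" if "length w = n" for n m w
  proof (induction m)
    case (Suc m)
    then show ?case using act[of "(\<gamma> ^^ m) w"] tree_aut_funpow_child(1)[OF aut, of m w] that by simp
  qed simp
  show False
  proof (rule no_dyadic_odometer[OF lab nat _ period q])
    fix e b
    show "(\<sigma> (V (length v + length e + 1)) ^^ (2 ^ length e * k))
        (ev (length v + length e + 1) (\<phi> (v @ e @ [b]))) = ev (length v + length e + 1) (\<phi> (v @ e @ [\<not> b]))"
      using iter[of "v @ e @ [b]" "length v + length e + 1" "2 ^ length e * k"]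
        stable_cycle_swap[OF aut stable, of e b] by simp
  qed
qed

section \<open>Rationality of the critical points\<close>

lemma degree_two_cases:
  assumes "Polynomial.degree p \<le> 2"
  obtains a b c where "p = [:a, b, c:]"
proof -
  have "p = [:Polynomial.coeff p 0, Polynomial.coeff p 1, Polynomial.coeff p 2:]"
  proof (rule poly_eqI)
    fix n :: nat
    consider "n = 0" | "n = 1" | "n = 2" | "n > 2" by linarith
    then show "Polynomial.coeff p n = Polynomial.coeff [:Polynomial.coeff p 0, Polynomial.coeff p 1, Polynomial.coeff p 2:] n"
    proof cases
      case 4
      then have "Polynomial.coeff p n = 0" using assms by (intro coeff_eq_0) simp
      moreover have "Polynomial.coeff [:Polynomial.coeff p 0, Polynomial.coeff p 1, Polynomial.coeff p 2:] n = 0"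
        using 4 by (intro coeff_eq_0) simp
      ultimately show ?thesis by simp
    qed (auto simp: numeral_2_eq_2)
  qed
  then show ?thesis using that by blast
qed

text \<open>If the two critical points \<open>z\<^sub>1, z\<^sub>2\<close> were not in \<open>F\<close>, they would be conjugate over \<open>F\<close>, and the
  conjugation would commute with \<open>f\<close>, hence rotate the critical cycle by half of its length.\<close>

lemma (in subfield_set) critical_points_rational:
  fixes f :: "'a poly fract"
  assumes two: "(2 :: 'a) \<noteq> 0" and deg: "rf_degree f = 2"
    and coeffs: "coeffs_in F (rf_num f)" "coeffs_in F (rf_den f)"
    and crit: "ramification_index f c1 > 1" "ramification_index f c2 > 1" "c1 \<noteq> c2"
    and cycle: "(rf_eval f ^^ d) c1 = c2" "(rf_eval f ^^ (2 * d)) c1 \<noteq> c1"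
  shows "c1 \<in> points_over F \<and> c2 \<in> points_over F"
proof -
  obtain p0 p1 p2 where p: "rf_num f = [:p0, p1, p2:]"
    using degree_two_cases rf_degree_bounds(1)[of f] deg by metis
  obtain q0 q1 q2 where q: "rf_den f = [:q0, q1, q2:]"
    using degree_two_cases rf_degree_bounds(2)[of f] deg by metis
  have inF: "p0 \<in> F" "p1 \<in> F" "p2 \<in> F" "q0 \<in> F" "q1 \<in> F" "q2 \<in> F"
    using coeffs by (auto simp: p q coeffs_in_pCons)
  \<comment> \<open>The coefficients of \<open>num' den - num den'\<close>, the Wronskian of
    numerator and denominator of \<open>f\<close>, which vanishes at the finite critical
    points.\<close>
  define D0 where "D0 = p1 * q0 - p0 * q1"
  define D1 where "D1 = 2 * (p2 * q0 - p0 * q2)"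
  define D2 where "D2 = p2 * q1 - p1 * q2"
  have "(2 :: 'a) \<in> F" using add_in[OF one_in one_in] by simp
  then have DF: "D0 \<in> F" "D1 \<in> F" "D2 \<in> F"
    unfolding D0_def D1_def D2_def using inF by (auto intro!: diff_in mult_in)
  \<comment> \<open>A vanishing Wronskian would make numerator and denominator proportional, hence
    \<open>f\<close> constant.\<close>
  have nz: "\<not> (D0 = 0 \<and> D1 = 0 \<and> D2 = 0)"
  proof
    assume "D0 = 0 \<and> D1 = 0 \<and> D2 = 0"
    then have *: "p1 * q0 = p0 * q1" "p2 * q0 = p0 * q2" "p2 * q1 = p1 * q2"
      using two by (auto simp: D0_def D1_def D2_def)
    have "q0 \<noteq> 0 \<or> q1 \<noteq> 0 \<or> q2 \<noteq> 0" using rf_rep(4)[of f] q by auto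
    then have "\<exists>c. p0 = c * q0 \<and> p1 = c * q1 \<and> p2 = c * q2"
    proof (elim disjE)
      assume "q0 \<noteq> 0"
      then show ?thesis using * by (intro exI[of _ "p0 / q0"]) (auto simp: field_simps)
    next
      assume "q1 \<noteq> 0"
      then show ?thesis using * by (intro exI[of _ "p1 / q1"]) (auto simp: field_simps)
    next
      assume "q2 \<noteq> 0"
      then show ?thesis using * by (intro exI[of _ "p2 / q2"]) (auto simp: field_simps)
    qed
    then obtain c where "fibre_poly f (Some c) = 0" by (auto simp: fibre_poly_def p q)
    then show False using fibre_poly_nonzero[of f "Some c"] deg by simp
  qed
  have zero: "D0 + D1 * z + D2 * z\<^sup>2 = 0" if "ramification_index f (Some z) > 1" for z
  proof -
    let ?G = "fibre_poly f (rf_eval f (Some z))"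
    have "Polynomial.order z ?G > 1" using that by (simp add: ramification_index_def Let_def)
    then have "[:- z, 1:] ^ 2 dvd ?G" using order_divides[of z 2 ?G] by auto
    then obtain h where h: "?G = [:- z, 1:] ^ 2 * h" by (rule dvdE)
    define L where "L = [:- z, 1:]"
    have L: "poly L z = 0" by (simp add: L_def)
    have "?G = L * (L * h)" unfolding h L_def by (simp only: power2_eq_square mult.assoc)
    then have G0: "poly ?G z = 0" "poly (pderiv ?G) z = 0"
      by (simp_all add: pderiv_mult L)
    show ?thesis
    proof (cases "rf_eval f (Some z)")
      case None
      then have "q0 + z * (q1 + z * q2) = 0" "q1 + z * (2 * q2) = 0"
        using G0 by (simp_all add: fibre_poly_def q pderiv_pCons algebra_simps)
      moreover have "D0 + D1 * z + D2 * z\<^sup>2 =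
          (p1 + 2 * p2 * z) * (q0 + z * (q1 + z * q2)) - (p0 + p1 * z + p2 * z\<^sup>2) * (q1 + z * (2 * q2))"
        by (simp add: D0_def D1_def D2_def algebra_simps power2_eq_square)
      ultimately show ?thesis by simp
    next
      case (Some c)
      then have "p0 + z * (p1 + z * p2) = c * (q0 + z * (q1 + z * q2))"
        "p1 + z * (2 * p2) = c * (q1 + z * (2 * q2))"
        using G0 by (simp_all add: fibre_poly_def p q pderiv_pCons algebra_simps)
      moreover have "D0 + D1 * z + D2 * z\<^sup>2 =
          (p1 + z * (2 * p2)) * (q0 + z * (q1 + z * q2)) - (p0 + z * (p1 + z * p2)) * (q1 + z * (2 * q2))"
        by (simp add: D0_def D1_def D2_def algebra_simps power2_eq_square)
      ultimately show ?thesis by (simp add: algebra_simps)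
    qed
  qed
  \<comment> \<open>A critical point at infinity shows up as a drop in the degree of the
    Wronskian.\<close>
  have zero_inf: "D2 = 0" if "ramification_index f None > 1"
  proof -
    let ?G = "fibre_poly f (rf_eval f None)"
    have "Polynomial.degree ?G = 0" using that deg by (simp add: ramification_index_def Let_def)
    then have "Polynomial.coeff ?G 1 = 0" "Polynomial.coeff ?G 2 = 0" by (simp_all add: coeff_eq_0)
    then show ?thesis
      by (cases "rf_eval f None") (auto simp: fibre_poly_def p q D2_def numeral_2_eq_2)
  qed
  have one_infinite: "z \<in> F" if "ramification_index f None > 1" "ramification_index f (Some z) > 1" for z
  proof -
    have D: "D0 + D1 * z = 0" "D2 = 0" using zero[OF that(2)] zero_inf[OF that(1)] by auto
    then have "D1 \<noteq> 0" using nz by auto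
    then have "z = - D0 / D1" using D by (simp add: field_simps eq_neg_iff_add_eq_0)
    then show ?thesis using DF by (auto intro: divide_in minus_in)
  qed
  have viete: "D2 \<noteq> 0 \<and> z1 + z2 = - D1 / D2" if c: "c1 = Some z1" "c2 = Some z2" for z1 z2
  proof -
    have z12: "z1 \<noteq> z2" using crit(3) c by auto
    have Z: "D0 + D1 * z1 + D2 * z1\<^sup>2 = 0" "D0 + D1 * z2 + D2 * z2\<^sup>2 = 0"
      using zero crit c by auto
    have "(z1 - z2) * (D1 + D2 * (z1 + z2)) = (D0 + D1 * z1 + D2 * z1\<^sup>2) - (D0 + D1 * z2 + D2 * z2\<^sup>2)"
      by (simp add: algebra_simps power2_eq_square)
    then have sum: "D1 + D2 * (z1 + z2) = 0" using Z z12 by simp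
    have D2: "D2 \<noteq> 0" using sum Z nz by auto
    then have "z1 + z2 = (D1 + D2 * (z1 + z2) - D1) / D2" by (simp add: field_simps)
    then show ?thesis using D2 unfolding sum by simp
  qed
  have both_finite: "z1 \<in> F" if c: "c1 = Some z1" "c2 = Some z2" for z1 z2
  proof (rule ccontr)
    assume z1: "z1 \<notin> F"
    note D2 = conjunct1[OF viete[OF c]]
    have Z: "D0 + D1 * z1 + D2 * z1\<^sup>2 = 0" "D0 + D1 * z2 + D2 * z2\<^sup>2 = 0"
      using zero crit c by auto
    define t where "t = - D1 / D2"
    define n where "n = D0 / D2"
    have tn: "t \<in> F" "n \<in> F" unfolding t_def n_def using DF by (auto intro: divide_in minus_in)
    have t: "z1 + z2 = t" using viete[OF c] by (simp add: t_def)
    have sq: "z1\<^sup>2 = t * z1 - n" "z2\<^sup>2 = t * z2 - n"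
      using Z D2 by (simp_all add: t_def n_def field_simps eq_neg_iff_add_eq_0)
    \<comment> \<open>The graph of the conjugation of \<open>F(z1)\<close> over \<open>F\<close>
      that exchanges \<open>z1\<close> and \<open>z2\<close>, kept as a relation;
      \<open>Rfun\<close> shows that it is single valued.\<close>
    define R where "R = (\<lambda>u w. \<exists>a\<in>F. \<exists>b\<in>F. u = a + b * z1 \<and> w = a + b * z2)"
    have RI: "R u w" if "a \<in> F" "b \<in> F" "u = a + b * z1" "w = a + b * z2" for u w a b
      unfolding R_def using that by blast
    have Rconst: "R a a" if "a \<in> F" for a
      by (rule RI[OF that zero_in]) auto
    have Radd: "R (u + u') (w + w')" if "R u w" "R u' w'" for u w u' w'
    proof -
      obtain a b a' b' where "a \<in> F" "b \<in> F" "a' \<in> F" "b' \<in> F"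
        "u = a + b * z1" "w = a + b * z2" "u' = a' + b' * z1" "w' = a' + b' * z2"
        using \<open>R u w\<close> \<open>R u' w'\<close> unfolding R_def by blast
      then show ?thesis by (intro RI[of "a + a'" "b + b'"]) (auto simp: algebra_simps intro: add_in)
    qed
    have Rmult: "R (u * u') (w * w')" if "R u w" "R u' w'" for u w u' w'
    proof -
      obtain a b a' b' where *: "a \<in> F" "b \<in> F" "a' \<in> F" "b' \<in> F"
        "u = a + b * z1" "w = a + b * z2" "u' = a' + b' * z1" "w' = a' + b' * z2"
        using \<open>R u w\<close> \<open>R u' w'\<close> unfolding R_def by blast
      have "(a + b * z) * (a' + b' * z) = (a * a' - b * b' * n) + (a * b' + b * a' + b * b' * t) * z"
        if "z\<^sup>2 = t * z - n" for z
      proof -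
        have "(a + b * z) * (a' + b' * z) = a * a' + (a * b' + b * a') * z + b * b' * z\<^sup>2"
          by (simp add: algebra_simps power2_eq_square)
        then show ?thesis unfolding that by (simp add: algebra_simps)
      qed
      then show ?thesis
        using * tn sq by (intro RI[of "a * a' - b * b' * n" "a * b' + b * a' + b * b' * t"])
          (auto intro!: add_in diff_in mult_in)
    qed
    have Rsym: "R w u" if "R u w" for u w
    proof -
      obtain a b where "a \<in> F" "b \<in> F" "u = a + b * z1" "w = a + b * z2"
        using \<open>R u w\<close> unfolding R_def by blast
      moreover have "a + b * z2 = (a + b * t) + - b * z1" "a + b * z1 = (a + b * t) + - b * z2"
        by (simp_all flip: t add: algebra_simps)
      ultimately show ?thesis using tn
        by (intro RI[of "a + b * t" "- b"]) (auto intro: add_in mult_in minus_in)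
    qed
    \<comment> \<open>This is where \<open>z1\<close> outside \<open>F\<close> enters: the
      coordinates of \<open>u\<close> with respect to 1 and \<open>z1\<close> are then
      unique.\<close>
    have Rfun: "w = w'" if "R u w" "R u w'" for u w w'
    proof -
      obtain a b a' b' where *: "a \<in> F" "b \<in> F" "a' \<in> F" "b' \<in> F"
        "u = a + b * z1" "w = a + b * z2" "u = a' + b' * z1" "w' = a' + b' * z2"
        using \<open>R u w\<close> \<open>R u w'\<close> unfolding R_def by blast
      have "b = b'"
      proof (rule ccontr)
        assume "b \<noteq> b'"
        moreover have "(b - b') * z1 = a' - a" using * by (simp add: algebra_simps)
        ultimately have "z1 = (a' - a) / (b - b')" by (simp add: field_simps)
        then show False using z1 * by (auto intro: divide_in diff_in)
      qed
      then show ?thesis using * by simp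
    qed
    have Rzero: "u = 0 \<longleftrightarrow> w = 0" if "R u w" for u w
      using Rfun[OF that] Rfun[OF Rsym[OF that]] Rconst[OF zero_in] by blast
    have Rinv: "R (inverse u) (inverse w)" if "R u w" for u w
    proof (cases "u = 0")
      case True
      then show ?thesis using Rzero[OF that] Rconst[OF zero_in] by simp
    next
      case False
      then have w0: "w \<noteq> 0" using Rzero[OF that] by simp
      obtain a b where *: "a \<in> F" "b \<in> F" "u = a + b * z1" "w = a + b * z2"
        using \<open>R u w\<close> unfolding R_def by blast
      have zn: "z1 * z2 = n"
      proof -
        have "z1 * z2 = t * z1 - z1\<^sup>2" by (simp flip: t add: algebra_simps power2_eq_square)
        then show ?thesis unfolding sq by simp
      qed
      have "u * w = a * a + a * b * (z1 + z2) + b * b * (z1 * z2)" unfolding * by (simp add: algebra_simps)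
      \<comment> \<open>The norm of \<open>u\<close> lies in \<open>F\<close>, so inverting
        \<open>u\<close> reduces to inverting an element of \<open>F\<close>.\<close>
      then have uw: "u * w \<in> F" unfolding t zn using * tn by (auto intro!: add_in mult_in)
      have i: "inverse u = w * inverse (u * w)" "inverse w = u * inverse (u * w)"
        using False w0 by (simp_all add: field_simps)
      show ?thesis
        by (subst i(1), subst i(2)) (rule Rmult[OF Rsym[OF that] Rconst[OF inverse_in[OF uw]]])
    qed
    have Rpoly: "R (poly g u) (poly g w)" if "coeffs_in F g" "R u w" for g u w
      using that(1)
      by (induction g) (auto simp: coeffs_in_pCons Rconst[OF zero_in] intro!: Radd Rmult Rconst that(2))
    define E where "E = (\<lambda>y y'. case y of None \<Rightarrow> y' = None | Some u \<Rightarrow> (case y' of None \<Rightarrow> False | Some w \<Rightarrow> R u w))"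
    have Ehval: "R (hval 2 g y) (hval 2 g y')" if "coeffs_in F g" "E y y'" for g y y'
      using that Rpoly Rconst unfolding E_def coeffs_in_iff
      by (cases y; cases y') (auto simp: coeffs_in_iff)
    have Eeval: "E (rf_eval f y) (rf_eval f y')" if "E y y'" for y y'
    proof -
      note n = Ehval[OF coeffs(1) that] and d = Ehval[OF coeffs(2) that]
      have "R (hval 2 (rf_num f) y / hval 2 (rf_den f) y) (hval 2 (rf_num f) y' / hval 2 (rf_den f) y')"
        using Rmult[OF n Rinv[OF d]] by (simp add: field_class.field_divide_inverse)
      then show ?thesis using Rzero[OF d] by (auto simp: rf_eval_hval deg E_def)
    qed
    have E0: "E c1 c2" using RI[OF zero_in one_in] by (simp add: E_def c)
    have Eiter: "E ((rf_eval f ^^ i) c1) ((rf_eval f ^^ i) c2)" for i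
      by (induction i) (auto simp: E0 Eeval)
    \<comment> \<open>Conjugation commutes with \<open>f\<close> and sends \<open>c1\<close> to
      \<open>c2\<close>. Hence it sends \<open>c2\<close> to the \<open>d\<close>-th image of
      \<open>c2\<close>, but also back to \<open>c1\<close>.\<close>
    have "E c2 ((rf_eval f ^^ d) c2)" using Eiter[of d] cycle(1) by simp
    moreover have "E c2 c1" using E0 Rsym by (simp add: E_def c)
    ultimately have "(rf_eval f ^^ d) c2 = c1"
      using Rfun c by (auto simp: E_def split: option.splits)
    then have "(rf_eval f ^^ (2 * d)) c1 = c1" using cycle(1) by (simp add: mult_2 funpow_add)
    then show False using cycle(2) by simp
  qed
  have both_finite': "z2 \<in> F" if c: "c1 = Some z1" "c2 = Some z2" for z1 z2
  proof -
    have "z2 = - D1 / D2 - z1" using viete[OF c] by (simp add: algebra_simps)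
    then show ?thesis using both_finite[OF c] DF by (auto intro!: diff_in divide_in minus_in)
  qed
  show ?thesis
    using one_infinite both_finite both_finite' crit by (cases c1; cases c2) (auto simp: points_over_def)
qed

section \<open>Base change and Galois action\<close>

text \<open>Stated for an arbitrary field homomorphism, as it serves both the embedding
  \<open>to_ac\<close> and the Galois automorphisms.\<close>

lemma map_poly_field_hom:
  fixes h :: "'a::field \<Rightarrow> 'b::field"
  assumes add: "\<And>a b. h (a + b) = h a + h b" and mult: "\<And>a b. h (a * b) = h a * h b" and one: "h 1 = 1"
  shows "h 0 = 0" "map_poly h (p + q) = map_poly h p + map_poly h q"
    "map_poly h (p * q) = map_poly h p * map_poly h q" "map_poly h 1 = 1"
    "h a = 0 \<longleftrightarrow> a = 0" "poly (map_poly h p) (h z) = h (poly p z)" "h (a / b) = h a / h b"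
proof -
  have "h 0 + h 0 = h 0 + 0" using add[of 0 0] by simp
  then show 0: "h 0 = 0" by (simp only: add_left_cancel)
  show "map_poly h 1 = 1" using one by (simp add: one_pCons map_poly_pCons 0)
  show padd: "map_poly h (p + q) = map_poly h p + map_poly h q" for p q
    by (rule poly_eqI) (simp add: coeff_map_poly 0 add)
  have scale: "map_poly h (Polynomial.smult c q) = Polynomial.smult (h c) (map_poly h q)" for c q
    by (rule poly_eqI) (simp add: coeff_map_poly 0 mult)
  show "map_poly h (p * q) = map_poly h p * map_poly h q"
    by (induction p) (simp_all add: map_poly_pCons 0 padd scale)
  show nz: "h a = 0 \<longleftrightarrow> a = 0" for a
  proof
    assume "h a = 0"
    show "a = 0"
    proof (rule ccontr)
      assume "a \<noteq> 0"
      then have "h a * h (inverse a) = 1" using mult[of a "inverse a"] one by simp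
      then show False using \<open>h a = 0\<close> by simp
    qed
  qed (simp add: 0)
  show "poly (map_poly h p) (h z) = h (poly p z)"
    by (induction p) (simp_all add: map_poly_pCons 0 add mult)
  show "h (a / b) = h a / h b"
  proof (cases "b = 0")
    case False
    then have "h (a / b) * h b = h a" by (simp flip: mult)
    then show ?thesis using False nz[of b] by (simp add: field_simps)
  qed (simp add: 0)
qed

lemma coprime_map_poly:
  fixes h :: "'a::field \<Rightarrow> 'b::field"
  assumes hom: "\<And>a b. h (a + b) = h a + h b" "\<And>a b. h (a * b) = h a * h b" "h 1 = 1"
    and "coprime p q"
  shows "coprime (map_poly h p) (map_poly h q)"
proof (rule coprimeI)
  note m = map_poly_field_hom[OF hom]
  obtain a b where "a * p + b * q = 1" using poly_bezout[OF assms(4)] .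
  then have "map_poly h (a * p + b * q) = 1" by (simp add: m(4))
  then have *: "map_poly h a * map_poly h p + map_poly h b * map_poly h q = 1" by (simp add: m)
  fix c assume "c dvd map_poly h p" "c dvd map_poly h q"
  then have "c dvd map_poly h a * map_poly h p + map_poly h b * map_poly h q" by simp
  then show "is_unit c" unfolding * .
qed

text \<open>Bezout identities and leading coefficients are preserved, so a reduced form goes to a
  reduced form.\<close>

lemma rf_rep_map_poly:
  fixes h :: "'a::field \<Rightarrow> 'b::field"
  assumes hom: "\<And>a b. h (a + b) = h a + h b" "\<And>a b. h (a * b) = h a * h b" "h 1 = 1"
    and g: "g = Fraction_Field.Fract (map_poly h (rf_num f)) (map_poly h (rf_den f))"
  shows "rf_num g = map_poly h (rf_num f)" "rf_den g = map_poly h (rf_den f)"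
proof -
  note m = map_poly_field_hom[OF hom]
  have deg: "Polynomial.degree (map_poly h p) = Polynomial.degree p" for p by (rule degree_map_poly) (simp add: m(5))
  have lc: "Polynomial.lead_coeff (map_poly h (rf_den f)) = 1"
    using rf_rep(3)[of f] by (simp add: deg coeff_map_poly m(1) hom(3))
  then have nz: "map_poly h (rf_den f) \<noteq> 0" by auto
  obtain l where l: "l \<noteq> 0" "map_poly h (rf_num f) = Polynomial.smult l (rf_num g)" "map_poly h (rf_den f) = Polynomial.smult l (rf_den g)"
    by (rule rf_repI[OF g coprime_map_poly[OF hom rf_rep(2)] nz])
  have "l = 1" using lc rf_rep(3)[of g] l by simp
  with l show "rf_num g = map_poly h (rf_num f)" "rf_den g = map_poly h (rf_den f)" by simp_all
qed

lemma base_change_rep: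
  "rf_num (base_change f) = map_poly to_ac (rf_num f)" "rf_den (base_change f) = map_poly to_ac (rf_den f)"
  "rf_degree (base_change f) = rf_degree f"
proof -
  show 1: "rf_num (base_change f) = map_poly to_ac (rf_num f)" "rf_den (base_change f) = map_poly to_ac (rf_den f)"
    by (rule rf_rep_map_poly; simp add: base_change_def rf_map_def)+
  have "Polynomial.degree (map_poly to_ac p) = Polynomial.degree p" for p :: "'a poly" by (rule degree_map_poly) simp
  then show "rf_degree (base_change f) = rf_degree f" by (simp add: rf_degree_def 1)
qed

lemma subfield_to_ac: "subfield_set (range (to_ac :: 'k::field \<Rightarrow> 'k alg_closure))"
proof
  show "1 \<in> range (to_ac :: 'k \<Rightarrow> 'k alg_closure)" by (rule range_eqI[of _ _ 1]) simp
  show "a - b \<in> range to_ac" if "a \<in> range to_ac" "b \<in> range to_ac" for a b :: "'k alg_closure"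
    using that by (metis (no_types, lifting) imageE rangeI to_ac_diff)
  show "a * b \<in> range to_ac" if "a \<in> range to_ac" "b \<in> range to_ac" for a b :: "'k alg_closure"
    using that by (metis (no_types, lifting) imageE rangeI to_ac_mult)
  show "inverse a \<in> range to_ac" if "a \<in> range to_ac" for a :: "'k alg_closure"
    using that by (metis (no_types, lifting) imageE rangeI to_ac_inverse)
qed

lemma coeffs_in_base_change:
  "coeffs_in (range to_ac) (rf_num (base_change f))" "coeffs_in (range to_ac) (rf_den (base_change f))"
  by (auto simp: base_change_rep coeffs_in_iff coeff_map_poly)

lemma absolute_galois_groupD:
  assumes "\<tau> \<in> absolute_galois_group"
  shows "\<tau> (a + b) = \<tau> a + \<tau> b" "\<tau> (a * b) = \<tau> a * \<tau> b" "\<tau> 1 = 1" "bij \<tau>" "\<tau> (to_ac c) = to_ac c"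
  using assms by (auto simp: absolute_galois_group_def ring_iso_def ring_hom_def ring_of_type_algebra_def)

text \<open>Some fraction representing \<open>h\<close> has coefficients fixed by
  \<open>\<tau>\<close>, so applying \<open>\<tau>\<close> to the reduced form of \<open>h\<close>
  gives a reduced form of \<open>h\<close> again. By uniqueness the reduced form is fixed, and
  evaluation commutes with \<open>\<tau>\<close>.\<close>

lemma rf_eval_galois:
  fixes h :: "'k::field alg_closure poly fract"
  assumes \<tau>: "\<tau> \<in> absolute_galois_group" and h: "rational_over (range to_ac) h"
  shows "rf_eval h (map_option \<tau> y) = map_option \<tau> (rf_eval h y)"
proof -
  note t = absolute_galois_groupD[OF \<tau>]
  note m = map_poly_field_hom[of \<tau>, OF t(1-3)]
  have fix_poly: "map_poly \<tau> p = p" if "coeffs_in (range to_ac) p" for p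
  proof (rule poly_eqI)
    fix n
    obtain c where "Polynomial.coeff p n = to_ac c" using \<open>coeffs_in (range to_ac) p\<close> unfolding coeffs_in_iff by blast
    then show "Polynomial.coeff (map_poly \<tau> p) n = Polynomial.coeff p n" by (simp add: coeff_map_poly m(1) t(5))
  qed
  obtain p q where pq: "q \<noteq> 0" "h = Fraction_Field.Fract p q" "coeffs_in (range to_ac) p" "coeffs_in (range to_ac) q"
    using h unfolding rational_over_def by blast
  have "rf_num h * q = p * rf_den h"
    using rf_rep(1,4)[of h] pq(1,2) by (metis eq_fract(1))
  then have "map_poly \<tau> (rf_num h * q) = map_poly \<tau> (p * rf_den h)" by simp
  then have eq: "map_poly \<tau> (rf_num h) * q = p * map_poly \<tau> (rf_den h)"
    by (simp add: m fix_poly pq)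
  have "map_poly \<tau> (rf_den h) \<noteq> 0"
    using rf_rep(4)[of h] by (simp add: map_poly_eq_0_iff m(5) m(1))
  then have g: "h = Fraction_Field.Fract (map_poly \<tau> (rf_num h)) (map_poly \<tau> (rf_den h))"
    using pq(1) eq by (subst pq(2)) (simp add: eq_fract mult.commute)
  note r = rf_rep_map_poly[of \<tau>, OF t(1-3) g]
  have hv: "hval d p (map_option \<tau> y) = \<tau> (hval d p y)" if "map_poly \<tau> p = p" for d p
  proof (cases y)
    case None
    then show ?thesis using that by (metis coeff_map_poly hval_simps(2) m(1) option.map_disc_iff)
  next
    case (Some z)
    then show ?thesis using m(6)[of p z] that by simp
  qed
  show ?thesis
    using hv[OF r(1)[symmetric]] hv[OF r(2)[symmetric]] by (simp add: rf_eval_hval m)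
qed

lemma absolute_galois_group_inv:
  assumes "\<tau> \<in> absolute_galois_group"
  shows "inv_into UNIV \<tau> \<in> absolute_galois_group"
proof -
  note t = absolute_galois_groupD[OF assms]
  let ?i = "inv_into UNIV \<tau>"
  have i: "\<tau> (?i a) = a" "?i (\<tau> a) = a" for a
    using t(4) by (simp_all add: bij_def surj_f_inv_f)
  have eq: "?i a = b" if "a = \<tau> b" for a b using that i by simp
  have "?i (a + b) = ?i a + ?i b" "?i (a * b) = ?i a * ?i b" "?i 1 = 1" "?i (to_ac c) = to_ac c" for a b c
    by (rule eq; simp add: t i)+
  moreover have "bij ?i" using t(4) by (rule bij_imp_bij_inv)
  ultimately show ?thesis
    by (auto simp: absolute_galois_group_def ring_iso_def ring_hom_def ring_of_type_algebra_def)
qed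

text \<open>Since the base point is rational, a Galois automorphism acts on the fibre of every cover by
  composition.\<close>

lemma arboreal_subset_iterated_monodromy:
  fixes f :: "'k::field_char_0 alg_closure poly fract"
  assumes tower: "preimage_tower (range to_ac) f c1 c2 (map_option to_ac a)"
    and lab: "tree_labelling f (map_option to_ac a) \<phi>"
  shows "arboreal_galois_group \<phi> \<subseteq> iterated_monodromy (range to_ac) f (map_option to_ac a) \<phi>"
proof
  define F where "F = range (to_ac :: 'k \<Rightarrow> 'k alg_closure)"
  define x where "x = map_option (to_ac :: 'k \<Rightarrow> 'k alg_closure) a"
  interpret preimage_tower F f c1 c2 x using tower by (simp add: F_def x_def)
  have cov: "etale_covers F (post_critical_set f) = covers"
    by (simp add: etale_covers_def covers_def)
  have fib: "etale_fibre F (post_critical_set f) x W = fibre W" for W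
    by (simp add: etale_fibre_def fibre_def)
  fix \<gamma> assume "\<gamma> \<in> arboreal_galois_group \<phi>"
  then obtain \<tau> where aut: "\<gamma> \<in> tree_aut" and \<tau>: "\<tau> \<in> absolute_galois_group"
    and act: "\<And>w. \<phi> (\<gamma> w) = map_option \<tau> (\<phi> w)"
    unfolding arboreal_galois_group_def by blast
  have x_fixed: "map_option \<tau> x = x" if "\<tau> \<in> absolute_galois_group" for \<tau>
    using absolute_galois_groupD(5)[OF that] by (cases a) (simp_all add: x_def)
  \<comment> \<open>At the rational point \<open>x\<close>, functions over the base field have
    values fixed by Galois; this keeps composition with an automorphism inside the fibre.\<close>
  have ev_fixed: "\<tau> (eval_hom A x b) = eval_hom A x b"
    if "\<tau> \<in> absolute_galois_group" "b \<in> carrier A" for \<tau> b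
  proof -
    have "rational_over F b" using that(2) by (simp add: coord_ring_simps(1))
    then have "rational_over (range to_ac) b" unfolding F_def .
    from rf_eval_galois[OF that(1) this, of x] have "map_option \<tau> (rf_eval b x) = rf_eval b x"
      by (simp add: x_fixed[OF that(1)])
    then show ?thesis using that(2) base_point
      by (auto simp: eval_hom_def coord_ring_simps(1))
  qed
  \<comment> \<open>Composition with \<open>\<tau>\<close>, cut down to the carrier because points
    of a fibre are extensional functions.\<close>
  define post where "post = (\<lambda>\<tau> (W :: 'k alg_closure poly fract ring \<times> ('k alg_closure poly fract \<Rightarrow> 'k alg_closure poly fract))
    (\<psi> :: 'k alg_closure poly fract \<Rightarrow> 'k alg_closure). \<lambda>b\<in>carrier (fst W). \<tau> (\<psi> b) :: 'k alg_closure)"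
  have post_fibre: "post \<tau> W \<psi> \<in> fibre W"
    if "\<tau> \<in> absolute_galois_group" "W \<in> covers" "\<psi> \<in> fibre W" for \<tau> W \<psi>
  proof -
    interpret W: cring "fst W" using coversD that by simp
    note t = absolute_galois_groupD[OF that(1)]
    have p: "\<psi> \<in> ring_hom (fst W) K" "\<And>b. b \<in> carrier A \<Longrightarrow> \<psi> (snd W b) = eval_hom A x b"
      using that(3) by (auto simp: fibre_iff)
    have "post \<tau> W \<psi> \<in> ring_hom (fst W) K"
      by (rule ring_hom_memI) (auto simp: post_def ring_homD[OF p(1)] t)
    then show ?thesis
      using ring_homD(1)[OF coversD(2)[OF that(2)]] p(2) ev_fixed[OF that(1)]
      by (auto simp: fibre_iff post_def)
  qed
  have post_inverse: "post \<tau> W (post \<tau>' W \<psi>) = \<psi>"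
    if "\<And>c. \<tau> (\<tau>' c) = c" "\<psi> \<in> fibre W" for \<tau> \<tau>' W \<psi>
    using that by (auto simp: post_def fibre_iff extensional_def fun_eq_iff)
  let ?i = "inv_into UNIV \<tau>"
  have i: "?i \<in> absolute_galois_group" by (rule absolute_galois_group_inv[OF \<tau>])
  have inv: "\<tau> (?i c) = c" "?i (\<tau> c) = c" for c
    using absolute_galois_groupD(4)[OF \<tau>] by (simp_all add: bij_def surj_f_inv_f)
  define \<sigma> where "\<sigma> = (\<lambda>W\<in>covers. \<lambda>\<psi>\<in>fibre W. post \<tau> W \<psi>)"
  have bij: "\<sigma> W \<in> Bij (fibre W)" if W: "W \<in> covers" for W
  proof -
    have "bij_betw (post \<tau> W) (fibre W) (fibre W)"
      by (rule bij_betw_byWitness[of _ "post ?i W"])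
        (auto simp: post_inverse inv post_fibre[OF \<tau> W] post_fibre[OF i W])
    then show ?thesis using W by (simp add: \<sigma>_def Bij_def)
  qed
  have "\<sigma> \<in> etale_pi1 F (post_critical_set f) x"
    unfolding etale_pi1_def cov fib
  proof (intro CollectI conjI ballI)
    show "\<sigma> \<in> (\<Pi>\<^sub>E W\<in>covers. Bij (fibre W))" using bij by (auto simp: \<sigma>_def)
    fix Y Z h \<psi> assume *: "Y \<in> covers" "Z \<in> covers" "h \<in> algebra_hom A Y Z" "\<psi> \<in> fibre Z"
    then have "compose (carrier (fst Y)) \<psi> h \<in> fibre Y" by (intro compose_fibre)
    moreover have "\<And>b. b \<in> carrier (fst Y) \<Longrightarrow> h b \<in> carrier (fst Z)"
      using *(3) by (auto simp: algebra_hom_iff dest: ring_homD(1))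
    ultimately show "\<sigma> Y (compose (carrier (fst Y)) \<psi> h) = compose (carrier (fst Y)) (\<sigma> Z \<psi>) h"
      using * by (auto simp: \<sigma>_def post_def compose_def fun_eq_iff)
  qed
  moreover have "ev (length w) (\<phi> (\<gamma> w)) = \<sigma> (V (length w)) (ev (length w) (\<phi> w))" for w
  proof -
    let ?l = "length w"
    have y: "(rf_eval f ^^ ?l) (\<phi> w) = x"
      using lab unfolding tree_labelling_def bij_betw_def x_def by blast
    have "ev ?l (map_option \<tau> (\<phi> w)) h = post \<tau> (V ?l) (ev ?l (\<phi> w)) h" for h
    proof (cases "h \<in> carrier (B ?l)")
      case True
      then have "rational_over F h" "rf_eval h (\<phi> w) \<noteq> None"
        using not_in_level[OF y] by (auto simp: coord_ring_simps(1))
      then have "rational_over (range to_ac) h" "rf_eval h (\<phi> w) \<noteq> None" unfolding F_def by auto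
      then show ?thesis
        using True rf_eval_galois[OF \<tau>, of h "\<phi> w"] by (auto simp: post_def eval_hom_def)
    next
      case False
      then show ?thesis by (simp add: post_def eval_hom_def)
    qed
    then have "ev ?l (map_option \<tau> (\<phi> w)) = post \<tau> (V ?l) (ev ?l (\<phi> w))" by (rule ext)
    then show ?thesis using V_cover ev_fibre[OF y] by (simp add: \<sigma>_def act)
  qed
  ultimately have "\<gamma> \<in> iterated_monodromy F f x \<phi>"
    unfolding iterated_monodromy_def using aut by (auto intro!: bexI[of _ \<sigma>])
  then show "\<gamma> \<in> iterated_monodromy (range to_ac) f (map_option to_ac a) \<phi>"
    by (simp add: F_def x_def)
qed

text \<open>The closure of the empty set is empty, so a group without settled elements fails to be
  densely settled because it has at least this element.\<close>

lemma id_in_arboreal_galois_group: "id \<in> arboreal_galois_group \<phi>"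
proof -
  have "id \<in> absolute_galois_group"
    by (auto simp: absolute_galois_group_def ring_iso_def ring_hom_def ring_of_type_algebra_def)
  moreover have "id \<in> tree_aut" by (simp add: tree_aut_def)
  ultimately show ?thesis
    unfolding arboreal_galois_group_def by (auto intro!: bexI[of _ id] simp: option.map_id)
qed

section \<open>Arithmetic of the critical cycle and conclusion\<close>

lemma critical_cycle_period:
  fixes p :: "nat \<Rightarrow> 'a" and g :: "'a \<Rightarrow> 'a"
  assumes "r > 0" and inj: "inj_on p {1..r}" and p: "\<And>i. i \<in> {1..r} \<Longrightarrow> p i = (g ^^ i) (p r)"
  shows "(g ^^ i) (p r) = p r \<longleftrightarrow> r dvd i"
proof -
  have fix_r: "(g ^^ r) (p r) = p r" using p[of r] assms(1) by simp
  have mult: "(g ^^ (r * m)) (p r) = p r" for m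
    by (induction m) (simp_all add: funpow_add fix_r)
  have "(g ^^ i) (p r) = (g ^^ (i mod r + r * (i div r))) (p r)" by simp
  then have mod: "(g ^^ i) (p r) = (g ^^ (i mod r)) (p r)"
    by (simp only: funpow_add comp_apply mult)
  show ?thesis
  proof
    assume *: "(g ^^ i) (p r) = p r"
    show "r dvd i"
    proof (rule ccontr)
      assume "\<not> r dvd i"
      then have m: "0 < i mod r" "i mod r < r" using assms(1) by (auto simp: dvd_eq_mod_eq_0)
      then have "p (i mod r) = p r" using p[of "i mod r"] * mod by simp
      then have "i mod r = r" using inj_onD[OF inj, of "i mod r" r] m by simp
      then show False using m by simp
    qed
  next
    assume "r dvd i"
    then show "(g ^^ i) (p r) = p r" using mod by (simp add: dvd_eq_mod_eq_0)
  qed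
qed

theorem theorem5p9:
  fixes f :: "'k::field_char_0 poly fract"
    and p :: "nat \<Rightarrow> 'k alg_closure option"
    and r s :: nat
  assumes "number_field TYPE('k)"
    and "rf_degree f = 2"
    and "r \<ge> 3"
    and "post_critical_set (base_change f) = p ` {1..r}"
    and "inj_on p {1..r}"
    and "\<And>i. i \<in> {1..r} \<Longrightarrow> p i = (rf_eval (base_change f) ^^ i) (p r)"
    and "1 < s" and "s \<le> r"
    and "critical_points (base_change f) = {p r, p (s - 1)}"
    and "odd r \<or> (even r \<and> odd s \<and> odd (r div gcd r (s - 1)))"
  shows "(\<forall>x\<^sub>0 \<phi>. map_option to_ac x\<^sub>0 \<notin> post_critical_set (base_change f) \<longrightarrow>
            tree_labelling (base_change f) (map_option to_ac x\<^sub>0) \<phi> \<longrightarrow>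
            (\<forall>\<gamma>\<in>G_arith f x\<^sub>0 \<phi>. \<not> settled \<gamma>) \<and> (\<forall>\<gamma>\<in>G_geom f x\<^sub>0 \<phi>. \<not> settled \<gamma>)) \<and>
         (\<forall>a \<phi>. map_option to_ac a \<notin> post_critical_set (base_change f) \<longrightarrow>
            tree_labelling (base_change f) (map_option to_ac a) \<phi> \<longrightarrow>
            \<not> densely_settled (arboreal_galois_group \<phi>))"
proof -
  define g where "g = base_change f"
  \<comment> \<open>The number of steps from the critical point \<open>p r\<close> to the other one,
    and hence from \<open>v1\<close> to \<open>v2\<close>.\<close>
  define d where "d = s - 1"
  \<comment> \<open>The least positive multiplier for which \<open>r\<close> divides
    \<open>q * d\<close>.\<close>
  define q where "q = r div gcd r d"
  have d: "0 < d" "d < r" "s - 1 = d" using assms(7,8) by (auto simp: d_def)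
  have r0: "r > 0" using assms(3) by simp
  have pcs: "post_critical_set g = p ` {1..r}" using assms(4) unfolding g_def .
  have crit: "critical_points g = {p r, p d}" using assms(9) unfolding g_def d(3) .
  have p: "p i = (rf_eval g ^^ i) (p r)" if "i \<in> {1..r}" for i
    unfolding g_def by (rule assms(6)[OF that])
  have period: "(rf_eval g ^^ i) (p r) = p r \<longleftrightarrow> r dvd i" for i
    by (rule critical_cycle_period[OF r0 assms(5)]) (rule p)
  have q: "odd q"
  proof (cases "odd r")
    case True
    have "q * gcd r d = r" unfolding q_def by simp
    then show ?thesis using True by (metis even_mult_iff)
  next
    case False
    then show ?thesis using assms(10) unfolding q_def d(3) by blast
  qed
  have qd: "r dvd q * d"
  proof -
    obtain e where "d = gcd r d * e" by (meson dvdE gcd_dvd2)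
    then have "q * d = (q * gcd r d) * e" by (metis mult.assoc)
    then show ?thesis by (simp add: q_def)
  qed
  \<comment> \<open>An odd \<open>q\<close> is coprime to 2, so if \<open>r\<close> divided
    \<open>2 * d\<close> it would divide \<open>d\<close>, which lies strictly between 0 and
    \<open>r\<close>. This supplies the cycle condition of
    \<open>critical_points_rational\<close>.\<close>
  have not_2d: "\<not> r dvd 2 * d"
  proof
    assume "r dvd 2 * d"
    then have "q * gcd r d dvd (2 * (d div gcd r d)) * gcd r d"
      by (simp add: q_def mult.assoc)
    then have "q dvd 2 * (d div gcd r d)" using r0 by simp
    then have "q dvd d div gcd r d" using q
      by (metis coprime_dvd_mult_right_iff coprime_right_2_iff_odd)
    then have "q * gcd r d dvd (d div gcd r d) * gcd r d" by (rule mult_dvd_mono) simp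
    then have "r dvd d" by (simp add: q_def)
    then show False using d by (auto dest: dvd_imp_le)
  qed
  have "d \<in> {1..r}" using d by simp
  then have c2: "(rf_eval g ^^ d) (p r) = p d" by (rule p[symmetric])
  have neq: "p r \<noteq> p d" using inj_onD[OF assms(5), of r d] d r0 by auto
  have ram: "ramification_index g (p r) > 1" "ramification_index g (p d) > 1"
    using crit unfolding critical_points_def by auto
  have deg: "rf_degree g = 2" using assms(2) by (simp add: g_def base_change_rep)
  have coeffs: "coeffs_in (range to_ac) (rf_num g)" "coeffs_in (range to_ac) (rf_den g)"
    unfolding g_def by (rule coeffs_in_base_change)+
  interpret k: subfield_set "range to_ac :: 'k alg_closure set" by (rule subfield_to_ac)
  have over: "p r \<in> points_over (range to_ac) \<and> p d \<in> points_over (range to_ac)"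
    by (rule k.critical_points_rational[OF _ deg coeffs ram neq c2]) (use period not_2d in simp_all)
  \<comment> \<open>One construction for both groups: points rational over the number field stay
    rational over a larger field of constants.\<close>
  have tower: "preimage_tower F g (p r) (p d) x"
    if F: "range to_ac \<subseteq> F" "subfield_set F" and x: "x \<notin> post_critical_set g" for F x
  proof -
    interpret subfield_set F by fact
    have pts: "points_over (range to_ac) \<subseteq> points_over F" using F(1) by (auto simp: points_over_def)
    interpret quadratic_rational_map F g "p r" "p d"
    proof
      show "coeffs_in F (rf_num g)" "coeffs_in F (rf_den g)"
        using coeffs F(1) by (auto simp: coeffs_in_iff)
      show "p r \<in> points_over F" "p d \<in> points_over F" using over pts by auto
    qed (use deg ram neq in auto)
    show ?thesis
    proof
      show "finite (post_critical_set g)" by (simp add: pcs)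
      have "(rf_eval g ^^ n) c \<in> points_over F" if "c \<in> points_over F" for n c
        using that by (induction n) (auto intro: eval_over)
      then show "post_critical_set g \<subseteq> points_over F"
        using over pts crit by (auto simp: post_critical_set_def)
      show "v1 \<in> post_critical_set g" "v2 \<in> post_critical_set g"
        unfolding post_critical_set_def crit v1_def v2_def
        by (auto intro!: exI[of _ "Suc 0"])
      show "rf_eval g y \<in> post_critical_set g" if "y \<in> post_critical_set g" for y
      proof -
        obtain n c where "n \<ge> 1" "c \<in> critical_points g" "y = (rf_eval g ^^ n) c"
          using \<open>y \<in> post_critical_set g\<close> unfolding post_critical_set_def by blast
        then show ?thesis
          unfolding post_critical_set_def by (intro CollectI exI[of _ "Suc n"] exI[of _ c]) simp
      qed
    qed (fact x)
  qed
  have main: "\<not> settled \<gamma>"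
    if F: "range to_ac \<subseteq> F" "subfield_set F" and x: "x \<notin> post_critical_set g"
      and lab: "tree_labelling g x \<phi>" and \<gamma>: "\<gamma> \<in> iterated_monodromy F g x \<phi>" for F x \<phi> \<gamma>
  proof -
    interpret preimage_tower F g "p r" "p d" x by (rule tower[OF F x])
    \<comment> \<open>\<open>v1\<close> is the image of \<open>p r\<close>, so the cycle relations
      of the critical points carry over to the critical values.\<close>
    have "(rf_eval g ^^ m) v1 = rf_eval g ((rf_eval g ^^ m) (p r))" for m
      by (simp add: v1_def funpow_swap1)
    then have "(rf_eval g ^^ d) v1 = v2" "(rf_eval g ^^ (q * d)) v1 = v1"
      using c2 period[of "q * d"] qd by (simp_all add: v1_def v2_def)
    then show ?thesis by (rule iterated_monodromy_not_settled[OF lab \<gamma> _ _ q])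
  qed
  have UNIV: "subfield_set (UNIV :: 'k alg_closure set)" by standard auto
  have arith: "\<not> settled \<gamma>"
    if "map_option to_ac a \<notin> post_critical_set g" "tree_labelling g (map_option to_ac a) \<phi>"
      "\<gamma> \<in> iterated_monodromy (range to_ac) g (map_option to_ac a) \<phi>" for a \<phi> \<gamma>
    using main[OF order_refl subfield_to_ac that] .
  have geom: "\<not> settled \<gamma>"
    if "map_option to_ac a \<notin> post_critical_set g" "tree_labelling g (map_option to_ac a) \<phi>"
      "\<gamma> \<in> iterated_monodromy UNIV g (map_option to_ac a) \<phi>" for a \<phi> \<gamma>
    using main[OF subset_UNIV UNIV that] .
  have arboreal: "\<not> densely_settled (arboreal_galois_group \<phi>)"
    if a: "map_option to_ac a \<notin> post_critical_set g" "tree_labelling g (map_option to_ac a) \<phi>" for a \<phi>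
  proof -
    have "\<not> settled \<gamma>" if "\<gamma> \<in> arboreal_galois_group \<phi>" for \<gamma>
      using arboreal_subset_iterated_monodromy[OF tower[OF order_refl subfield_to_ac a(1)] a(2)]
        arith[OF a] that by blast
    then have empty: "{\<gamma> \<in> arboreal_galois_group \<phi>. settled \<gamma>} = {}" by blast
    show ?thesis
      using id_in_arboreal_galois_group[of \<phi>] unfolding densely_settled_def empty by auto
  qed
  show ?thesis
    using arith geom arboreal unfolding G_arith_def G_geom_def g_def by blast
qed

end
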